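(* Let $\mathcal{H}_A,\mathcal{H}_B$ be finite-dimensional Hilbert spaces and let $\mathcal{S}^{AB}=\{p_i,|\psi_i\rangle\}_{i=1}^n$ be a finite ensemble of pure states $|\psi_i\rangle\in\mathcal{H}_A\otimes\mathcal{H}_B$ with probabilities $p_i>0$, $\sum_i p_i=1$. Let $\rho^{AB}=\sum_i p_i|\psi_i\rangle\langle\psi_i|$, $\rho^A=\mathrm{Tr}_B\,\rho^{AB}$, $\rho^B=\mathrm{Tr}_A\,\rho^{AB}$, and assume $S(\rho^{AB})>0$. Then for every proper measure of entanglement $E$, $$\mathcal{R}_E\left(\mathcal{S}^{AB}\right)\le 1-\frac{\left|S\left(\rho^{A}\right)-S\left(\rho^{B}\right)\right|}{S\left(\rho^{AB}\right)}.$$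
   Context: $S(\cdot)$ denotes the von Neumann entropy and $H(\{p_i\})=-\sum_i p_i\log p_i$ the Shannon entropy. A proper measure of entanglement is a function $E$ on bipartite states (for all finite dimensions) which is an entanglement monotone (non-increasing under LOCC), equals the entropy of entanglement on pure states (i.e. $E(|\psi\rangle)=S(\mathrm{Tr}_B|\psi\rangle\langle\psi|)$), and is asymptotically continuous. For an ensemble $\mathcal{S}^{AB}=\{p_i,\sigma_i\}$ of bipartite states (viewed as an i.i.d. source: $N$ uses produce $\sigma_{i_1}\otimes\cdots\otimes\sigma_{i_N}$ with probability $p_{i_1}\cdots p_{i_N}$), define $$E\left(\mathcal{S}^{AB}\right)=\lim_{N\to\infty}\frac1N\sum_{i_1,\dots,i_N}p_{i_1}\cdots p_{i_N}\,E\left(\sigma_{i_1}\otimes\cdots\otimes\sigma_{i_N}\right),$$ where the bipartite cut places all $A$ subsystems on one side and all $B$ subsystems on the other. For a bipartite state $\rho$, $E^{\infty}(\rho)=\lim_{N\to\infty}\frac1N E(\rho^{\otimes N})$. The unlocking rate of the source is $$\mathcal{R}_E\left(\mathcal{S}^{AB}\right)=\frac{E\left(\mathcal{S}^{AB}\right)-E^{\infty}(\rho)}{H(\{p_i\})},\qquad \rho=\sum_i p_i\sigma_i.$$ (Note $H(\{p_i\})\ge S(\rho^{AB})>0$ under the hypotheses.) *)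

theory Defs
  imports Complex_Main "Jordan_Normal_Form.Char_Poly"
begin

text \<open>A bipartite system A B with local dimensions dA, dB is modelled on
  C^(dA*dB); the basis vector |a>|b> has index a*dB+b.  Logarithms are base 2
  throughout (the claimed inequality is invariant under the choice of base).\<close>

definition adj :: "complex mat \<Rightarrow> complex mat" where
  "adj A = mat (dim_col A) (dim_row A) (\<lambda>(i,j). cnj (A $$ (j,i)))"

definition psd :: "complex mat \<Rightarrow> bool" where
  "psd A \<longleftrightarrow> A = adj A \<and>
     (\<forall>v::complex vec. dim_vec v = dim_row A \<longrightarrow>
        0 \<le> Re (\<Sum>i<dim_row A. cnj (v $ i) * (A *\<^sub>v v) $ i))"

definition mtrace :: "complex mat \<Rightarrow> complex" where
  "mtrace A = (\<Sum>i<dim_row A. A $$ (i,i))"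

definition density_op :: "nat \<Rightarrow> complex mat \<Rightarrow> bool" where
  "density_op d \<rho> \<longleftrightarrow> \<rho> \<in> carrier_mat d d \<and> psd \<rho> \<and> mtrace \<rho> = 1"

definition bstate :: "nat \<Rightarrow> nat \<Rightarrow> complex mat \<Rightarrow> bool" where
  "bstate dA dB \<rho> \<longleftrightarrow> density_op (dA * dB) \<rho>"

definition unit_vector :: "complex vec \<Rightarrow> bool" where
  "unit_vector v \<longleftrightarrow> (\<Sum>i<dim_vec v. (cmod (v $ i))\<^sup>2) = 1"

definition proj :: "complex vec \<Rightarrow> complex mat" where
  "proj v = mat (dim_vec v) (dim_vec v) (\<lambda>(i,j). v $ i * cnj (v $ j))"

definition xlogx :: "real \<Rightarrow> real" where
  "xlogx x = (if x \<le> 0 then 0 else x * log 2 x)"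

definition eigvals :: "complex mat \<Rightarrow> complex multiset" where
  "eigvals A = proots (char_poly A)"

definition vN_entropy :: "complex mat \<Rightarrow> real" where
  "vN_entropy \<rho> = - sum_mset (image_mset (\<lambda>x. xlogx (Re x)) (eigvals \<rho>))"

definition shannon :: "nat \<Rightarrow> (nat \<Rightarrow> real) \<Rightarrow> real" where
  "shannon n p = - (\<Sum>i<n. xlogx (p i))"

definition trace_norm :: "complex mat \<Rightarrow> real" where
  "trace_norm A = sum_mset (image_mset (\<lambda>x. sqrt (Re x)) (eigvals (adj A * A)))"

definition ptrace_B :: "nat \<Rightarrow> nat \<Rightarrow> complex mat \<Rightarrow> complex mat" where
  "ptrace_B dA dB \<rho> = mat dA dA (\<lambda>(a,a'). \<Sum>b<dB. \<rho> $$ (a*dB+b, a'*dB+b))"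

definition ptrace_A :: "nat \<Rightarrow> nat \<Rightarrow> complex mat \<Rightarrow> complex mat" where
  "ptrace_A dA dB \<rho> = mat dB dB (\<lambda>(b,b'). \<Sum>a<dA. \<rho> $$ (a*dB+b, a*dB+b'))"

definition kron :: "complex mat \<Rightarrow> complex mat \<Rightarrow> complex mat" where
  "kron A B = mat (dim_row A * dim_row B) (dim_col A * dim_col B)
     (\<lambda>(i,j). A $$ (i div dim_row B, j div dim_col B) * B $$ (i mod dim_row B, j mod dim_col B))"

text \<open>Tensor product of a state on A1B1 (dims dA1,dB1) and a state on A2B2 (dims dA2,dB2),
  viewed as a bipartite state on (A1A2)(B1B2), i.e. with all A parts on one side
  and all B parts on the other.\<close>
definition btensor :: "nat \<Rightarrow> nat \<Rightarrow> nat \<Rightarrow> nat \<Rightarrow> complex mat \<Rightarrow> complex mat \<Rightarrow> complex mat" where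
  "btensor dA1 dB1 dA2 dB2 \<rho>1 \<rho>2 =
     mat ((dA1*dA2)*(dB1*dB2)) ((dA1*dA2)*(dB1*dB2)) (\<lambda>(i,j).
       let a = i div (dB1*dB2); b = i mod (dB1*dB2);
           a' = j div (dB1*dB2); b' = j mod (dB1*dB2);
           a1 = a div dA2; a2 = a mod dA2; b1 = b div dB2; b2 = b mod dB2;
           a1' = a' div dA2; a2' = a' mod dA2; b1' = b' div dB2; b2' = b' mod dB2
       in \<rho>1 $$ (a1*dB1+b1, a1'*dB1+b1') * \<rho>2 $$ (a2*dB2+b2, a2'*dB2+b2'))"

fun btensor_list :: "nat \<Rightarrow> nat \<Rightarrow> complex mat list \<Rightarrow> complex mat" where
  "btensor_list dA dB [] = 1\<^sub>m 1"
| "btensor_list dA dB (r # rs) =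
     btensor dA dB (dA ^ length rs) (dB ^ length rs) r (btensor_list dA dB rs)"

definition kraus_sum :: "nat \<Rightarrow> complex mat list \<Rightarrow> complex mat" where
  "kraus_sum d Ks = foldr (\<lambda>K acc. adj K * K + acc) Ks (0\<^sub>m d d)"

definition apply_kraus :: "nat \<Rightarrow> complex mat list \<Rightarrow> complex mat \<Rightarrow> complex mat" where
  "apply_kraus d' Ks \<rho> = foldr (\<lambda>K acc. K * \<rho> * adj K + acc) Ks (0\<^sub>m d' d')"

text \<open>LOCC_instr dA dB dA' dB' Ks: Ks is an LOCC instrument from C^dA (x) C^dB to
  C^dA' (x) C^dB'; outcome k is the CP map with Kraus operators Ks!k.
  Local instruments of either party, classical communication of the outcome
  (the next round may depend on all previous outcomes), and coarse-graining.\<close>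
inductive LOCC_instr :: "nat \<Rightarrow> nat \<Rightarrow> nat \<Rightarrow> nat \<Rightarrow> complex mat list list \<Rightarrow> bool" where
  localA: "\<lbrakk> \<forall>K \<in> set (concat Ks). K \<in> carrier_mat dA' dA;
            kraus_sum dA (concat Ks) = 1\<^sub>m dA \<rbrakk>
          \<Longrightarrow> LOCC_instr dA dB dA' dB (map (map (\<lambda>K. kron K (1\<^sub>m dB))) Ks)"
| localB: "\<lbrakk> \<forall>K \<in> set (concat Ks). K \<in> carrier_mat dB' dB;
            kraus_sum dB (concat Ks) = 1\<^sub>m dB \<rbrakk>
          \<Longrightarrow> LOCC_instr dA dB dA dB' (map (map (\<lambda>K. kron (1\<^sub>m dA) K)) Ks)"
| compose: "\<lbrakk> LOCC_instr dA dB dA1 dB1 Ks; length Ls = length Ks;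
             \<forall>k<length Ks. LOCC_instr dA1 dB1 dA2 dB2 (Ls ! k) \<rbrakk>
          \<Longrightarrow> LOCC_instr dA dB dA2 dB2
                (concat (map (\<lambda>(K, Lk). map (\<lambda>L. [l * k. l \<leftarrow> L, k \<leftarrow> K]) Lk) (zip Ks Ls)))"
| coarse: "LOCC_instr dA dB dA' dB' Ks \<Longrightarrow> LOCC_instr dA dB dA' dB' [concat Ks]"

text \<open>An LOCC channel is the sum over all outcomes of an LOCC instrument.\<close>

definition LOCC_monotone :: "(nat \<Rightarrow> nat \<Rightarrow> complex mat \<Rightarrow> real) \<Rightarrow> bool" where
  "LOCC_monotone E \<longleftrightarrow>
     (\<forall>dA dB dA' dB' Ks \<rho>. bstate dA dB \<rho> \<longrightarrow> LOCC_instr dA dB dA' dB' Ks \<longrightarrow>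
        E dA' dB' (apply_kraus (dA' * dB') (concat Ks) \<rho>) \<le> E dA dB \<rho>)"

definition pure_normalized :: "(nat \<Rightarrow> nat \<Rightarrow> complex mat \<Rightarrow> real) \<Rightarrow> bool" where
  "pure_normalized E \<longleftrightarrow>
     (\<forall>dA dB \<psi>. \<psi> \<in> carrier_vec (dA * dB) \<longrightarrow> unit_vector \<psi> \<longrightarrow>
        E dA dB (proj \<psi>) = vN_entropy (ptrace_B dA dB (proj \<psi>)))"

definition asymptotically_continuous :: "(nat \<Rightarrow> nat \<Rightarrow> complex mat \<Rightarrow> real) \<Rightarrow> bool" where
  "asymptotically_continuous E \<longleftrightarrow>
     (\<forall>(dA :: nat \<Rightarrow> nat) (dB :: nat \<Rightarrow> nat) (\<rho> :: nat \<Rightarrow> complex mat) \<sigma>.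
        (\<forall>m. bstate (dA m) (dB m) (\<rho> m) \<and> bstate (dA m) (dB m) (\<sigma> m)) \<longrightarrow>
        (\<lambda>m. trace_norm (\<rho> m - \<sigma> m)) \<longlonglongrightarrow> 0 \<longrightarrow>
        (\<lambda>m. \<bar>E (dA m) (dB m) (\<rho> m) - E (dA m) (dB m) (\<sigma> m)\<bar>
               / (1 + log 2 (real (dA m * dB m)))) \<longlonglongrightarrow> 0)"

definition proper_measure :: "(nat \<Rightarrow> nat \<Rightarrow> complex mat \<Rightarrow> real) \<Rightarrow> bool" where
  "proper_measure E \<longleftrightarrow> LOCC_monotone E \<and> pure_normalized E \<and> asymptotically_continuous E"

definition ens_state :: "nat \<Rightarrow> nat \<Rightarrow> (nat \<Rightarrow> real) \<Rightarrow> (nat \<Rightarrow> complex mat) \<Rightarrow> complex mat" where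
  "ens_state d n p \<sigma> = mat d d (\<lambda>(r,c). \<Sum>i<n. complex_of_real (p i) * \<sigma> i $$ (r,c))"

definition source_E_seq ::
  "(nat \<Rightarrow> nat \<Rightarrow> complex mat \<Rightarrow> real) \<Rightarrow> nat \<Rightarrow> nat \<Rightarrow> nat \<Rightarrow> (nat \<Rightarrow> real) \<Rightarrow> (nat \<Rightarrow> complex mat) \<Rightarrow> nat \<Rightarrow> real" where
  "source_E_seq E dA dB n p \<sigma> N =
     (\<Sum>is \<in> {is. set is \<subseteq> {..<n} \<and> length is = N}.
        (\<Prod>j<N. p (is ! j)) * E (dA ^ N) (dB ^ N) (btensor_list dA dB (map \<sigma> is))) / real N"

definition reg_E_seq ::
  "(nat \<Rightarrow> nat \<Rightarrow> complex mat \<Rightarrow> real) \<Rightarrow> nat \<Rightarrow> nat \<Rightarrow> complex mat \<Rightarrow> nat \<Rightarrow> real" where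
  "reg_E_seq E dA dB \<rho> N = E (dA ^ N) (dB ^ N) (btensor_list dA dB (replicate N \<rho>)) / real N"

end

theory Submission
  imports Defs "Jordan_Normal_Form.Schur_Decomposition" "Jordan_Normal_Form.Spectral_Radius"
begin

text \<open>On pure product states the measure is the sum of the local entropies, so \<open>E(\<S>)\<close> is the average
  entropy of the reduced states, which by concavity is at most \<open>S(\<rho>\<^sup>A)\<close> and at most \<open>S(\<rho>\<^sup>B)\<close>. The hashing inequality
  \<open>E\<^sup>\<infinity>(\<rho>) \<ge> max (S(\<rho>\<^sup>A)) (S(\<rho>\<^sup>B)) - S(\<rho>\<^sup>A\<^sup>B)\<close> then bounds the numerator of the rate by
  \<open>S(\<rho>\<^sup>A\<^sup>B) - \<bar>S(\<rho>\<^sup>A) - S(\<rho>\<^sup>B)\<bar>\<close>, which is nonnegative by Araki--Lieb, and \<open>H({p\<^sub>i}) \<ge> S(\<rho>\<^sup>A\<^sup>B)\<close>.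

  The hashing inequality comes from a one-way protocol. Alice measures with Kraus operators
  \<open>X\<^sub>s : A \<rightarrow> \<complex>\<^sup>K\<close> whose entries are phases with the second and fourth moments of independent uniform phases;
  this is an exact measurement, and it almost decouples the \<open>K\<close>-dimensional system from the purifying system
  as long as \<open>K\<close> is below (smallest typical eigenvalue of \<open>\<rho>\<^sup>A\<^sup>B\<close>) / (largest typical eigenvalue of \<open>\<rho>\<^sup>B\<close>).
  Bob decodes with the polar factor of the resulting amplitude matrix, which gives a state close to
  the maximally entangled state of rank \<open>K\<close>. A Chernoff bound on the spectra of \<open>N\<close> copies makes
  \<open>log K \<approx> N (S(\<rho>\<^sup>B) - S(\<rho>\<^sup>A\<^sup>B))\<close> possible, and asymptotic continuity on the \<open>K \<times> K\<close>-dimensional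
  output transfers this rate to \<open>E\<close>.\<close>

subsection \<open>Unitary diagonalization\<close>

text \<open>A lower bound on \<open>E\<close> of a mixed state has to come from monotonicity,
  through an explicit LOCC channel with nearly pure output. \<open>LOCC_instr\<close> admits only
  finite lists of Kraus operators, so the random measurement is a finite ensemble. Moments up to the
  fourth suffice because the Gram matrix of the amplitudes enters the fidelity estimate only through
  its first and second powers, and it is quadratic in the phases. After division of the amplitudes
  by the square roots of the eigenvalues \<open>\<mu> r\<close>, this matrix should be close to the
  identity; its second power contributes an error \<open>K * \<nu>0 / \<mu>0\<close>, and this is
  the whole restriction on \<open>K\<close>. Either party may measure first; the marginal that
  enters the bound is the one of the party that decodes, so the two directions together give the
  maximum of the marginal entropies. The averaged entropy lies below their minimum, and minimum
  minus maximum is where the absolute value comes from. Entropies and trace norms are defined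
  through roots of characteristic polynomials, hence every spectral statement is first reduced to an
  explicit unitary diagonalization.\<close>

lemma dim_adj [simp]: "dim_row (adj A) = dim_col A" "dim_col (adj A) = dim_row A"
  by (auto simp: adj_def)

lemma index_adj [simp]: "i < dim_col A \<Longrightarrow> j < dim_row A \<Longrightarrow> adj A $$ (i,j) = cnj (A $$ (j,i))"
  by (auto simp: adj_def)

lemma adj_carrier [simp]: "adj A \<in> carrier_mat m n \<longleftrightarrow> A \<in> carrier_mat n m"
  by (metis carrier_matD carrier_matI dim_adj)

lemma adj_adj [simp]: "adj (adj A) = A"
  by (rule eq_matI) auto

lemma adj_one [simp]: "adj (1\<^sub>m n) = 1\<^sub>m n"
  by (rule eq_matI) auto

lemma index_mult_mat_sum:
  "i < dim_row A \<Longrightarrow> j < dim_col B \<Longrightarrow> dim_col A = dim_row B \<Longrightarrow>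
    (A * B) $$ (i,j) = (\<Sum>k<dim_row B. A $$ (i,k) * B $$ (k,j))"
  by (auto simp: scalar_prod_def atLeast0LessThan intro!: sum.cong)

lemma adj_mult:
  assumes "A \<in> carrier_mat n m" "B \<in> carrier_mat m l"
  shows "adj (A * B) = adj B * adj A"
  using assms by (intro eq_matI) (auto simp: index_mult_mat_sum mult.commute simp del: index_mult_mat(1) intro!: sum.cong)

lemma mult_mat_assoc:
  "dim_col A = dim_row B \<Longrightarrow> dim_col B = dim_row C \<Longrightarrow> A * B * C = A * (B * C)"
  for A B C :: "complex mat"
  by (rule assoc_mult_mat[of A "dim_row A" "dim_row B" B "dim_row C" C "dim_col C"]) auto

definition unitary_mat :: "nat \<Rightarrow> complex mat \<Rightarrow> bool" where
  "unitary_mat n U \<longleftrightarrow> U \<in> carrier_mat n n \<and> adj U * U = 1\<^sub>m n \<and> U * adj U = 1\<^sub>m n"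

definition real_diag :: "nat \<Rightarrow> (nat \<Rightarrow> real) \<Rightarrow> complex mat" where
  "real_diag n d = mat n n (\<lambda>(i,j). if i = j then of_real (d i) else 0)"

lemma real_diag_carrier [simp]:
  "real_diag n d \<in> carrier_mat n n" "dim_row (real_diag n d) = n" "dim_col (real_diag n d) = n"
  by (simp_all add: real_diag_def)

lemma unitary_matD:
  assumes "unitary_mat n U"
  shows "U \<in> carrier_mat n n" "adj U \<in> carrier_mat n n" "adj U * U = 1\<^sub>m n" "U * adj U = 1\<^sub>m n"
  using assms by (auto simp: unitary_mat_def)

lemma unitary_matI:
  assumes "U \<in> carrier_mat n n" "adj U * U = 1\<^sub>m n"
  shows "unitary_mat n U"
  using assms mat_mult_left_right_inverse[of "adj U" n U] by (auto simp: unitary_mat_def)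

lemma unitary_mat_one: "unitary_mat n (1\<^sub>m n)"
  by (auto simp: unitary_mat_def)

lemma unitary_mat_mult:
  assumes U: "unitary_mat n U" and V: "unitary_mat n V"
  shows "unitary_mat n (U * V)"
proof (rule unitary_matI)
  note u = unitary_matD[OF U] and v = unitary_matD[OF V]
  show "U * V \<in> carrier_mat n n" using u v by auto
  have "adj (U * V) * (U * V) = adj V * (adj U * U) * V"
    using u(1,2) v(1,2) by (simp add: adj_mult[OF u(1) v(1)] assoc_mult_mat[of _ n n _ n _ n])
  then show "adj (U * V) * (U * V) = 1\<^sub>m n" using u v by simp
qed

lemma unitary_rows_orthonormal:
  assumes U: "unitary_mat n U" and "i < n" "j < n"
  shows "(\<Sum>k<n. U $$ (i,k) * cnj (U $$ (j,k))) = (if i = j then 1 else 0)"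
proof -
  note u = unitary_matD[OF U]
  have "(U * adj U) $$ (i,j) = (\<Sum>k<n. U $$ (i,k) * cnj (U $$ (j,k)))"
    using u(1) assms by (subst index_mult_mat_sum) (auto intro!: sum.cong)
  then show ?thesis using u assms by auto
qed

lemma unitary_cols_orthonormal:
  assumes U: "unitary_mat n U" and "i < n" "j < n"
  shows "(\<Sum>k<n. cnj (U $$ (k,i)) * U $$ (k,j)) = (if i = j then 1 else 0)"
proof -
  note u = unitary_matD[OF U]
  have "(adj U * U) $$ (i,j) = (\<Sum>k<n. cnj (U $$ (k,i)) * U $$ (k,j))"
    using u(1) assms by (subst index_mult_mat_sum) (auto intro!: sum.cong)
  then show ?thesis using u assms by auto
qed

lemma cscalar_prod_sum:
  "dim_vec v = dim_vec w \<Longrightarrow> v \<bullet>c w = (\<Sum>k<dim_vec v. v $ k * cnj (w $ k))" for v w :: "complex vec"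
  by (auto simp: scalar_prod_def atLeast0LessThan intro!: sum.cong)

text \<open>Gram-Schmidt on a basis that starts with \<open>v\<close>, followed by normalization of
  the columns. The scalar \<open>c\<close> is left open: for the deflation below, any multiple of an
  eigenvector serves as first column.\<close>

lemma unitary_completion:
  assumes v: "v \<in> carrier_vec n" and v0: "v \<noteq> 0\<^sub>v n"
  obtains W c where "unitary_mat n W" "col W 0 = c \<cdot>\<^sub>v v"
proof -
  interpret cof_vec_space n "TYPE(complex)" .
  have n: "n \<noteq> 0" using v v0 by (intro notI) auto
  define b where "b = basis_completion v"
  define ws where "ws = gram_schmidt n b"
  from basis_completion[OF v v0, folded b_def]
  have dist_b: "distinct b" and indep: "\<not> lin_dep (set b)" and b: "set b \<subseteq> carrier_vec n"
    and hdb: "hd b = v" and len_b: "length b = n" by auto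
  from hdb len_b n obtain vs where bv: "b = v # vs" by (cases b, auto)
  from gram_schmidt_result[OF b dist_b indep refl, folded ws_def]
  have ws: "set ws \<subseteq> carrier_vec n" "corthogonal ws" "length ws = n" by (auto simp: len_b)
  from gram_schmidt_hd[OF v, of vs, folded bv] have hdws: "hd ws = v" unfolding ws_def .
  have wsc: "ws ! j \<in> carrier_vec n" if "j < n" for j using ws that by auto
  define r where "r j = complex_of_real (sqrt (Re (ws ! j \<bullet>c ws ! j)))" for j
  define W where "W = mat n n (\<lambda>(i,j). ws ! j $ i / r j)"
  have sq: "ws ! j \<bullet>c ws ! j = of_real (\<Sum>k<n. (cmod (ws ! j $ k))\<^sup>2)" if "j < n" for j
    using wsc[OF that] by (subst cscalar_prod_sum) (auto intro!: sum.cong simp: complex_norm_square simp flip: of_real_power)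
  have r: "cnj (r j) * r j = ws ! j \<bullet>c ws ! j" if "j < n" for j
  proof -
    define q where "q = (\<Sum>k<n. (cmod (ws ! j $ k))\<^sup>2)"
    have "q \<ge> 0" unfolding q_def by (intro sum_nonneg) auto
    have "r j = complex_of_real (sqrt q)" using sq[OF that] by (simp add: r_def q_def)
    then have "cnj (r j) * r j = complex_of_real (sqrt q * sqrt q)"
      by (simp del: real_sqrt_mult_self)
    also have "\<dots> = of_real q" using \<open>q \<ge> 0\<close> by simp
    finally show ?thesis using sq[OF that] by (simp add: q_def)
  qed
  have W: "unitary_mat n W"
  proof (rule unitary_matI)
    show "W \<in> carrier_mat n n" by (simp add: W_def)
    show "adj W * W = 1\<^sub>m n"
    proof (rule eq_matI)
      fix i j assume ij: "i < dim_row (1\<^sub>m n)" "j < dim_col (1\<^sub>m n)"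
      have "(adj W * W) $$ (i,j) = (\<Sum>k<n. cnj (ws ! i $ k / r i) * (ws ! j $ k / r j))"
        using ij by (subst index_mult_mat_sum) (auto simp: W_def)
      also have "\<dots> = (ws ! j \<bullet>c ws ! i) / (cnj (r i) * r j)"
        using ij wsc[of i] wsc[of j] by (subst cscalar_prod_sum) (auto simp: sum_divide_distrib mult.commute)
      also have "\<dots> = 1\<^sub>m n $$ (i,j)"
        using ij corthogonalD[OF ws(2), of j i] ws(3) r[of i] by auto
      finally show "(adj W * W) $$ (i,j) = 1\<^sub>m n $$ (i,j)" .
    qed (auto simp: W_def)
  qed
  have "ws ! 0 = v" using hdws ws(3) n by (cases ws) auto
  then have "col W 0 = (1 / r 0) \<cdot>\<^sub>v v"
    using n v by (intro eq_vecI) (auto simp: W_def)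
  with W show ?thesis by (rule that)
qed

text \<open>Deflation. With an eigenvector as first column of the unitary \<open>W\<close>, the
  first column of \<open>adj W * A * W\<close> is a multiple of the first unit vector; hermiticity
  clears the first row too, makes the eigenvalue real (it is a diagonal entry), and leaves a
  hermitian block of size \<open>n\<close> for the induction hypothesis.\<close>

theorem hermitian_diagonalization:
  assumes "A \<in> carrier_mat n n" "adj A = A"
  shows "\<exists>U d. unitary_mat n U \<and> A = U * real_diag n d * adj U"
  using assms
proof (induction n arbitrary: A)
  case 0
  then show ?case
    by (intro exI[of _ "1\<^sub>m 0"]) (auto simp: unitary_mat_def real_diag_def intro!: eq_matI)
next
  case (Suc n)
  let ?N = "Suc n"
  note A = Suc.prems(1)
  from spectrum_non_empty[OF A] obtain e where "eigenvalue A e" by (auto simp: spectrum_def)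
  then obtain v where v: "v \<in> carrier_vec ?N" "v \<noteq> 0\<^sub>v ?N" "A *\<^sub>v v = e \<cdot>\<^sub>v v"
    using A by (auto simp: eigenvalue_def eigenvector_def)
  from unitary_completion[OF v(1,2)] obtain W c where W: "unitary_mat ?N W" and c0: "col W 0 = c \<cdot>\<^sub>v v" .
  note w = unitary_matD[OF W]
  define A' where "A' = adj W * A * W"
  have A': "A' \<in> carrier_mat ?N ?N" using A w by (auto simp: A'_def)
  have herm: "adj A' = A'"
  proof -
    have "adj A' = adj W * (adj A * W)"
      unfolding A'_def using A w(1,2) by (simp add: adj_mult[of _ ?N ?N _ ?N])
    then show ?thesis using A w(1,2) Suc.prems(2) by (simp add: A'_def)
  qed
  have "A *\<^sub>v col W 0 = e \<cdot>\<^sub>v col W 0"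
    using A v by (simp add: c0 mult_mat_vec[OF A v(1)] smult_smult_assoc mult.commute)
  then have AW: "col (A * W) 0 = e \<cdot>\<^sub>v col W 0" using A w(1) by (subst col_mult2[of _ ?N ?N _ ?N]) auto
  have "col A' 0 = adj W *\<^sub>v col (A * W) 0"
    unfolding A'_def using A w(1,2) by (subst assoc_mult_mat[of _ ?N ?N _ ?N _ ?N]) (auto simp: col_mult2[of _ ?N ?N _ ?N])
  also have "\<dots> = e \<cdot>\<^sub>v col (adj W * W) 0"
    unfolding AW col_mult2[OF w(2,1) zero_less_Suc] mult_mat_vec[OF w(2) col_carrier_vec[OF zero_less_Suc w(1)]] ..
  finally have col0: "col A' 0 = e \<cdot>\<^sub>v col (1\<^sub>m ?N) 0" using w by simp
  have c0': "A' $$ (i,0) = (if i = 0 then e else 0)" if "i < ?N" for i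
    using arg_cong[OF col0, of "\<lambda>v. v $ i"] A' that by auto
  have herm': "A' $$ (i,j) = cnj (A' $$ (j,i))" if "i < ?N" "j < ?N" for i j
    using arg_cong[OF herm, of "\<lambda>M. M $$ (i,j)"] A' that by auto
  have r0': "A' $$ (0,j) = (if j = 0 then e else 0)" if "j < ?N" for j
    using herm'[of 0 j] c0'[of j] c0'[of 0] herm'[of 0 0] that by auto
  have e: "e = of_real (Re e)" using herm'[of 0 0] c0'[of 0] by (auto simp: complex_eq_iff)
  define A3 where "A3 = mat n n (\<lambda>(i,j). A' $$ (Suc i, Suc j))"
  have "adj A3 = A3"
    by (intro eq_matI) (auto simp: A3_def intro!: herm'[symmetric])
  from Suc.IH[OF _ this] obtain U d where U: "unitary_mat n U" and A3: "A3 = U * real_diag n d * adj U"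
    by (auto simp: A3_def)
  note u = unitary_matD[OF U]
  define F where "F = four_block_mat (1\<^sub>m 1) (0\<^sub>m 1 n) (0\<^sub>m n 1) U"
  have adjF: "adj F = four_block_mat (1\<^sub>m 1) (0\<^sub>m 1 n) (0\<^sub>m n 1) (adj U)"
    using u(1) by (intro eq_matI) (auto simp: F_def)
  have F: "unitary_mat ?N F"
  proof (rule unitary_matI)
    show "F \<in> carrier_mat ?N ?N" using u(1) by (auto simp: F_def)
    show "adj F * F = 1\<^sub>m ?N"
      unfolding adjF unfolding F_def using u
      by (subst mult_four_block_mat[where ?nr1.0=1 and ?n1.0=1 and ?n2.0=n and ?nr2.0=n and ?nc1.0=1 and ?nc2.0=n])
        (auto intro!: eq_matI)
  qed
  define d' where "d' i = (case i of 0 \<Rightarrow> Re e | Suc j \<Rightarrow> d j)" for i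
  have D': "real_diag ?N d' = four_block_mat (mat 1 1 (\<lambda>_. e)) (0\<^sub>m 1 n) (0\<^sub>m n 1) (real_diag n d)"
    by (rule eq_matI) (auto simp: real_diag_def d'_def e[symmetric] split: nat.splits)
  have "F * real_diag ?N d' * adj F = four_block_mat (mat 1 1 (\<lambda>_. e)) (0\<^sub>m 1 n) (0\<^sub>m n 1) A3"
  proof -
    have "F * real_diag ?N d' = four_block_mat (mat 1 1 (\<lambda>_. e)) (0\<^sub>m 1 n) (0\<^sub>m n 1) (U * real_diag n d)"
      unfolding D' F_def using u(1)
      by (subst mult_four_block_mat[where ?nr1.0=1 and ?n1.0=1 and ?n2.0=n and ?nr2.0=n and ?nc1.0=1 and ?nc2.0=n])
        (auto simp: left_mult_zero_mat[OF real_diag_carrier(1)])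
    moreover have UD: "U * real_diag n d \<in> carrier_mat n n" and UDU: "U * real_diag n d * adj U \<in> carrier_mat n n"
      using u(1) by auto
    ultimately show ?thesis
      unfolding adjF using u(1,2)
      by (simp, subst mult_four_block_mat[where ?nr1.0=1 and ?n1.0=1 and ?n2.0=n and ?nr2.0=n and ?nc1.0=1 and ?nc2.0=n])
        (auto simp: A3 left_mult_zero_mat[OF u(2)] right_mult_zero_mat[OF UD] left_add_zero_mat[OF UDU])
  qed
  also have "\<dots> = A'"
    using A' c0' r0' by (intro eq_matI) (auto simp: A3_def)
  finally have A'F: "A' = F * real_diag ?N d' * adj F" ..
  note f = unitary_matD[OF F]
  have "A = (W * adj W) * A * (W * adj W)" using A w(4) by simp
  also have "\<dots> = W * A' * adj W"
    unfolding A'_def using A w(1) by (simp add: mult_mat_assoc)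
  also have "\<dots> = (W * F) * real_diag ?N d' * adj (W * F)"
    unfolding A'F adj_mult[OF w(1) f(1)] using w(1) f(1) by (simp add: mult_mat_assoc)
  finally show ?case using unitary_mat_mult[OF W F] by blast
qed

section \<open>Spectral sums from a diagonalization, and the spectra of \<open>A * B\<close> and
  \<open>B * A\<close>\<close>

lemma eigvals_unitary_conj:
  assumes U: "unitary_mat n U" and A: "A = U * real_diag n d * adj U"
  shows "eigvals A = image_mset (\<lambda>i. complex_of_real (d i)) (mset_set {..<n})"
proof -
  note u = unitary_matD[OF U]
  have "similar_mat_wit A (real_diag n d) U (adj U)"
    using u A by (intro similar_mat_witI[of _ _ n]) auto
  then have "char_poly A = char_poly (real_diag n d)" by (intro char_poly_similar) (auto simp: similar_mat_def)
  also have "\<dots> = (\<Prod>a\<leftarrow>diag_mat (real_diag n d). [:- a, 1:])"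
    by (rule char_poly_upper_triangular[of _ n]) (auto simp: real_diag_def)
  also have "diag_mat (real_diag n d) = map (\<lambda>i. of_real (d i)) [0..<n]"
    by (auto simp: diag_mat_def real_diag_def)
  finally have cp: "char_poly A = (\<Prod>a\<leftarrow>map (\<lambda>i. complex_of_real (d i)) [0..<n]. [:- a, 1:])" .
  have "proots (\<Prod>a\<leftarrow>xs. [:- a, 1:]) = mset xs" for xs :: "complex list"
  proof (induction xs)
    case (Cons a xs)
    have "(\<Prod>a\<leftarrow>xs. [:- a, 1:]) \<noteq> 0" by (auto simp: prod_list_zero_iff)
    with Cons show ?case by (simp add: proots_mult del: mult_pCons_left)
  qed auto
  then have "eigvals A = mset (map (\<lambda>i. complex_of_real (d i)) [0..<n])"
    unfolding eigvals_def cp .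
  then show ?thesis by (simp flip: atLeast0LessThan)
qed

lemma sum_eigvals_unitary_conj:
  assumes "unitary_mat n U" "A = U * real_diag n d * adj U"
  shows "sum_mset (image_mset f (eigvals A)) = (\<Sum>i<n. f (of_real (d i)))"
  unfolding eigvals_unitary_conj[OF assms] by (simp add: sum_unfold_sum_mset image_mset.compositionality o_def)

lemma vN_entropy_unitary_conj:
  assumes "unitary_mat n U" "A = U * real_diag n d * adj U"
  shows "vN_entropy A = - (\<Sum>i<n. xlogx (d i))"
  unfolding vN_entropy_def sum_eigvals_unitary_conj[OF assms] by simp

text \<open>Sylvester's identity. Multiplying the block matrix \<open>M\<close> by \<open>L1\<close>
  from the right or by \<open>L2\<close> from the left makes it block upper triangular, with
  diagonal blocks containing \<open>x I - A B\<close> and \<open>x I - B A\<close> respectively; the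
  two determinants give the two sides. The powers of the indeterminate make up for the different
  numbers of zero eigenvalues.\<close>

lemma char_poly_mult_commute:
  fixes A B :: "complex mat"
  assumes A: "A \<in> carrier_mat n m" and B: "B \<in> carrier_mat m n"
  shows "[:0,1:] ^ m * char_poly (A * B) = [:0,1:] ^ n * char_poly (B * A)" (is "?x ^ m * _ = _")
proof -
  let ?h = "map_mat (\<lambda>a::complex. [:a:])"
  let ?A = "?h A" and ?B = "?h B"
  let ?xI = "\<lambda>k. ?x \<cdot>\<^sub>m 1\<^sub>m k"
  have hA: "?A \<in> carrier_mat n m" and hB: "?B \<in> carrier_mat m n" using A B by auto
  interpret h: ring_hom "\<lambda>a::complex. [:a:]" by unfold_locales (auto simp: one_pCons)
  have cp: "char_poly C = det (?xI k - ?h C)" if "C \<in> carrier_mat k k" for C k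
    unfolding char_poly_def char_poly_matrix_def using that
    by (intro arg_cong[of _ _ det] eq_matI) auto
  define M where "M = four_block_mat (?xI n) ?A ?B (1\<^sub>m m)"
  have M: "M \<in> carrier_mat (n+m) (n+m)" by (auto simp: M_def)
  define L1 where "L1 = four_block_mat (1\<^sub>m n) (0\<^sub>m n m) (- ?B) (1\<^sub>m m)"
  have L1: "L1 \<in> carrier_mat (n+m) (n+m)" by (auto simp: L1_def)
  define L2 where "L2 = four_block_mat (1\<^sub>m n) (0\<^sub>m n m) (- ?B) (?xI m)"
  have L2: "L2 \<in> carrier_mat (n+m) (n+m)" by (auto simp: L2_def)
  have "M * L1 = four_block_mat (?xI n - ?A * ?B) ?A (0\<^sub>m m n) (1\<^sub>m m)"
    unfolding M_def L1_def using hA hB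
    by (subst mult_four_block_mat[where ?nr1.0=n and ?n1.0=n and ?n2.0=m and ?nr2.0=m and ?nc1.0=n and ?nc2.0=m])
      (auto intro!: cong_four_block_mat eq_matI)
  moreover have "?A * ?B = ?h (A * B)" using A B by (rule h.mat_hom_mult[symmetric])
  ultimately have "det (M * L1) = char_poly (A * B)"
    using A B by (simp, subst det_four_block_mat_lower_left_zero[of _ n _ m]) (auto simp: cp[of _ n])
  moreover have "det L1 = 1"
    unfolding L1_def by (subst det_four_block_mat_upper_right_zero[of _ n _ m]) (use hB in auto)
  ultimately have d1: "det M = char_poly (A * B)" using det_mult[OF M L1] by simp
  have "L2 * M = four_block_mat (?xI n) ?A (0\<^sub>m m n) (?xI m - ?B * ?A)"
    unfolding M_def L2_def using hA hB
    by (subst mult_four_block_mat[where ?nr1.0=n and ?n1.0=n and ?n2.0=m and ?nr2.0=m and ?nc1.0=n and ?nc2.0=m])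
      (auto intro!: cong_four_block_mat eq_matI)
  moreover have "?B * ?A = ?h (B * A)" using B A by (rule h.mat_hom_mult[symmetric])
  ultimately have "det (L2 * M) = ?x ^ n * char_poly (B * A)"
    using A B by (simp, subst det_four_block_mat_lower_left_zero[of _ n _ m]) (auto simp: cp[of _ m])
  moreover have "det L2 = ?x ^ m"
    unfolding L2_def by (subst det_four_block_mat_upper_right_zero[of _ n _ m]) (use hB in auto)
  ultimately show ?thesis using det_mult[OF L2 M] d1 by simp
qed

text \<open>The two products share their nonzero eigenvalues with multiplicity, and
  \<open>f 0 = 0\<close> hides the surplus zeros. For \<open>f = xlogx\<close> this is the reason
  why complementary marginals of a pure state have equal entropy.\<close>

lemma sum_eigvals_mult_commute:
  fixes A B :: "complex mat" and f :: "complex \<Rightarrow> real"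
  assumes A: "A \<in> carrier_mat n m" and B: "B \<in> carrier_mat m n" and f0: "f 0 = 0"
  shows "sum_mset (image_mset f (eigvals (A * B))) = sum_mset (image_mset f (eigvals (B * A)))"
proof -
  have nz: "char_poly C \<noteq> 0" if "C \<in> carrier_mat k k" for C :: "complex mat" and k
    using degree_monic_char_poly[OF that] by auto
  have pr: "sum_mset (image_mset f (proots ([:0,1:] ^ k * q))) = sum_mset (image_mset f (proots q))"
    if "q \<noteq> 0" for k and q :: "complex poly"
    using that
  proof (induction k)
    case (Suc k)
    have "[:0,1:] ^ k * q \<noteq> 0" using Suc.prems by auto
    moreover have "proots [:0, 1::complex:] = {#0#}" using proots_linear_factor[of "0::complex"] by simp
    ultimately have "proots ([:0,1:] * ([:0,1:] ^ k * q)) = {#0#} + proots ([:0,1:] ^ k * q)"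
      by (subst proots_mult) auto
    then show ?case using Suc f0 by (simp add: mult.assoc del: mult_pCons_left)
  qed auto
  have "sum_mset (image_mset f (eigvals (A * B))) = sum_mset (image_mset f (proots ([:0,1:] ^ m * char_poly (A * B))))"
    using pr[of "char_poly (A * B)" m] nz[of "A * B" n] A B by (simp add: eigvals_def)
  also have "\<dots> = sum_mset (image_mset f (eigvals (B * A)))"
    unfolding char_poly_mult_commute[OF A B] using pr[of "char_poly (B * A)" n] nz[of "B * A" m] A B by (simp add: eigvals_def)
  finally show ?thesis .
qed

lemma vN_entropy_mult_commute:
  assumes "A \<in> carrier_mat n m" "B \<in> carrier_mat m n"
  shows "vN_entropy (A * B) = vN_entropy (B * A)"
  unfolding vN_entropy_def by (subst sum_eigvals_mult_commute[OF assms]) (auto simp: xlogx_def)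

lemma vN_entropy_transpose: "A \<in> carrier_mat n n \<Longrightarrow> vN_entropy A\<^sup>T = vN_entropy A"
  by (simp add: vN_entropy_def eigvals_def)

subsection \<open>Entropy inequalities\<close>

lemma sum_rotate:
  "(\<Sum>i\<in>A. \<Sum>j\<in>B. \<Sum>k\<in>C. f i j k) = (\<Sum>k\<in>C. \<Sum>i\<in>A. \<Sum>j\<in>B. f i j k)"
proof -
  have "(\<Sum>j\<in>B. \<Sum>k\<in>C. f i j k) = (\<Sum>k\<in>C. \<Sum>j\<in>B. f i j k)" for i by (rule sum.swap)
  then show ?thesis by (simp only:) (rule sum.swap)
qed

lemma sum_prod_index:
  fixes f :: "nat \<Rightarrow> 'a::comm_monoid_add"
  shows "(\<Sum>k<n*m. f k) = (\<Sum>i<n. \<Sum>j<m. f (i*m+j))"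
proof -
  have "(\<Sum>k<n*m. f k) = (\<Sum>i<n. sum f {i*m..<i*m+m})" by (rule sum.nat_group[symmetric])
  moreover have "sum f {i*m..<i*m+m} = (\<Sum>j<m. f (i*m+j))" for i
    using sum.shift_bounds_nat_ivl[of f 0 "i*m" m] by (simp add: atLeast0LessThan add.commute)
  ultimately show ?thesis by simp
qed

lemma prod_index_less: "i < n \<Longrightarrow> j < m \<Longrightarrow> i*m+j < n*(m::nat)"
  by (metis add.commute add_mult_distrib less_mono_imp_le_mono linorder_not_less mult_le_mono1 nat_add_left_cancel_less order_less_le_trans plus_1_eq_Suc mult_Suc Suc_leI)

lemma index_div_mod [simp]: "j < m \<Longrightarrow> (i*m+j) div m = (i::nat)" "j < m \<Longrightarrow> (i*m+j) mod m = j"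
  by auto

lemma less_mult_divmod: "k < n*m \<Longrightarrow> k div m < n \<and> k mod m < (m::nat)"
  by (metis less_mult_imp_div_less mod_less_divisor mult_0_right not_gr_zero not_less_zero)

section \<open>Positive semidefinite matrices as Gram matrices\<close>

lemma psd_iff_form:
  assumes A: "A \<in> carrier_mat n n"
  shows "psd A \<longleftrightarrow> adj A = A \<and>
    (\<forall>v. 0 \<le> Re (\<Sum>i<n. \<Sum>j<n. cnj (v i) * A $$ (i,j) * v j))"
proof -
  have *: "(\<Sum>i<n. cnj (v $ i) * (A *\<^sub>v v) $ i) = (\<Sum>i<n. \<Sum>j<n. cnj (v $ i) * A $$ (i,j) * v $ j)"
    if "dim_vec v = n" for v
    using A that by (intro sum.cong refl)
      (auto simp: scalar_prod_def sum_distrib_left atLeast0LessThan mult.assoc intro!: sum.cong)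
  have "(\<forall>v. 0 \<le> Re (\<Sum>i<n. \<Sum>j<n. cnj (v i) * A $$ (i,j) * v j)) \<longleftrightarrow>
      (\<forall>v. dim_vec v = n \<longrightarrow> 0 \<le> Re (\<Sum>i<n. \<Sum>j<n. cnj (v $ i) * A $$ (i,j) * v $ j))" (is "?L = ?R")
  proof
    assume R: ?R
    show ?L
    proof
      fix v :: "nat \<Rightarrow> complex"
      show "0 \<le> Re (\<Sum>i<n. \<Sum>j<n. cnj (v i) * A $$ (i,j) * v j)"
        using R[rule_format, of "vec n v"] by simp
    qed
  qed auto
  with * A show ?thesis unfolding psd_def by auto
qed

lemma sum_form_gram:
  fixes f :: "'a \<Rightarrow> nat \<Rightarrow> complex"
  shows "(\<Sum>i<n. \<Sum>j<n. cnj (v i) * (\<Sum>k\<in>S. f k i * cnj (f k j)) * v j)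
    = of_real (\<Sum>k\<in>S. (cmod (\<Sum>j<n. cnj (f k j) * v j))\<^sup>2)"
proof -
  have "(\<Sum>i<n. \<Sum>j<n. cnj (v i) * (\<Sum>k\<in>S. f k i * cnj (f k j)) * v j)
      = (\<Sum>i<n. \<Sum>j<n. \<Sum>k\<in>S. cnj (v i) * f k i * (cnj (f k j) * v j))"
    by (simp add: sum_distrib_left sum_distrib_right mult_ac)
  also have "\<dots> = (\<Sum>k\<in>S. \<Sum>i<n. \<Sum>j<n. cnj (v i) * f k i * (cnj (f k j) * v j))"
    by (rule sum_rotate)
  also have "\<dots> = (\<Sum>k\<in>S. (\<Sum>i<n. cnj (v i) * f k i) * (\<Sum>j<n. cnj (f k j) * v j))"
    by (simp only: sum_product)
  moreover have "(\<Sum>i<n. cnj (v i) * f k i) = cnj (\<Sum>i<n. cnj (f k i) * v i)" for k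
    by (simp add: mult.commute)
  moreover have "cnj z * z = of_real ((cmod z)\<^sup>2)" for z
    by (simp only: complex_norm_square mult.commute)
  ultimately show ?thesis by (simp only: of_real_sum)
qed

text \<open>The usual route to positivity in the sequel: the index set \<open>S\<close> is the basis
  of a system that is traced out, and \<open>f\<close> lists the amplitudes.\<close>

lemma psd_gram:
  assumes A: "A \<in> carrier_mat n n"
    and f: "\<And>i j. i < n \<Longrightarrow> j < n \<Longrightarrow> A $$ (i,j) = (\<Sum>k\<in>S. f k i * cnj (f k j))"
  shows "psd A"
proof -
  have "adj A = A" using A by (intro eq_matI) (auto simp: f mult.commute)
  moreover have "(\<Sum>i<n. \<Sum>j<n. cnj (v i) * A $$ (i,j) * v j)
      = (\<Sum>i<n. \<Sum>j<n. cnj (v i) * (\<Sum>k\<in>S. f k i * cnj (f k j)) * v j)" for v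
    by (intro sum.cong) (auto simp: f)
  ultimately show ?thesis
    unfolding psd_iff_form[OF A] by (auto simp: sum_form_gram intro: sum_nonneg)
qed

lemma psd_mult_adj: "psd (M * adj M)"
proof (rule psd_gram)
  show "(M * adj M) $$ (i,j) = (\<Sum>k<dim_col M. M $$ (i,k) * cnj (M $$ (j,k)))"
    if "i < dim_row M" "j < dim_row M" for i j
    using that by (subst index_mult_mat_sum) auto
qed auto

lemma index_unitary_conj:
  assumes U: "unitary_mat n U" and ij: "i < n" "j < n"
  shows "(U * real_diag n d * adj U) $$ (i,j) = (\<Sum>l<n. of_real (d l) * (U $$ (i,l) * cnj (U $$ (j,l))))"
proof -
  note u = unitary_matD[OF U]
  have "(U * real_diag n d) $$ (i,l) = of_real (d l) * U $$ (i,l)" if "l < n" for l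
    using u(1) that ij by (subst index_mult_mat_sum) (auto simp: real_diag_def if_distrib cong: if_cong)
  then show ?thesis using u(1) ij by (subst index_mult_mat_sum) (auto simp: mult.assoc)
qed

lemma adj_conj_diagonalization:
  assumes U: "unitary_mat n U" and A: "A = U * real_diag n d * adj U"
  shows "adj U * A * U = real_diag n d"
proof -
  note u = unitary_matD[OF U]
  have "adj U * A * U = (adj U * U) * real_diag n d * (adj U * U)"
    unfolding A using u(1) by (simp add: mult_mat_assoc)
  then show ?thesis using u by simp
qed

text \<open>Each eigenvalue is the value of the quadratic form at the corresponding column of
  \<open>U\<close>.\<close>

lemma psd_diagonalization:
  assumes A: "A \<in> carrier_mat n n" "psd A"
  obtains U d where "unitary_mat n U" "A = U * real_diag n d * adj U" "\<And>i. i < n \<Longrightarrow> d i \<ge> 0"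
proof -
  from A(2) have "adj A = A" unfolding psd_iff_form[OF A(1)] by simp
  from hermitian_diagonalization[OF A(1) this] obtain U d
    where U: "unitary_mat n U" and Ad: "A = U * real_diag n d * adj U" by blast
  have "d m \<ge> 0" if m: "m < n" for m
  proof -
    have "0 \<le> Re (\<Sum>i<n. \<Sum>j<n. cnj (U $$ (i,m)) * A $$ (i,j) * U $$ (j,m))"
      using A(2) unfolding psd_iff_form[OF A(1)] by (auto elim: allE[of _ "\<lambda>i. U $$ (i,m)"])
    also have "(\<Sum>i<n. \<Sum>j<n. cnj (U $$ (i,m)) * A $$ (i,j) * U $$ (j,m)) =
        (\<Sum>i<n. \<Sum>j<n. \<Sum>l<n. of_real (d l) * ((cnj (U $$ (i,m)) * U $$ (i,l)) * (cnj (U $$ (j,l)) * U $$ (j,m))))"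
      by (intro sum.cong refl) (auto simp: Ad index_unitary_conj[OF U] sum_distrib_left sum_distrib_right mult_ac)
    also have "\<dots> = (\<Sum>l<n. of_real (d l) * ((\<Sum>i<n. cnj (U $$ (i,m)) * U $$ (i,l)) * (\<Sum>j<n. cnj (U $$ (j,l)) * U $$ (j,m))))"
      by (subst sum_rotate, rule sum.cong[OF refl], subst sum_product, simp add: sum_distrib_left)
    also have "\<dots> = (\<Sum>l<n. of_real (d l) * (if l = m then 1 else 0))"
      using m by (intro sum.cong refl) (simp add: unitary_cols_orthonormal[OF U])
    also have "\<dots> = of_real (d m)" using m by (simp add: if_distrib cong: if_cong)
    finally show ?thesis by simp
  qed
  with U Ad show ?thesis by (rule that)
qed

section \<open>Scalar inequalities for \<open>x log x\<close>\<close>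

lemma xlogx_0 [simp]: "xlogx 0 = 0"
  by (simp add: xlogx_def)

lemma xlogx_mult: "x \<ge> 0 \<Longrightarrow> y \<ge> 0 \<Longrightarrow> xlogx (x * y) = y * xlogx x + x * xlogx y"
  by (cases "x = 0"; cases "y = 0") (auto simp: xlogx_def log_mult algebra_simps mult_le_0_iff)

text \<open>Convexity, expressed by the tangent at \<open>y\<close> and obtained from
  \<open>ln z \<le> z - 1\<close>. The linear remainder is kept because it sums to zero in both
  applications, Jensen's inequality and subadditivity.\<close>

lemma xlogx_tangent:
  assumes x: "x \<ge> 0" and y: "y > 0"
  shows "xlogx x \<ge> x * log 2 y + (x - y) / ln 2"
proof (cases "x = 0")
  case False
  with x have x: "x > 0" by simp
  have "ln (y / x) \<le> y / x - 1" using x y by (intro ln_le_minus_one) auto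
  then have "x * ln (y / x) \<le> x * (y / x - 1)" using x by (intro mult_left_mono) auto
  also have "\<dots> = y - x" using x by (simp add: field_simps)
  finally have "x * (ln x - ln y) \<ge> x - y" using x y by (simp add: ln_div algebra_simps)
  then have "x * (ln x - ln y) / ln 2 \<ge> (x - y) / ln 2" by (intro divide_right_mono) auto
  then show ?thesis using x by (simp add: xlogx_def log_def diff_divide_distrib algebra_simps)
qed (use y in auto)

lemma xlogx_jensen:
  assumes "finite S" and w: "\<And>i. i \<in> S \<Longrightarrow> w i \<ge> 0" and w1: "sum w S = 1" and d: "\<And>i. i \<in> S \<Longrightarrow> d i \<ge> 0"
  shows "xlogx (\<Sum>i\<in>S. w i * d i) \<le> (\<Sum>i\<in>S. w i * xlogx (d i))"
proof -
  define y where "y = (\<Sum>i\<in>S. w i * d i)"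
  have y0: "y \<ge> 0" unfolding y_def using w d by (intro sum_nonneg) auto
  show ?thesis
  proof (cases "y = 0")
    case True
    then have "w i * d i = 0" if "i \<in> S" for i
      using sum_nonneg_eq_0_iff[OF assms(1), of "\<lambda>i. w i * d i"] w d that unfolding y_def by auto
    then have "w i * xlogx (d i) = 0" if "i \<in> S" for i using that by fastforce
    then show ?thesis using True by (simp add: y_def)
  next
    case False
    with y0 have y: "y > 0" by simp
    have "(\<Sum>i\<in>S. w i * xlogx (d i)) \<ge> (\<Sum>i\<in>S. w i * (d i * log 2 y + (d i - y) / ln 2))"
      using w d y by (intro sum_mono mult_left_mono xlogx_tangent) auto
    also have "(\<Sum>i\<in>S. w i * (d i * log 2 y + (d i - y) / ln 2)) =
        (\<Sum>i\<in>S. w i * d i) * log 2 y + ((\<Sum>i\<in>S. w i * d i) - (\<Sum>i\<in>S. w i) * y) / ln 2"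
      by (simp add: sum_distrib_right sum_distrib_left sum.distrib sum_subtractf sum_divide_distrib algebra_simps
          diff_divide_distrib)
    also have "\<dots> = xlogx y" using y unfolding y_def[symmetric] w1 by (simp add: xlogx_def)
    finally show ?thesis unfolding y_def .
  qed
qed

text \<open>Nonnegativity of the mutual information of the joint distribution \<open>q\<close>: the
  tangent inequality is taken at the product \<open>\<beta> i * \<gamma> j\<close>, and the
  remainders cancel because \<open>q\<close> and the product distribution both have total mass
  1.\<close>

lemma xlogx_subadditive:
  fixes n m :: nat
  assumes q: "\<And>i j. i < n \<Longrightarrow> j < m \<Longrightarrow> q i j \<ge> 0"
    and \<beta>: "\<And>i. i < n \<Longrightarrow> \<beta> i = (\<Sum>j<m. q i j)" and \<gamma>: "\<And>j. j < m \<Longrightarrow> \<gamma> j = (\<Sum>i<n. q i j)"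
    and q1: "(\<Sum>i<n. \<Sum>j<m. q i j) = 1"
  shows "(\<Sum>i<n. xlogx (\<beta> i)) + (\<Sum>j<m. xlogx (\<gamma> j)) \<le> (\<Sum>i<n. \<Sum>j<m. xlogx (q i j))"
proof -
  have \<beta>0: "\<beta> i \<ge> 0" if "i < n" for i using that q by (auto simp: \<beta> intro: sum_nonneg)
  have \<gamma>0: "\<gamma> j \<ge> 0" if "j < m" for j using that q by (auto simp: \<gamma> intro: sum_nonneg)
  define L where "L x = (if x > 0 then log 2 x else 0)" for x :: real
  have xL: "xlogx x = x * L x" if "x \<ge> 0" for x using that by (auto simp: xlogx_def L_def)
  have pt: "xlogx (q i j) \<ge> q i j * L (\<beta> i) + q i j * L (\<gamma> j) + (q i j - \<beta> i * \<gamma> j) / ln 2"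
    if ij: "i < n" "j < m" for i j
  proof (cases "\<beta> i > 0 \<and> \<gamma> j > 0")
    case True
    then have "xlogx (q i j) \<ge> q i j * log 2 (\<beta> i * \<gamma> j) + (q i j - \<beta> i * \<gamma> j) / ln 2"
      using q[OF ij] by (intro xlogx_tangent) auto
    then show ?thesis using True by (simp add: L_def log_mult algebra_simps)
  next
    case False
    have "q i j \<le> \<beta> i" unfolding \<beta>[OF ij(1)]
      using ij q member_le_sum[of j "{..<m}" "q i"] by auto
    moreover have "q i j \<le> \<gamma> j" unfolding \<gamma>[OF ij(2)]
      using ij q member_le_sum[of i "{..<n}" "\<lambda>i. q i j"] by auto
    ultimately have "q i j = 0" using False q[OF ij] by linarith
    moreover have "\<beta> i * \<gamma> j = 0" using False \<beta>0[OF ij(1)] \<gamma>0[OF ij(2)] by auto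
    ultimately show ?thesis by (simp only:) simp
  qed
  have s\<beta>: "(\<Sum>i<n. \<beta> i) = 1" using q1 by (simp add: \<beta>)
  have s\<gamma>: "(\<Sum>j<m. \<gamma> j) = 1" using q1 by (subst (asm) sum.swap) (simp add: \<gamma>)
  have t1: "(\<Sum>i<n. \<Sum>j<m. q i j * L (\<beta> i)) = (\<Sum>i<n. xlogx (\<beta> i))"
    using \<beta>0 by (intro sum.cong refl) (simp add: xL \<beta> sum_distrib_right)
  have t2: "(\<Sum>i<n. \<Sum>j<m. q i j * L (\<gamma> j)) = (\<Sum>j<m. xlogx (\<gamma> j))"
    using \<gamma>0 by (subst sum.swap, intro sum.cong refl) (simp add: xL \<gamma> sum_distrib_right)
  have t3: "(\<Sum>i<n. \<Sum>j<m. (q i j - \<beta> i * \<gamma> j) / ln 2) = 0"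
    using q1 s\<beta> s\<gamma> by (simp add: sum_subtractf diff_divide_distrib flip: sum_divide_distrib sum_distrib_left sum_distrib_right)
  have "(\<Sum>i<n. \<Sum>j<m. q i j * L (\<beta> i) + q i j * L (\<gamma> j) + (q i j - \<beta> i * \<gamma> j) / ln 2)
      \<le> (\<Sum>i<n. \<Sum>j<m. xlogx (q i j))"
    by (intro sum_mono pt) auto
  then show ?thesis using t1 t2 t3 by (simp add: sum.distrib)
qed

section \<open>Entropy of the diagonal, and concavity\<close>

lemma unitary_col_weights: "unitary_mat n U \<Longrightarrow> l < n \<Longrightarrow> (\<Sum>i<n. (cmod (U $$ (i,l)))\<^sup>2) = 1"
  using unitary_cols_orthonormal[of n U l l]
  by (simp add: mult.commute complex_norm_square[symmetric] flip: of_real_power of_real_sum)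

lemma unitary_row_weights: "unitary_mat n U \<Longrightarrow> i < n \<Longrightarrow> (\<Sum>l<n. (cmod (U $$ (i,l)))\<^sup>2) = 1"
  using unitary_rows_orthonormal[of n U i i]
  by (simp add: complex_norm_square[symmetric] flip: of_real_power of_real_sum)

text \<open>The diagonal is the image of the spectrum under the doubly stochastic matrix of squared
  moduli of \<open>U\<close>. Rows summing to 1 allow Jensen's inequality; columns summing to 1 then
  collapse the double sum to the spectrum.\<close>

lemma vN_entropy_le_diag:
  assumes A: "A \<in> carrier_mat n n" "psd A"
  shows "vN_entropy A \<le> - (\<Sum>i<n. xlogx (Re (A $$ (i,i))))"
proof -
  obtain U d where U: "unitary_mat n U" and Ad: "A = U * real_diag n d * adj U" and d: "\<And>i. i < n \<Longrightarrow> d i \<ge> 0"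
    using psd_diagonalization[OF A] by metis
  have Aii: "Re (A $$ (i,i)) = (\<Sum>l<n. (cmod (U $$ (i,l)))\<^sup>2 * d l)" if "i < n" for i
    unfolding Ad index_unitary_conj[OF U that that]
    by (simp add: complex_norm_square[symmetric] mult.commute flip: of_real_power)
  have "(\<Sum>i<n. xlogx (Re (A $$ (i,i)))) \<le> (\<Sum>i<n. \<Sum>l<n. (cmod (U $$ (i,l)))\<^sup>2 * xlogx (d l))"
    using d by (intro sum_mono) (auto simp: Aii intro!: xlogx_jensen unitary_row_weights[OF U])
  also have "\<dots> = (\<Sum>l<n. (\<Sum>i<n. (cmod (U $$ (i,l)))\<^sup>2) * xlogx (d l))"
    by (subst sum.swap) (simp add: sum_distrib_right)
  also have "\<dots> = (\<Sum>l<n. xlogx (d l))" by (simp add: unitary_col_weights[OF U])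
  finally show ?thesis unfolding vN_entropy_unitary_conj[OF U Ad] by simp
qed

lemma index_conj:
  assumes "A \<in> carrier_mat n n" "W \<in> carrier_mat n m" "i < m" "j < m"
  shows "(adj W * A * W) $$ (i,j) = (\<Sum>k<n. \<Sum>l<n. cnj (W $$ (k,i)) * A $$ (k,l) * W $$ (l,j))"
proof -
  have "(adj W * A) $$ (i,l) = (\<Sum>k<n. cnj (W $$ (k,i)) * A $$ (k,l))" if "l < n" for l
    using assms that by (subst index_mult_mat_sum) auto
  then have "(adj W * A * W) $$ (i,j) = (\<Sum>l<n. (\<Sum>k<n. cnj (W $$ (k,i)) * A $$ (k,l)) * W $$ (l,j))"
    using assms by (subst index_mult_mat_sum) auto
  then show ?thesis by (subst sum.swap) (simp add: sum_distrib_right)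
qed

lemma psd_conj:
  assumes A: "A \<in> carrier_mat n n" "psd A" and W: "W \<in> carrier_mat n m"
  shows "psd (adj W * A * W)"
proof -
  obtain U d where U: "unitary_mat n U" and Ad: "A = U * real_diag n d * adj U" and d: "\<And>i. i < n \<Longrightarrow> d i \<ge> 0"
    using psd_diagonalization[OF A] by metis
  define f where "f l i = (\<Sum>k<n. complex_of_real (sqrt (d l)) * (cnj (W $$ (k,i)) * U $$ (k,l)))" for l i
  show ?thesis
  proof (rule psd_gram)
    show "adj W * A * W \<in> carrier_mat m m" using A W by auto
    fix i j assume ij: "i < m" "j < m"
    have "(adj W * A * W) $$ (i,j) = (\<Sum>k<n. \<Sum>k'<n. \<Sum>l<n. of_real (d l) * ((cnj (W $$ (k,i)) * U $$ (k,l)) * (W $$ (k',j) * cnj (U $$ (k',l)))))"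
      unfolding index_conj[OF A(1) W ij]
      by (intro sum.cong refl) (auto simp: Ad index_unitary_conj[OF U] sum_distrib_left sum_distrib_right mult_ac)
    also have "\<dots> = (\<Sum>l<n. \<Sum>k<n. \<Sum>k'<n. of_real (d l) * ((cnj (W $$ (k,i)) * U $$ (k,l)) * (W $$ (k',j) * cnj (U $$ (k',l)))))"
      by (rule sum_rotate)
    also have "\<dots> = (\<Sum>l<n. f l i * cnj (f l j))"
    proof (intro sum.cong refl)
      fix l assume "l \<in> {..<n}"
      then have "complex_of_real (d l) = of_real (sqrt (d l)) * of_real (sqrt (d l))"
        using d by (simp flip: of_real_mult)
      then show "(\<Sum>k<n. \<Sum>k'<n. of_real (d l) * ((cnj (W $$ (k,i)) * U $$ (k,l)) * (W $$ (k',j) * cnj (U $$ (k',l))))) = f l i * cnj (f l j)"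
        by (simp add: f_def sum_product mult_ac)
    qed
    finally show "(adj W * A * W) $$ (i,j) = (\<Sum>l<n. f l i * cnj (f l j))" .
  qed
qed

lemma vN_entropy_conj:
  assumes A: "A \<in> carrier_mat n n" and W: "unitary_mat n W"
  shows "vN_entropy (adj W * A * W) = vN_entropy A"
proof -
  note w = unitary_matD[OF W]
  have "adj W * A * W = adj W * (A * W)" using A w(1) by (simp add: mult_mat_assoc)
  moreover have "A * W * adj W = A" using A w by (simp add: mult_mat_assoc)
  ultimately show ?thesis using vN_entropy_mult_commute[of "adj W" n n "A * W"] A w by simp
qed

lemma vN_entropy_le_unitary_diag:
  assumes A: "A \<in> carrier_mat n n" "psd A" and W: "unitary_mat n W"
  shows "vN_entropy A \<le> - (\<Sum>i<n. xlogx (Re ((adj W * A * W) $$ (i,i))))"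
proof -
  have "adj W * A * W \<in> carrier_mat n n" using A unitary_matD[OF W] by auto
  from vN_entropy_le_diag[OF this psd_conj[OF A unitary_matD(1)[OF W]]]
  show ?thesis unfolding vN_entropy_conj[OF A(1) W] .
qed

lemma psd_diag_nonneg:
  assumes A: "A \<in> carrier_mat n n" "psd A" and i: "i < n"
  shows "Re (A $$ (i,i)) \<ge> 0"
proof -
  have "0 \<le> Re (\<Sum>k<n. \<Sum>l<n. cnj (if k = i then 1 else 0) * A $$ (k,l) * (if l = i then 1 else 0))"
    using A(2) unfolding psd_iff_form[OF A(1)] by (auto elim!: allE[of _ "\<lambda>k. if k = i then 1 else 0"])
  also have "(\<Sum>k<n. \<Sum>l<n. cnj (if k = i then 1 else 0) * A $$ (k,l) * (if l = i then 1 else 0)) = A $$ (i,i)"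
    using i by (simp add: if_distrib[of cnj] if_distrib[of "\<lambda>x. x * _"] if_distrib[of "\<lambda>x. _ * x"] cong: if_cong)
  finally show ?thesis .
qed

text \<open>Everything is read in the eigenbasis of the mixture. There the diagonal of
  \<open>\<rho>\<close> is its spectrum, passing to the diagonal can only raise the entropy of each
  component, and Jensen's inequality compares the diagonals entry by entry.\<close>

theorem vN_entropy_concave:
  fixes n :: nat
  assumes \<sigma>: "\<And>i. i < n \<Longrightarrow> \<sigma> i \<in> carrier_mat d d \<and> psd (\<sigma> i)"
    and p: "\<And>i. i < n \<Longrightarrow> p i \<ge> 0" "(\<Sum>i<n. p i) = 1"
    and \<rho>: "\<rho> \<in> carrier_mat d d" "psd \<rho>"
      "\<And>k l. k < d \<Longrightarrow> l < d \<Longrightarrow> \<rho> $$ (k,l) = (\<Sum>i<n. complex_of_real (p i) * \<sigma> i $$ (k,l))"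
  shows "(\<Sum>i<n. p i * vN_entropy (\<sigma> i)) \<le> vN_entropy \<rho>"
proof -
  obtain U e where U: "unitary_mat d U" and \<rho>e: "\<rho> = U * real_diag d e * adj U" and e: "\<And>i. i < d \<Longrightarrow> e i \<ge> 0"
    using psd_diagonalization[OF \<rho>(1,2)] by metis
  note u = unitary_matD[OF U]
  define q where "q i k = Re ((adj U * \<sigma> i * U) $$ (k,k))" for i k
  have ek: "e k = Re ((adj U * \<rho> * U) $$ (k,k))" if "k < d" for k
    unfolding adj_conj_diagonalization[OF U \<rho>e] using that by (simp add: real_diag_def)
  have e_q: "e k = (\<Sum>i<n. p i * q i k)" if k: "k < d" for k
  proof -
    have "(adj U * \<rho> * U) $$ (k,k) = (\<Sum>a<d. \<Sum>b<d. \<Sum>i<n. complex_of_real (p i) * (cnj (U $$ (a,k)) * \<sigma> i $$ (a,b) * U $$ (b,k)))"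
      unfolding index_conj[OF \<rho>(1) u(1) k k]
      by (intro sum.cong refl) (auto simp: \<rho>(3) sum_distrib_left sum_distrib_right mult_ac)
    also have "\<dots> = (\<Sum>i<n. \<Sum>a<d. \<Sum>b<d. complex_of_real (p i) * (cnj (U $$ (a,k)) * \<sigma> i $$ (a,b) * U $$ (b,k)))"
      by (rule sum_rotate)
    also have "\<dots> = (\<Sum>i<n. complex_of_real (p i) * (adj U * \<sigma> i * U) $$ (k,k))"
      using \<sigma> by (intro sum.cong refl) (auto simp: index_conj[OF _ u(1) k k] sum_distrib_left)
    finally show ?thesis by (simp add: ek[OF k] q_def)
  qed
  have q0: "q i k \<ge> 0" if "i < n" "k < d" for i k
    unfolding q_def using that \<sigma> u by (intro psd_diag_nonneg[of _ d] psd_conj[of _ d]) auto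
  have "(\<Sum>k<d. xlogx (e k)) \<le> (\<Sum>k<d. \<Sum>i<n. p i * xlogx (q i k))"
    using p q0 by (intro sum_mono) (auto simp: e_q intro!: xlogx_jensen)
  also have "\<dots> = (\<Sum>i<n. p i * (\<Sum>k<d. xlogx (q i k)))"
    by (subst sum.swap) (simp add: sum_distrib_left)
  also have "\<dots> \<le> (\<Sum>i<n. p i * - vN_entropy (\<sigma> i))"
    using p(1) \<sigma> vN_entropy_le_unitary_diag[OF _ _ U] by (intro sum_mono mult_left_mono) (force simp: q_def)+
  finally show ?thesis unfolding vN_entropy_unitary_conj[OF U \<rho>e] by (simp add: sum_negf)
qed

section \<open>Kronecker products\<close>

lemma dim_kron [simp]: "dim_row (kron A B) = dim_row A * dim_row B" "dim_col (kron A B) = dim_col A * dim_col B"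
  by (auto simp: kron_def)

lemma kron_carrier [simp]: "A \<in> carrier_mat a b \<Longrightarrow> B \<in> carrier_mat c d \<Longrightarrow> kron A B \<in> carrier_mat (a*c) (b*d)"
  by (auto simp: kron_def)

lemma index_kron:
  "i < dim_row A * dim_row B \<Longrightarrow> j < dim_col A * dim_col B \<Longrightarrow>
    kron A B $$ (i,j) = A $$ (i div dim_row B, j div dim_col B) * B $$ (i mod dim_row B, j mod dim_col B)"
  by (auto simp: kron_def)

lemma kron_mult:
  assumes "A \<in> carrier_mat a b" "B \<in> carrier_mat c d" "C \<in> carrier_mat b e" "D \<in> carrier_mat d f"
  shows "kron A B * kron C D = kron (A * C) (B * D)"
proof (rule eq_matI)
  fix i j assume "i < dim_row (kron (A * C) (B * D))" "j < dim_col (kron (A * C) (B * D))"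
  then have ij: "i < a * c" "j < e * f" using assms by auto
  note i = less_mult_divmod[OF ij(1)] and j = less_mult_divmod[OF ij(2)]
  have "(kron A B * kron C D) $$ (i,j) = (\<Sum>k<b*d. kron A B $$ (i,k) * kron C D $$ (k,j))"
    using assms ij by (subst index_mult_mat_sum) auto
  also have "\<dots> = (\<Sum>k<b. \<Sum>l<d. (A $$ (i div c, k) * B $$ (i mod c, l)) * (C $$ (k, j div f) * D $$ (l, j mod f)))"
    unfolding sum_prod_index using assms ij by (intro sum.cong refl) (auto simp: index_kron prod_index_less)
  also have "\<dots> = (\<Sum>k<b. A $$ (i div c, k) * C $$ (k, j div f)) * (\<Sum>l<d. B $$ (i mod c, l) * D $$ (l, j mod f))"
    by (simp add: sum_product mult_ac)
  also have "\<dots> = kron (A * C) (B * D) $$ (i,j)"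
    using assms ij i j by (auto simp: index_kron index_mult_mat_sum simp del: index_mult_mat(1))
  finally show "(kron A B * kron C D) $$ (i,j) = kron (A * C) (B * D) $$ (i,j)" .
qed (use assms in auto)

lemma adj_kron: "adj (kron A B) = kron (adj A) (adj B)"
proof (rule eq_matI)
  fix i j assume "i < dim_row (kron (adj A) (adj B))" "j < dim_col (kron (adj A) (adj B))"
  then have ij: "i < dim_col A * dim_col B" "j < dim_row A * dim_row B" by auto
  show "adj (kron A B) $$ (i,j) = kron (adj A) (adj B) $$ (i,j)"
    using ij less_mult_divmod[OF ij(1)] less_mult_divmod[OF ij(2)] by (simp add: index_kron)
qed auto

lemma kron_one: "kron (1\<^sub>m n) (1\<^sub>m m) = 1\<^sub>m (n*m)"
proof (rule eq_matI)
  fix i j assume "i < dim_row (1\<^sub>m (n*m))" "j < dim_col (1\<^sub>m (n*m))"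
  then have ij: "i < n*m" "j < n*m" by auto
  have "i div m = j div m \<and> i mod m = j mod m \<longleftrightarrow> i = j" by (metis div_mult_mod_eq)
  then show "kron (1\<^sub>m n) (1\<^sub>m m) $$ (i,j) = 1\<^sub>m (n*m) $$ (i,j)"
    using ij less_mult_divmod[OF ij(1)] less_mult_divmod[OF ij(2)] by (auto simp: index_kron)
qed auto

lemma unitary_kron:
  assumes U: "unitary_mat n U" and V: "unitary_mat m V"
  shows "unitary_mat (n*m) (kron U V)"
proof (rule unitary_matI)
  note u = unitary_matD[OF U] and v = unitary_matD[OF V]
  show "kron U V \<in> carrier_mat (n*m) (n*m)" using u v by simp
  show "adj (kron U V) * kron U V = 1\<^sub>m (n*m)"
    unfolding adj_kron kron_mult[OF u(2) v(2) u(1) v(1)] u v kron_one ..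
qed

subsection \<open>Subadditivity and additivity\<close>

lemma psd_gram_decomposition:
  assumes "A \<in> carrier_mat n n" "psd A"
  obtains f :: "nat \<Rightarrow> nat \<Rightarrow> complex"
  where "\<And>i j. i < n \<Longrightarrow> j < n \<Longrightarrow> A $$ (i,j) = (\<Sum>l<n. f l i * cnj (f l j))"
proof -
  obtain U d where U: "unitary_mat n U" and Ad: "A = U * real_diag n d * adj U" and d: "\<And>i. i < n \<Longrightarrow> d i \<ge> 0"
    using psd_diagonalization[OF assms] by metis
  have "A $$ (i,j) = (\<Sum>l<n. (of_real (sqrt (d l)) * U $$ (i,l)) * cnj (of_real (sqrt (d l)) * U $$ (j,l)))"
    if "i < n" "j < n" for i j
    unfolding Ad index_unitary_conj[OF U that]
  proof (intro sum.cong refl)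
    fix l assume "l \<in> {..<n}"
    then have "complex_of_real (d l) = of_real (sqrt (d l)) * of_real (sqrt (d l))"
      using d by (simp flip: of_real_mult)
    then show "complex_of_real (d l) * (U $$ (i,l) * cnj (U $$ (j,l)))
      = (of_real (sqrt (d l)) * U $$ (i,l)) * cnj (of_real (sqrt (d l)) * U $$ (j,l))"
      by (simp only: complex_cnj_mult complex_cnj_complex_of_real mult_ac)
  qed
  then show ?thesis by (rule that)
qed

lemma trace_unitary_conj:
  assumes U: "unitary_mat n U" and A: "A = U * real_diag n d * adj U"
  shows "(\<Sum>i<n. A $$ (i,i)) = of_real (\<Sum>i<n. d i)"
proof -
  have "(\<Sum>i<n. A $$ (i,i)) = (\<Sum>i<n. \<Sum>l<n. of_real (d l) * (cnj (U $$ (i,l)) * U $$ (i,l)))"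
    unfolding A by (intro sum.cong refl) (simp add: index_unitary_conj[OF U] mult_ac)
  also have "\<dots> = (\<Sum>l<n. of_real (d l) * (\<Sum>i<n. cnj (U $$ (i,l)) * U $$ (i,l)))"
    by (subst sum.swap) (simp add: sum_distrib_left)
  finally show ?thesis by (simp add: unitary_cols_orthonormal[OF U])
qed

lemma ptrace_carrier [simp]:
  "ptrace_B n m A \<in> carrier_mat n n" "ptrace_A n m A \<in> carrier_mat m m"
  by (simp_all add: ptrace_A_def ptrace_B_def)

lemma index_ptrace_B: "a < n \<Longrightarrow> a' < n \<Longrightarrow> ptrace_B n m A $$ (a,a') = (\<Sum>b<m. A $$ (a*m+b, a'*m+b))"
  by (simp add: ptrace_B_def)

lemma index_ptrace_A: "b < m \<Longrightarrow> b' < m \<Longrightarrow> ptrace_A n m A $$ (b,b') = (\<Sum>a<n. A $$ (a*m+b, a*m+b'))"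
  by (simp add: ptrace_A_def)

lemma psd_ptrace:
  assumes A: "A \<in> carrier_mat (n*m) (n*m)" "psd A"
  shows "psd (ptrace_B n m A)" "psd (ptrace_A n m A)"
proof -
  obtain f where f: "\<And>i j. i < n*m \<Longrightarrow> j < n*m \<Longrightarrow> A $$ (i,j) = (\<Sum>l<n*m. f l i * cnj (f l j))"
    using psd_gram_decomposition[OF A] by metis
  show "psd (ptrace_B n m A)"
  proof (rule psd_gram[where S = "{..<m} \<times> {..<n*m}" and f = "\<lambda>(b,l) a. f l (a*m+b)"])
    fix a a' assume "a < n" "a' < n"
    then show "ptrace_B n m A $$ (a,a') = (\<Sum>k\<in>{..<m} \<times> {..<n*m}. (case k of (b,l) \<Rightarrow> \<lambda>a. f l (a*m+b)) a * cnj ((case k of (b,l) \<Rightarrow> \<lambda>a. f l (a*m+b)) a'))"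
      by (simp add: index_ptrace_B f prod_index_less sum.cartesian_product case_prod_beta)
  qed auto
  show "psd (ptrace_A n m A)"
  proof (rule psd_gram[where S = "{..<n} \<times> {..<n*m}" and f = "\<lambda>(a,l) b. f l (a*m+b)"])
    fix b b' assume "b < m" "b' < m"
    then show "ptrace_A n m A $$ (b,b') = (\<Sum>k\<in>{..<n} \<times> {..<n*m}. (case k of (a,l) \<Rightarrow> \<lambda>b. f l (a*m+b)) b * cnj ((case k of (a,l) \<Rightarrow> \<lambda>b. f l (a*m+b)) b'))"
      by (simp add: index_ptrace_A f prod_index_less sum.cartesian_product case_prod_beta)
  qed auto
qed

lemma sum_innermost:
  "(\<Sum>j\<in>J. \<Sum>a\<in>A. \<Sum>b\<in>B. \<Sum>c\<in>C. \<Sum>d\<in>D. f j a b c d) = (\<Sum>a\<in>A. \<Sum>b\<in>B. \<Sum>c\<in>C. \<Sum>d\<in>D. \<Sum>j\<in>J. f j a b c d)"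
  by (simp only: sum.swap[of _ _ J])

text \<open>In the product \<open>W\<close> of eigenbases of the two marginals, the diagonal of
  \<open>A\<close> is a joint distribution \<open>q\<close> whose marginals are the two spectra.
  Discarding the off-diagonal entries can only raise the entropy, and the classical inequality
  applies to \<open>q\<close>.\<close>

theorem vN_entropy_subadditive:
  assumes A: "A \<in> carrier_mat (n*m) (n*m)" "psd A" and tr: "(\<Sum>i<n*m. A $$ (i,i)) = 1"
  shows "vN_entropy A \<le> vN_entropy (ptrace_B n m A) + vN_entropy (ptrace_A n m A)"
proof -
  obtain U \<beta> where U: "unitary_mat n U" and B: "ptrace_B n m A = U * real_diag n \<beta> * adj U"
    using psd_diagonalization[OF _ psd_ptrace(1)[OF A]] by (metis ptrace_carrier(1))
  obtain V \<gamma> where V: "unitary_mat m V" and G: "ptrace_A n m A = V * real_diag m \<gamma> * adj V"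
    using psd_diagonalization[OF _ psd_ptrace(2)[OF A]] by (metis ptrace_carrier(2))
  note u = unitary_matD[OF U] and v = unitary_matD[OF V]
  define W where "W = kron U V"
  have W: "unitary_mat (n*m) W" unfolding W_def by (rule unitary_kron[OF U V])
  note w = unitary_matD[OF W]
  define z where "z i j = (adj W * A * W) $$ (i*m+j,i*m+j)" for i j
  define q where "q i j = Re (z i j)" for i j
  have Wi: "W $$ (a*m+b, i*m+j) = U $$ (a,i) * V $$ (b,j)" if "a < n" "b < m" "i < n" "j < m" for a b i j
    unfolding W_def using that u(1) v(1) by (subst index_kron) (auto simp: prod_index_less)
  have z: "z i j = (\<Sum>a<n. \<Sum>b<m. \<Sum>a'<n. \<Sum>b'<m.
      (cnj (U $$ (a,i)) * U $$ (a',i)) * (cnj (V $$ (b,j)) * V $$ (b',j)) * A $$ (a*m+b, a'*m+b'))"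
    if "i < n" "j < m" for i j
    unfolding z_def index_conj[OF A(1) w(1) prod_index_less[OF that] prod_index_less[OF that]] sum_prod_index
    using that by (intro sum.cong refl) (simp add: Wi mult_ac)
  have \<beta>: "(\<Sum>j<m. z i j) = of_real (\<beta> i)" if i: "i < n" for i
  proof -
    have "(\<Sum>j<m. z i j) = (\<Sum>j<m. \<Sum>a<n. \<Sum>b<m. \<Sum>a'<n. \<Sum>b'<m.
      (cnj (U $$ (a,i)) * U $$ (a',i)) * (cnj (V $$ (b,j)) * V $$ (b',j)) * A $$ (a*m+b, a'*m+b'))"
      by (intro sum.cong refl) (simp add: z i)
    also have "\<dots> = (\<Sum>a<n. \<Sum>b<m. \<Sum>a'<n. \<Sum>b'<m. \<Sum>j<m.
      (cnj (U $$ (a,i)) * U $$ (a',i)) * (cnj (V $$ (b,j)) * V $$ (b',j)) * A $$ (a*m+b, a'*m+b'))"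
      by (rule sum_innermost)
    also have "\<dots> = (\<Sum>a<n. \<Sum>b<m. \<Sum>a'<n. \<Sum>b'<m.
      (cnj (U $$ (a,i)) * U $$ (a',i)) * (if b' = b then 1 else 0) * A $$ (a*m+b, a'*m+b'))"
      by (intro sum.cong refl) (simp add: unitary_rows_orthonormal[OF V, symmetric] sum_distrib_left sum_distrib_right mult_ac)
    also have "\<dots> = (\<Sum>a<n. \<Sum>b<m. \<Sum>a'<n. (cnj (U $$ (a,i)) * U $$ (a',i)) * A $$ (a*m+b, a'*m+b))"
      by (simp add: if_distrib[of "\<lambda>x. _ * x"] if_distrib[of "\<lambda>x. x * _"] cong: if_cong)
    also have "\<dots> = (\<Sum>a<n. \<Sum>a'<n. \<Sum>b<m. (cnj (U $$ (a,i)) * U $$ (a',i)) * A $$ (a*m+b, a'*m+b))"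
      by (rule sum.cong[OF refl], rule sum.swap)
    also have "\<dots> = (adj U * ptrace_B n m A * U) $$ (i,i)"
      by (simp add: index_conj[OF ptrace_carrier(1) u(1) i i] index_ptrace_B sum_distrib_left mult_ac)
    finally show ?thesis using i by (simp add: adj_conj_diagonalization[OF U B] real_diag_def)
  qed
  have \<gamma>: "(\<Sum>i<n. z i j) = of_real (\<gamma> j)" if j: "j < m" for j
  proof -
    have "(\<Sum>i<n. z i j) = (\<Sum>i<n. \<Sum>a<n. \<Sum>b<m. \<Sum>a'<n. \<Sum>b'<m.
      (cnj (U $$ (a,i)) * U $$ (a',i)) * (cnj (V $$ (b,j)) * V $$ (b',j)) * A $$ (a*m+b, a'*m+b'))"
      by (intro sum.cong refl) (simp add: z j)
    also have "\<dots> = (\<Sum>a<n. \<Sum>b<m. \<Sum>a'<n. \<Sum>b'<m. \<Sum>i<n.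
      (cnj (U $$ (a,i)) * U $$ (a',i)) * (cnj (V $$ (b,j)) * V $$ (b',j)) * A $$ (a*m+b, a'*m+b'))"
      by (rule sum_innermost)
    also have "\<dots> = (\<Sum>a<n. \<Sum>b<m. \<Sum>a'<n. \<Sum>b'<m.
      (if a' = a then 1 else 0) * ((cnj (V $$ (b,j)) * V $$ (b',j)) * A $$ (a*m+b, a'*m+b')))"
      by (intro sum.cong refl) (simp add: unitary_rows_orthonormal[OF U, symmetric] sum_distrib_left sum_distrib_right mult_ac)
    also have "\<dots> = (\<Sum>a<n. \<Sum>b<m. \<Sum>b'<m. \<Sum>a'<n.
      (if a' = a then (cnj (V $$ (b,j)) * V $$ (b',j)) * A $$ (a*m+b, a'*m+b') else 0))"
      by (rule sum.cong[OF refl], rule sum.cong[OF refl], subst sum.swap) (intro sum.cong refl, simp)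
    also have "\<dots> = (\<Sum>a<n. \<Sum>b<m. \<Sum>b'<m. (cnj (V $$ (b,j)) * V $$ (b',j)) * A $$ (a*m+b, a*m+b'))"
      by simp
    also have "\<dots> = (\<Sum>b<m. \<Sum>b'<m. \<Sum>a<n. (cnj (V $$ (b,j)) * V $$ (b',j)) * A $$ (a*m+b, a*m+b'))"
      by (rule sum_rotate[symmetric])
    also have "\<dots> = (adj V * ptrace_A n m A * V) $$ (j,j)"
      by (simp add: index_conj[OF ptrace_carrier(2) v(1) j j] index_ptrace_A sum_distrib_left mult_ac)
    finally show ?thesis using j by (simp add: adj_conj_diagonalization[OF V G] real_diag_def)
  qed
  have "(\<Sum>i<n. ptrace_B n m A $$ (i,i)) = 1"
    using tr by (simp add: index_ptrace_B sum_prod_index)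
  then have "of_real (\<Sum>i<n. \<beta> i) = complex_of_real 1"
    using trace_unitary_conj[OF U B] by simp
  then have s\<beta>: "(\<Sum>i<n. \<beta> i) = 1" by (simp only: of_real_eq_iff)
  have \<beta>q: "\<beta> i = (\<Sum>j<m. q i j)" if "i < n" for i
    using arg_cong[OF \<beta>[OF that], of Re] by (simp add: q_def)
  have \<gamma>q: "\<gamma> j = (\<Sum>i<n. q i j)" if "j < m" for j
    using arg_cong[OF \<gamma>[OF that], of Re] by (simp add: q_def)
  have q0: "q i j \<ge> 0" if "i < n" "j < m" for i j
    unfolding q_def z_def using psd_conj[OF A w(1)] A(1) w prod_index_less[OF that]
    by (intro psd_diag_nonneg[of _ "n*m"]) auto
  have "vN_entropy A \<le> - (\<Sum>i<n. \<Sum>j<m. xlogx (q i j))"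
    using vN_entropy_le_unitary_diag[OF A W] unfolding sum_prod_index q_def z_def .
  also have "\<dots> \<le> - ((\<Sum>i<n. xlogx (\<beta> i)) + (\<Sum>j<m. xlogx (\<gamma> j)))"
    using xlogx_subadditive[of n m q \<beta> \<gamma>] q0 \<beta>q \<gamma>q s\<beta> by simp
  also have "\<dots> = vN_entropy (ptrace_B n m A) + vN_entropy (ptrace_A n m A)"
    unfolding vN_entropy_unitary_conj[OF U B] vN_entropy_unitary_conj[OF V G] by simp
  finally show ?thesis .
qed

section \<open>Purifications and the Araki-Lieb inequality\<close>

lemma index_mult_adj:
  "i < dim_row M \<Longrightarrow> j < dim_row N \<Longrightarrow> dim_col M = dim_col N \<Longrightarrow>
    (M * adj N) $$ (i,j) = (\<Sum>k<dim_col N. M $$ (i,k) * cnj (N $$ (j,k)))"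
  by (subst index_mult_mat_sum) auto

lemma index_adj_mult:
  "i < dim_col M \<Longrightarrow> j < dim_col N \<Longrightarrow> dim_row M = dim_row N \<Longrightarrow>
    (adj M * N) $$ (i,j) = (\<Sum>k<dim_row N. cnj (M $$ (k,i)) * N $$ (k,j))"
  by (subst index_mult_mat_sum) auto

text \<open>The two matrices are the marginals of the bipartite vector with amplitudes
  \<open>f i k\<close>. With these index conventions they are \<open>M * adj M\<close> and the
  transpose of \<open>adj M * M\<close>, and transposition preserves the spectrum.\<close>

lemma vN_entropy_gram_swap:
  "vN_entropy (mat n n (\<lambda>(i,j). \<Sum>k<m. f i k * cnj (f j k))) =
   vN_entropy (mat m m (\<lambda>(k,l). \<Sum>i<n. f i k * cnj (f i l)))"
proof -
  define M where "M = mat n m (\<lambda>(i,k). f i k)"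
  have M: "M \<in> carrier_mat n m" by (simp add: M_def)
  have "mat n n (\<lambda>(i,j). \<Sum>k<m. f i k * cnj (f j k)) = M * adj M"
    by (rule eq_matI) (auto simp: M_def index_mult_adj simp del: index_mult_mat(1))
  moreover have "mat m m (\<lambda>(k,l). \<Sum>i<n. f i k * cnj (f i l)) = (adj M * M)\<^sup>T"
    by (rule eq_matI) (auto simp: M_def index_adj_mult mult.commute simp del: index_mult_mat(1))
  ultimately show ?thesis
    using vN_entropy_mult_commute[OF M, of "adj M"] vN_entropy_transpose[of "adj M * M" m] M by simp
qed

text \<open>Amplitudes \<open>f r a b\<close> of a pure state of three systems: \<open>R A\<close> and \<open>B\<close> have equal entropy, so
  subadditivity bounds the entropy of one system by those of the other two.\<close>

lemma entropy_triangle: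
  fixes f :: "nat \<Rightarrow> nat \<Rightarrow> nat \<Rightarrow> complex"
  assumes norm: "(\<Sum>r<n. \<Sum>a<k. \<Sum>b<m. (cmod (f r a b))\<^sup>2) = 1"
  shows "vN_entropy (mat m m (\<lambda>(b,b'). \<Sum>r<n. \<Sum>a<k. f r a b * cnj (f r a b')))
    \<le> vN_entropy (mat n n (\<lambda>(r,r'). \<Sum>a<k. \<Sum>b<m. f r a b * cnj (f r' a b)))
     + vN_entropy (mat k k (\<lambda>(a,a'). \<Sum>r<n. \<Sum>b<m. f r a b * cnj (f r a' b)))"
proof -
  define g where "g i b = f (i div k) (i mod k) b" for i b
  define A where "A = mat (n*k) (n*k) (\<lambda>(i,j). \<Sum>b<m. g i b * cnj (g j b))"
  have A: "A \<in> carrier_mat (n*k) (n*k)" by (simp add: A_def)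
  have "psd A" by (rule psd_gram[OF A, where S = "{..<m}" and f = "\<lambda>b i. g i b"]) (simp add: A_def)
  have tr: "(\<Sum>i<n*k. A $$ (i,i)) = 1"
    using arg_cong[OF norm, of complex_of_real] 
    by (simp add: A_def sum_prod_index prod_index_less g_def complex_norm_square del: of_real_power)
  have "mat m m (\<lambda>(b,b'). \<Sum>r<n. \<Sum>a<k. f r a b * cnj (f r a b')) = mat m m (\<lambda>(b,b'). \<Sum>i<n*k. g i b * cnj (g i b'))"
    by (rule eq_matI) (auto simp: sum_prod_index g_def)
  then have "vN_entropy (mat m m (\<lambda>(b,b'). \<Sum>r<n. \<Sum>a<k. f r a b * cnj (f r a b'))) = vN_entropy A"
    unfolding A_def vN_entropy_gram_swap[where n = "n*k" and m = m and f = g] by simp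
  moreover have "ptrace_B n k A = mat n n (\<lambda>(r,r'). \<Sum>a<k. \<Sum>b<m. f r a b * cnj (f r' a b))"
    by (rule eq_matI) (auto simp: ptrace_B_def A_def prod_index_less g_def)
  moreover have "ptrace_A n k A = mat k k (\<lambda>(a,a'). \<Sum>r<n. \<Sum>b<m. f r a b * cnj (f r a' b))"
    by (rule eq_matI) (auto simp: ptrace_A_def A_def prod_index_less g_def)
  ultimately show ?thesis using vN_entropy_subadditive[OF A \<open>psd A\<close> tr] by simp
qed

text \<open>Reading \<open>r\<close> as the basis index of a third system turns any decomposition of
  \<open>\<rho>\<close> into a purification; in the final application the \<open>f r\<close> are the
  weighted ensemble vectors. The third system has the entropy of \<open>\<rho>\<close>, and the two
  signs of the absolute value come from exchanging the roles of \<open>A\<close> and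
  \<open>B\<close> in the triangle inequality.\<close>

theorem araki_lieb:
  fixes f :: "nat \<Rightarrow> nat \<Rightarrow> complex"
  assumes \<rho>: "\<rho> \<in> carrier_mat (dA*dB) (dA*dB)"
      "\<And>i j. i < dA*dB \<Longrightarrow> j < dA*dB \<Longrightarrow> \<rho> $$ (i,j) = (\<Sum>r<n. f r i * cnj (f r j))"
    and norm: "(\<Sum>r<n. \<Sum>i<dA*dB. (cmod (f r i))\<^sup>2) = 1"
  shows "\<bar>vN_entropy (ptrace_B dA dB \<rho>) - vN_entropy (ptrace_A dA dB \<rho>)\<bar> \<le> vN_entropy \<rho>"
proof -
  have "\<rho> = mat (dA*dB) (dA*dB) (\<lambda>(i,j). \<Sum>r<n. f r i * cnj (f r j))"
    by (rule eq_matI) (use \<rho> in auto)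
  then have "vN_entropy \<rho> = vN_entropy (mat n n (\<lambda>(r,r'). \<Sum>i<dA*dB. f r i * cnj (f r' i)))"
    using vN_entropy_gram_swap[where n = "dA*dB" and m = n and f = "\<lambda>i r. f r i"] by simp
  then have S: "vN_entropy \<rho> = vN_entropy (mat n n (\<lambda>(r,r'). \<Sum>a<dA. \<Sum>b<dB. f r (a*dB+b) * cnj (f r' (a*dB+b))))"
    unfolding sum_prod_index .
  have S': "vN_entropy \<rho> = vN_entropy (mat n n (\<lambda>(r,r'). \<Sum>b<dB. \<Sum>a<dA. f r (a*dB+b) * cnj (f r' (a*dB+b))))"
    unfolding S by (subst sum.swap) simp
  have A: "ptrace_B dA dB \<rho> = mat dA dA (\<lambda>(a,a'). \<Sum>r<n. \<Sum>b<dB. f r (a*dB+b) * cnj (f r (a'*dB+b)))"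
    by (rule eq_matI) (auto simp: ptrace_B_def \<rho> prod_index_less intro: sum.swap)
  have B: "ptrace_A dA dB \<rho> = mat dB dB (\<lambda>(b,b'). \<Sum>r<n. \<Sum>a<dA. f r (a*dB+b) * cnj (f r (a*dB+b')))"
    by (rule eq_matI) (auto simp: ptrace_A_def \<rho> prod_index_less intro: sum.swap)
  have norm1: "(\<Sum>r<n. \<Sum>a<dA. \<Sum>b<dB. (cmod (f r (a*dB+b)))\<^sup>2) = 1"
    using norm by (simp add: sum_prod_index)
  have norm2: "(\<Sum>r<n. \<Sum>b<dB. \<Sum>a<dA. (cmod (f r (a*dB+b)))\<^sup>2) = 1"
    by (subst sum.swap) (rule norm1)
  show ?thesis
    using entropy_triangle[OF norm1, folded S A B] entropy_triangle[OF norm2, folded S' A B] by linarith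
qed

lemma ptrace_pure_entropy:
  assumes \<psi>: "\<psi> \<in> carrier_vec (dA*dB)"
  shows "vN_entropy (ptrace_A dA dB (proj \<psi>)) = vN_entropy (ptrace_B dA dB (proj \<psi>))"
proof -
  have "ptrace_B dA dB (proj \<psi>) = mat dA dA (\<lambda>(a,a'). \<Sum>b<dB. \<psi> $ (a*dB+b) * cnj (\<psi> $ (a'*dB+b)))"
    by (rule eq_matI) (use \<psi> in \<open>auto simp: ptrace_B_def proj_def prod_index_less\<close>)
  moreover have "ptrace_A dA dB (proj \<psi>) = mat dB dB (\<lambda>(b,b'). \<Sum>a<dA. \<psi> $ (a*dB+b) * cnj (\<psi> $ (a*dB+b')))"
    by (rule eq_matI) (use \<psi> in \<open>auto simp: ptrace_A_def proj_def prod_index_less\<close>)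
  ultimately show ?thesis using vN_entropy_gram_swap[where n = dA and m = dB and f = "\<lambda>a b. \<psi> $ (a*dB+b)"] by simp
qed

text \<open>The purifying system carries the Gram matrix of the vectors \<open>\<psi> i\<close>
  scaled by \<open>sqrt (p i)\<close>. Its diagonal is \<open>p\<close>, and forgetting the overlaps
  off the diagonal can only raise the entropy.\<close>

lemma vN_entropy_ensemble_le_shannon:
  fixes n :: nat
  assumes p: "\<And>i. i < n \<Longrightarrow> p i \<ge> 0" and \<psi>: "\<And>i. i < n \<Longrightarrow> \<psi> i \<in> carrier_vec d \<and> unit_vector (\<psi> i)"
  shows "vN_entropy (ens_state d n p (\<lambda>i. proj (\<psi> i))) \<le> shannon n p"
proof -
  define f where "f k i = complex_of_real (sqrt (p i)) * \<psi> i $ k" for k i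
  have pp: "complex_of_real (p i) = of_real (sqrt (p i)) * of_real (sqrt (p i))" if "i < n" for i
    using p[OF that] by (simp flip: of_real_mult)
  have "dim_vec (\<psi> i) = d" if "i < n" for i using \<psi>[OF that] by auto
  then have "ens_state d n p (\<lambda>i. proj (\<psi> i)) = mat d d (\<lambda>(k,l). \<Sum>i<n. f k i * cnj (f l i))"
    unfolding ens_state_def
    by (intro cong_mat) (auto simp: proj_def f_def pp intro!: sum.cong)
  then have "vN_entropy (ens_state d n p (\<lambda>i. proj (\<psi> i))) = vN_entropy (mat n n (\<lambda>(i,j). \<Sum>k<d. f k i * cnj (f k j)))"
    (is "_ = vN_entropy ?G") using vN_entropy_gram_swap[where n = d and m = n and f = f] by simp
  also have "\<dots> \<le> - (\<Sum>i<n. xlogx (Re (?G $$ (i,i))))"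
    by (intro vN_entropy_le_diag psd_gram[where f = "\<lambda>k i. f k i" and S = "{..<d}"]) auto
  also have "Re (?G $$ (i,i)) = p i" if i: "i < n" for i
  proof -
    have "?G $$ (i,i) = (\<Sum>k<d. complex_of_real (p i) * of_real ((cmod (\<psi> i $ k))\<^sup>2))"
      using i by (simp add: f_def pp complex_norm_square mult_ac del: of_real_power)
    also have "\<dots> = of_real (p i * (\<Sum>k<d. (cmod (\<psi> i $ k))\<^sup>2))"
      by (simp add: sum_distrib_left)
    also have "(\<Sum>k<d. (cmod (\<psi> i $ k))\<^sup>2) = 1"
      using \<psi>[OF i] by (auto simp: unit_vector_def)
    finally show ?thesis by simp
  qed
  then have "- (\<Sum>i<n. xlogx (Re (?G $$ (i,i)))) = shannon n p" by (simp add: shannon_def)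
  finally show ?thesis .
qed

lemma kron_diagonalization:
  assumes U: "unitary_mat n U" and A: "A = U * real_diag n d * adj U"
    and V: "unitary_mat m V" and B: "B = V * real_diag m e * adj V"
  shows "kron A B = kron U V * real_diag (n*m) (\<lambda>k. d (k div m) * e (k mod m)) * adj (kron U V)"
proof -
  note u = unitary_matD[OF U] and v = unitary_matD[OF V]
  have "kron (real_diag n d) (real_diag m e) = real_diag (n*m) (\<lambda>k. d (k div m) * e (k mod m))"
  proof (rule eq_matI)
    fix i j assume "i < dim_row (real_diag (n*m) (\<lambda>k. d (k div m) * e (k mod m)))"
      "j < dim_col (real_diag (n*m) (\<lambda>k. d (k div m) * e (k mod m)))"
    then have ij: "i < n*m" "j < n*m" by auto
    have "i div m = j div m \<and> i mod m = j mod m \<longleftrightarrow> i = j" by (metis div_mult_mod_eq)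
    then show "kron (real_diag n d) (real_diag m e) $$ (i,j) = real_diag (n*m) (\<lambda>k. d (k div m) * e (k mod m)) $$ (i,j)"
      using ij less_mult_divmod[OF ij(1)] less_mult_divmod[OF ij(2)] by (auto simp: index_kron real_diag_def)
  qed auto
  then show ?thesis
    unfolding A B adj_kron using u v
    by (simp add: kron_mult[of _ n n _ m m _ n _ m] flip: kron_mult[of _ n n _ m m _ n _ m])
qed

lemma vN_entropy_kron:
  assumes A: "density_op n A" and B: "density_op m B"
  shows "vN_entropy (kron A B) = vN_entropy A + vN_entropy B"
proof -
  from A B have A': "A \<in> carrier_mat n n" "psd A" "mtrace A = 1" and B': "B \<in> carrier_mat m m" "psd B" "mtrace B = 1"
    by (auto simp: density_op_def)
  obtain U d where U: "unitary_mat n U" and Ad: "A = U * real_diag n d * adj U" and d: "\<And>i. i < n \<Longrightarrow> d i \<ge> 0"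
    using psd_diagonalization[OF A'(1,2)] by metis
  obtain V e where V: "unitary_mat m V" and Be: "B = V * real_diag m e * adj V" and e: "\<And>i. i < m \<Longrightarrow> e i \<ge> 0"
    using psd_diagonalization[OF B'(1,2)] by metis
  have "of_real (\<Sum>i<n. d i) = complex_of_real 1"
    using trace_unitary_conj[OF U Ad] A' by (simp add: mtrace_def)
  then have sd: "(\<Sum>i<n. d i) = 1" by (simp only: of_real_eq_iff)
  have "of_real (\<Sum>i<m. e i) = complex_of_real 1"
    using trace_unitary_conj[OF V Be] B' by (simp add: mtrace_def)
  then have se: "(\<Sum>i<m. e i) = 1" by (simp only: of_real_eq_iff)
  have "vN_entropy (kron A B) = - (\<Sum>i<n. \<Sum>j<m. xlogx (d i * e j))"
    using vN_entropy_unitary_conj[OF unitary_kron[OF U V] kron_diagonalization[OF U Ad V Be]] by (simp add: sum_prod_index)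
  also have "(\<Sum>i<n. \<Sum>j<m. xlogx (d i * e j)) = (\<Sum>i<n. \<Sum>j<m. e j * xlogx (d i) + d i * xlogx (e j))"
    using d e by (intro sum.cong refl xlogx_mult) auto
  also have "\<dots> = (\<Sum>i<n. xlogx (d i)) + (\<Sum>j<m. xlogx (e j))"
    using sd se by (simp add: sum.distrib flip: sum_distrib_left sum_distrib_right)
  finally show ?thesis unfolding vN_entropy_unitary_conj[OF U Ad] vN_entropy_unitary_conj[OF V Be] by simp
qed

subsection \<open>Phases and polar decomposition\<close>

text \<open>Bessel's inequality without normalization, from the squared norm of
  \<open>C * w - u\<close> where \<open>u\<close> is the sum of the \<open>y i * e i\<close>. Zero
  vectors among the \<open>e i\<close> are allowed, which matters when some eigenvalues of a
  marginal vanish.\<close>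

lemma bessel:
  fixes e :: "'i \<Rightarrow> 's \<Rightarrow> complex"
  assumes I: "finite I" and C: "C > 0"
    and orth: "\<And>i j. i \<in> I \<Longrightarrow> j \<in> I \<Longrightarrow> (\<Sum>s\<in>S. e i s * cnj (e j s)) = (if i = j then of_real (c i) else 0)"
    and c: "\<And>i. i \<in> I \<Longrightarrow> c i \<le> C"
  shows "(\<Sum>i\<in>I. (cmod (\<Sum>s\<in>S. w s * cnj (e i s)))\<^sup>2) \<le> C * (\<Sum>s\<in>S. (cmod (w s))\<^sup>2)"
proof -
  define y where "y i = (\<Sum>s\<in>S. w s * cnj (e i s))" for i
  define N where "N = (\<Sum>s\<in>S. (cmod (w s))\<^sup>2)"
  define M where "M = (\<Sum>i\<in>I. (cmod (y i))\<^sup>2)"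
  define u where "u s = (\<Sum>i\<in>I. y i * e i s)" for s
  have N: "complex_of_real N = (\<Sum>s\<in>S. w s * cnj (w s))"
    by (simp add: N_def complex_norm_square del: of_real_power)
  have M: "complex_of_real M = (\<Sum>i\<in>I. y i * cnj (y i))"
    by (simp add: M_def complex_norm_square del: of_real_power)
  have wu: "(\<Sum>s\<in>S. w s * cnj (u s)) = of_real M"
  proof -
    have "(\<Sum>s\<in>S. w s * cnj (u s)) = (\<Sum>s\<in>S. \<Sum>i\<in>I. cnj (y i) * (w s * cnj (e i s)))"
      by (simp add: u_def sum_distrib_left mult_ac)
    also have "\<dots> = (\<Sum>i\<in>I. cnj (y i) * y i)"
      by (subst sum.swap) (simp add: y_def sum_distrib_left)
    finally show ?thesis by (simp add: M mult.commute)
  qed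
  have uu: "(\<Sum>s\<in>S. u s * cnj (u s)) = of_real (\<Sum>i\<in>I. (cmod (y i))\<^sup>2 * c i)"
  proof -
    have "(\<Sum>s\<in>S. u s * cnj (u s)) = (\<Sum>s\<in>S. \<Sum>i\<in>I. \<Sum>j\<in>I. (y i * e i s) * cnj (y j * e j s))"
      by (simp add: u_def sum_product)
    also have "\<dots> = (\<Sum>i\<in>I. \<Sum>j\<in>I. \<Sum>s\<in>S. (y i * e i s) * cnj (y j * e j s))"
      by (rule sum_rotate[symmetric])
    also have "\<dots> = (\<Sum>i\<in>I. \<Sum>j\<in>I. y i * cnj (y j) * (\<Sum>s\<in>S. e i s * cnj (e j s)))"
      by (simp add: sum_distrib_left mult_ac)
    also have "\<dots> = (\<Sum>i\<in>I. \<Sum>j\<in>I. if i = j then y i * cnj (y j) * of_real (c i) else 0)"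
      by (intro sum.cong refl) (simp add: orth)
    also have "\<dots> = (\<Sum>i\<in>I. y i * cnj (y i) * of_real (c i))" using I by simp
    finally show ?thesis by (simp add: complex_norm_square del: of_real_power)
  qed
  have "complex_of_real (\<Sum>s\<in>S. (cmod (of_real C * w s - u s))\<^sup>2)
      = (\<Sum>s\<in>S. (of_real C * w s - u s) * cnj (of_real C * w s - u s))"
    by (simp add: complex_norm_square del: of_real_power complex_cnj_diff)
  also have "\<dots> = of_real C * of_real C * (\<Sum>s\<in>S. w s * cnj (w s))
      - of_real C * (\<Sum>s\<in>S. w s * cnj (u s)) - of_real C * cnj (\<Sum>s\<in>S. w s * cnj (u s)) + (\<Sum>s\<in>S. u s * cnj (u s))"
    by (simp add: algebra_simps sum.distrib sum_subtractf sum_distrib_left)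
  also have "\<dots> = of_real (C * C * N - 2 * C * M + (\<Sum>i\<in>I. (cmod (y i))\<^sup>2 * c i))"
    unfolding wu uu N[symmetric] by (simp add: algebra_simps)
  finally have "C * C * N - 2 * C * M + (\<Sum>i\<in>I. (cmod (y i))\<^sup>2 * c i) = (\<Sum>s\<in>S. (cmod (of_real C * w s - u s))\<^sup>2)"
    by (simp only: of_real_eq_iff)
  then have "C * C * N - 2 * C * M + (\<Sum>i\<in>I. (cmod (y i))\<^sup>2 * c i) \<ge> 0"
    by (simp add: sum_nonneg)
  moreover have "(\<Sum>i\<in>I. (cmod (y i))\<^sup>2 * c i) \<le> (\<Sum>i\<in>I. (cmod (y i))\<^sup>2 * C)"
    using c by (intro sum_mono mult_left_mono) auto
  moreover have "(\<Sum>i\<in>I. (cmod (y i))\<^sup>2 * C) = C * M" by (simp add: M_def sum_distrib_left mult.commute)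
  ultimately have "C * M \<le> C * (C * N)" by (simp add: mult_ac)
  then have "M \<le> C * N" using C by simp
  then show ?thesis by (simp add: M_def N_def y_def)
qed

text \<open>The Gram matrices of the rows and of the columns of \<open>v\<close> have the same
  Frobenius norm. In the error estimate this trades pairs of indices of the purifying system and
  \<open>A\<close> for pairs of indices of \<open>B\<close>.\<close>

lemma frobenius_swap:
  fixes v :: "'s \<Rightarrow> 'b \<Rightarrow> complex"
  shows "(\<Sum>s\<in>S. \<Sum>t\<in>S. (cmod (\<Sum>b\<in>B. v s b * cnj (v t b)))\<^sup>2) = (\<Sum>b\<in>B. \<Sum>c\<in>B. (cmod (\<Sum>s\<in>S. v s b * cnj (v s c)))\<^sup>2)"
proof -
  have "complex_of_real (\<Sum>s\<in>S. \<Sum>t\<in>S. (cmod (\<Sum>b\<in>B. v s b * cnj (v t b)))\<^sup>2)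
     = (\<Sum>s\<in>S. \<Sum>t\<in>S. \<Sum>b\<in>B. \<Sum>c\<in>B. (v s b * cnj (v t b)) * cnj (v s c * cnj (v t c)))"
    by (simp add: complex_norm_square sum_product del: of_real_power complex_cnj_mult)
  also have "\<dots> = (\<Sum>b\<in>B. \<Sum>c\<in>B. \<Sum>s\<in>S. \<Sum>t\<in>S. (v s b * cnj (v s c)) * cnj (v t b * cnj (v t c)))"
    by (subst sum_rotate, rule sum.cong[OF refl], subst sum_rotate) (simp add: mult_ac)
  also have "\<dots> = complex_of_real (\<Sum>b\<in>B. \<Sum>c\<in>B. (cmod (\<Sum>s\<in>S. v s b * cnj (v s c)))\<^sup>2)"
    by (simp add: complex_norm_square sum_product del: of_real_power complex_cnj_mult)
  finally show ?thesis by (simp only: of_real_eq_iff)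
qed

section \<open>Finite phase ensembles\<close>

lemma sum_cis_roots:
  assumes t: "\<bar>t\<bar> < int P"
  shows "(\<Sum>s<P. cis (2 * pi * real s * real_of_int t / real P)) = (if t = 0 then of_nat P else 0)"
proof (cases "t = 0")
  case False
  from t have P: "P > 0" by linarith
  define z where "z = cis (2 * pi * real_of_int t / real P)"
  have "z \<noteq> 1"
  proof
    assume "z = 1"
    then have "cos (2 * pi * real_of_int t / real P) = 1" by (simp add: z_def complex_eq_iff)
    then obtain k :: int where "2 * pi * real_of_int t / real P = of_int k * 2 * pi"
      unfolding cos_one_2pi_int by blast
    then have "real_of_int t = real_of_int (k * int P)" using P by (simp add: field_simps)
    then have "t = k * int P" by (simp only: of_int_eq_iff)
    with False t P show False by (auto simp: abs_mult)
  qed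
  have "(\<Sum>s<P. cis (2 * pi * real s * real_of_int t / real P)) = (\<Sum>s<P. z ^ s)"
    by (simp add: z_def Complex.DeMoivre mult_ac)
  also have "\<dots> = (z ^ P - 1) / (z - 1)" using \<open>z \<noteq> 1\<close> by (rule geometric_sum)
  also have "z ^ P = 1"
    using P cis_multiple_2pi[of "real_of_int t"] by (simp add: z_def Complex.DeMoivre mult_ac)
  finally show ?thesis using False by simp
qed simp

text \<open>The leading exponents must agree: if \<open>p < q\<close>, then \<open>4 ^ q\<close> is
  at least \<open>4 * 4 ^ p\<close>, whereas the left side is at most
  \<open>2 * 4 ^ p\<close>.\<close>

lemma sidon_powers_aux:
  assumes "v \<le> p" "u \<le> q" "(4::int) ^ p + 4 ^ v = 4 ^ q + 4 ^ u"
  shows "p = q \<and> v = u"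
proof -
  have *: "\<not> p < q" if "v \<le> p" "(4::int) ^ p + 4 ^ v = 4 ^ q + 4 ^ u" for p q u v :: nat
  proof
    assume "p < q"
    then have "(4::int) ^ Suc p \<le> 4 ^ q" by (intro power_increasing) auto
    moreover have "(4::int) ^ v \<le> 4 ^ p" using that by (intro power_increasing) auto
    moreover have "(4::int) ^ u > 0" "(4::int) ^ p > 0" by auto
    ultimately show False using that(2) by simp
  qed
  have "p = q" using *[of v p q u] *[of u q p v] assms by auto
  then show ?thesis using assms by simp
qed

lemma sidon_powers:
  "(4::int) ^ p + 4 ^ v = 4 ^ q + 4 ^ u \<longleftrightarrow> (p = q \<and> v = u) \<or> (p = u \<and> v = q)"
proof
  assume "(4::int) ^ p + 4 ^ v = 4 ^ q + 4 ^ u"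
  then have "(4::int) ^ p + 4 ^ v = 4 ^ q + 4 ^ u" "(4::int) ^ p + 4 ^ v = 4 ^ u + 4 ^ q"
    "(4::int) ^ v + 4 ^ p = 4 ^ q + 4 ^ u" "(4::int) ^ v + 4 ^ p = 4 ^ u + 4 ^ q" by linarith+
  note sidon_powers_aux[OF _ _ this(1)] sidon_powers_aux[OF _ _ this(2)]
    sidon_powers_aux[OF _ _ this(3)] sidon_powers_aux[OF _ _ this(4)]
  then show "(p = q \<and> v = u) \<or> (p = u \<and> v = q)" using linear[of v p] linear[of u q] by blast
qed (elim disjE, simp_all)

text \<open>Since the frequencies \<open>4 ^ p\<close> form a Sidon set, the phases \<open>cis (2 * pi * s * 4 ^ p / P)\<close> have the second
  and fourth moments of independent uniform phases.\<close>

lemma phase_ensemble: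
  obtains P :: nat and x :: "nat \<Rightarrow> nat \<Rightarrow> complex" where "P > 0"
    "\<And>p q. p < l \<Longrightarrow> q < l \<Longrightarrow> (\<Sum>s<P. x s p * cnj (x s q)) = (if p = q then of_nat P else 0)"
    "\<And>p q u v. p < l \<Longrightarrow> q < l \<Longrightarrow> u < l \<Longrightarrow> v < l \<Longrightarrow>
      (\<Sum>s<P. (x s p * cnj (x s q)) * cnj (x s u * cnj (x s v))) = (if (p = q \<and> v = u) \<or> (p = u \<and> v = q) then of_nat P else 0)"
proof
  \<comment> \<open>Each frequency is at most a quarter of \<open>4 ^ l\<close>, so all exponents
    that occur are smaller than \<open>P\<close> in absolute value. Hence there is no wrap-around
    modulo \<open>P\<close>, and a sum over \<open>s\<close> vanishes unless the integer exponent
    itself is 0.\<close>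
  define P :: nat where "P = 4 ^ Suc l"
  define x where "x s p = cis (2 * pi * real s * real_of_int (4 ^ p) / real P)" for s p
  show "P > 0" by (simp add: P_def)
  have b: "0 < (4::int) ^ p \<and> 4 * (4::int) ^ p \<le> 4 ^ l" if "p < l" for p
    using that power_increasing[of "Suc p" l "4::int"] by auto
  have P: "int P = 4 * 4 ^ l" by (simp add: P_def)
  fix p q assume pq: "p < l" "q < l"
  have "x s p * cnj (x s q) = cis (2 * pi * real s * real_of_int (4 ^ p - 4 ^ q) / real P)" for s
    by (simp add: x_def cis_cnj cis_mult diff_divide_distrib right_diff_distrib)
  moreover have "\<bar>(4::int) ^ p - 4 ^ q\<bar> < int P" unfolding P using b[OF pq(1)] b[OF pq(2)] by linarith
  ultimately show "(\<Sum>s<P. x s p * cnj (x s q)) = (if p = q then of_nat P else 0)"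
    using sum_cis_roots[of "4 ^ p - 4 ^ q" P] by (simp add: eq_iff_diff_eq_0[symmetric])
  fix u v assume uv: "u < l" "v < l"
  have "(x s p * cnj (x s q)) * cnj (x s u * cnj (x s v))
      = cis (2 * pi * real s * real_of_int ((4 ^ p + 4 ^ v) - (4 ^ q + 4 ^ u)) / real P)" for s
    by (simp add: x_def cis_cnj cis_mult) (simp add: diff_divide_distrib add_divide_distrib right_diff_distrib distrib_left algebra_simps)
  moreover have "\<bar>((4::int) ^ p + 4 ^ v) - (4 ^ q + 4 ^ u)\<bar> < int P"
    unfolding P using b[OF pq(1)] b[OF pq(2)] b[OF uv(1)] b[OF uv(2)] by linarith
  moreover have "((4::int) ^ p + 4 ^ v) - (4 ^ q + 4 ^ u) = 0 \<longleftrightarrow> (p = q \<and> v = u) \<or> (p = u \<and> v = q)"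
    using sidon_powers[of p v q u] by simp
  ultimately show "(\<Sum>s<P. (x s p * cnj (x s q)) * cnj (x s u * cnj (x s v)))
      = (if (p = q \<and> v = u) \<or> (p = u \<and> v = q) then of_nat P else 0)"
    using sum_cis_roots[of "(4 ^ p + 4 ^ v) - (4 ^ q + 4 ^ u)" P] by simp
qed

lemma real_diag_mult: "real_diag n d * real_diag n e = real_diag n (\<lambda>i. d i * e i)"
  by (rule eq_matI) (auto simp: index_mult_mat_sum real_diag_def if_distrib simp del: index_mult_mat(1) cong: if_cong)

text \<open>The partial isometry of the polar decomposition. The lower bound on \<open>Y V\<^sup>* = sqrt (Y Y\<^sup>*)\<close>
  is the scalar inequality \<open>2 * sqrt t \<ge> 3 * t - t\<^sup>2\<close>, tight at \<open>t = 1\<close>.\<close>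

lemma polar_isometry:
  fixes Y :: "nat \<Rightarrow> nat \<Rightarrow> complex"
  obtains V L :: "nat \<Rightarrow> nat \<Rightarrow> complex" where
    "\<And>b c. b < d \<Longrightarrow> c < d \<Longrightarrow>
      (\<Sum>i<n. cnj (V i b) * V i c) + (\<Sum>l<d. cnj (L l b) * L l c) = (if b = c then 1 else 0)"
    "\<And>i. i < n \<Longrightarrow> 2 * Re (\<Sum>b<d. Y i b * cnj (V i b))
      \<ge> 3 * (\<Sum>b<d. (cmod (Y i b))\<^sup>2) - (\<Sum>j<n. (cmod (\<Sum>b<d. Y i b * cnj (Y j b)))\<^sup>2)"
    "\<And>b i. b < d \<Longrightarrow> (\<And>j. j < n \<Longrightarrow> Y j b = 0) \<Longrightarrow> V i b = 0"
proof -
  define A where "A = mat n n (\<lambda>(i,j). \<Sum>b<d. Y i b * cnj (Y j b))"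
  have A: "A \<in> carrier_mat n n" by (simp add: A_def)
  have psdA: "psd A" by (rule psd_gram[OF A, where S = "{..<d}" and f = "\<lambda>b i. Y i b"]) (simp add: A_def)
  obtain U k where U: "unitary_mat n U" and Ak: "A = U * real_diag n k * adj U" and k: "\<And>i. i < n \<Longrightarrow> k i \<ge> 0"
    using psd_diagonalization[OF A psdA] by metis
  note u = unitary_matD[OF U]
  define w where "w l b = (\<Sum>i<n. cnj (U $$ (i,l)) * Y i b)" for l b
  \<comment> \<open>Division by zero yields 0, so \<open>e l\<close> vanishes when
    \<open>k l = 0\<close> and \<open>V\<close> is only a partial isometry.\<close>
  define e where "e l b = w l b / of_real (sqrt (k l))" for l b
  define V where "V i b = (\<Sum>l<n. U $$ (i,l) * e l b)" for i b
  have ww: "(\<Sum>b<d. w l b * cnj (w m b)) = (if l = m then of_real (k l) else 0)" if lm: "l < n" "m < n" for l m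
  proof -
    have "(\<Sum>b<d. w l b * cnj (w m b)) = (\<Sum>b<d. \<Sum>i<n. \<Sum>j<n. cnj (U $$ (i,l)) * (Y i b * cnj (Y j b)) * U $$ (j,m))"
      by (simp add: w_def sum_product mult_ac)
    also have "\<dots> = (\<Sum>i<n. \<Sum>j<n. \<Sum>b<d. cnj (U $$ (i,l)) * (Y i b * cnj (Y j b)) * U $$ (j,m))"
      by (rule sum_rotate[symmetric])
    also have "\<dots> = (adj U * A * U) $$ (l,m)"
      unfolding index_conj[OF A u(1) lm] by (simp add: A_def sum_distrib_left sum_distrib_right)
    finally show ?thesis using lm by (simp add: adj_conj_diagonalization[OF U Ak] real_diag_def)
  qed
  have we: "(\<Sum>b<d. w l b * cnj (e m b)) = (if l = m then of_real (sqrt (k l)) else 0)" if lm: "l < n" "m < n" for l m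
  proof -
    have "(\<Sum>b<d. w l b * cnj (e m b)) = (\<Sum>b<d. w l b * cnj (w m b)) / of_real (sqrt (k m))"
      by (simp add: e_def sum_divide_distrib)
    also have "\<dots> = (if l = m then of_real (k l / sqrt (k l)) else 0)" using ww[OF lm] by auto
    also have "k l / sqrt (k l) = sqrt (k l)" using k[OF lm(1)] by (simp add: real_div_sqrt)
    finally show ?thesis .
  qed
  have ee: "(\<Sum>b<d. e l b * cnj (e m b)) = (if l = m \<and> k l \<noteq> 0 then 1 else 0)" if lm: "l < n" "m < n" for l m
  proof -
    have "(\<Sum>b<d. e l b * cnj (e m b)) = (\<Sum>b<d. w l b * cnj (e m b)) / of_real (sqrt (k l))"
      by (simp add: e_def sum_divide_distrib mult.commute)
    then show ?thesis using we[OF lm] by auto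
  qed
  define Q where "Q b c = (\<Sum>l<n. cnj (e l b) * e l c)" for b c
  have VV: "(\<Sum>i<n. cnj (V i b) * V i c) = Q b c" for b c
  proof -
    have "(\<Sum>i<n. cnj (V i b) * V i c) = (\<Sum>i<n. \<Sum>l<n. \<Sum>m<n. (cnj (e l b) * e m c) * (cnj (U $$ (i,l)) * U $$ (i,m)))"
      by (simp add: V_def sum_product) (simp add: mult_ac)
    also have "\<dots> = (\<Sum>l<n. \<Sum>m<n. \<Sum>i<n. (cnj (e l b) * e m c) * (cnj (U $$ (i,l)) * U $$ (i,m)))"
      by (rule sum_rotate[symmetric])
    also have "\<dots> = (\<Sum>l<n. \<Sum>m<n. if l = m then cnj (e l b) * e m c else 0)"
      by (intro sum.cong refl) (simp add: unitary_cols_orthonormal[OF U] flip: sum_distrib_left)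
    finally show ?thesis by (simp add: Q_def)
  qed
  have cnjQ: "cnj (Q b c) = Q c b" for b c by (simp add: Q_def mult.commute)
  have QQ: "(\<Sum>b<d. Q a b * Q b c) = Q a c" for a c
  proof -
    have "(\<Sum>b<d. Q a b * Q b c) = (\<Sum>b<d. \<Sum>l<n. \<Sum>m<n. (cnj (e l a) * e m c) * (e l b * cnj (e m b)))"
      by (simp add: Q_def sum_product) (simp add: mult_ac)
    also have "\<dots> = (\<Sum>l<n. \<Sum>m<n. \<Sum>b<d. (cnj (e l a) * e m c) * (e l b * cnj (e m b)))"
      by (rule sum_rotate[symmetric])
    also have "\<dots> = (\<Sum>l<n. \<Sum>m<n. if l = m then (if k l \<noteq> 0 then cnj (e l a) * e m c else 0) else 0)"
      by (intro sum.cong refl) (simp add: ee flip: sum_distrib_left)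
    also have "\<dots> = (\<Sum>l<n. if k l \<noteq> 0 then cnj (e l a) * e l c else 0)" by simp
    also have "\<dots> = Q a c" unfolding Q_def by (intro sum.cong refl) (simp add: e_def)
    finally show ?thesis .
  qed
  \<comment> \<open>\<open>Q\<close> is the projection onto the support of \<open>V\<close>. Its
    complement \<open>L\<close> is again a projection, so adding it completes the rows of
    \<open>V\<close> to a resolution of the identity.\<close>
  define L where "L l b = (if l = b then 1 else 0) - Q l b" for l b
  show ?thesis
  proof (rule that[of V L])
    fix b c assume bc: "b < d" "c < d"
    have "(\<Sum>l<d. cnj (L l b) * L l c) = (\<Sum>l<d. (if l = b then (if l = c then 1 else 0) else 0)
       - (if l = b then Q l c else 0) - (if l = c then Q b l else 0) + Q b l * Q l c)"
      by (intro sum.cong refl) (auto simp: L_def cnjQ algebra_simps)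
    also have "\<dots> = (if b = c then 1 else 0) - Q b c"
      using bc QQ[of b c] by (simp add: sum.distrib sum_subtractf)
    finally show "(\<Sum>i<n. cnj (V i b) * V i c) + (\<Sum>l<d. cnj (L l b) * L l c) = (if b = c then 1 else 0)"
      by (simp add: VV)
  next
    fix i assume i: "i < n"
    have Yw: "Y i b = (\<Sum>l<n. U $$ (i,l) * w l b)" for b
    proof -
      have "(\<Sum>l<n. U $$ (i,l) * w l b) = (\<Sum>l<n. \<Sum>j<n. (U $$ (i,l) * cnj (U $$ (j,l))) * Y j b)"
        by (simp add: w_def sum_distrib_left mult_ac)
      also have "\<dots> = (\<Sum>j<n. (\<Sum>l<n. U $$ (i,l) * cnj (U $$ (j,l))) * Y j b)"
        by (subst sum.swap) (simp add: sum_distrib_right)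
      also have "\<dots> = (\<Sum>j<n. if j = i then Y j b else 0)"
        using i by (intro sum.cong refl) (auto simp: unitary_rows_orthonormal[OF U])
      finally show ?thesis using i by simp
    qed
    define p where "p l = (cmod (U $$ (i,l)))\<^sup>2" for l
    have p: "U $$ (i,l) * cnj (U $$ (i,l)) = of_real (p l)" for l
      by (simp add: p_def complex_norm_square del: of_real_power)
    have "(\<Sum>b<d. Y i b * cnj (V i b)) = (\<Sum>b<d. \<Sum>l<n. \<Sum>m<n. (U $$ (i,l) * cnj (U $$ (i,m))) * (w l b * cnj (e m b)))"
      by (simp add: Yw V_def sum_product) (simp add: mult_ac)
    also have "\<dots> = (\<Sum>l<n. \<Sum>m<n. \<Sum>b<d. (U $$ (i,l) * cnj (U $$ (i,m))) * (w l b * cnj (e m b)))"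
      by (rule sum_rotate[symmetric])
    also have "\<dots> = (\<Sum>l<n. \<Sum>m<n. if l = m then (U $$ (i,l) * cnj (U $$ (i,m))) * of_real (sqrt (k l)) else 0)"
      by (intro sum.cong refl) (simp add: we flip: sum_distrib_left)
    also have "\<dots> = of_real (\<Sum>l<n. p l * sqrt (k l))" by (simp add: p)
    finally have YV: "Re (\<Sum>b<d. Y i b * cnj (V i b)) = (\<Sum>l<n. p l * sqrt (k l))" by simp
    have "complex_of_real (\<Sum>b<d. (cmod (Y i b))\<^sup>2) = A $$ (i,i)"
      using i by (simp add: A_def complex_norm_square del: of_real_power)
    also have "\<dots> = of_real (\<Sum>l<n. p l * k l)"
      unfolding Ak index_unitary_conj[OF U i i] by (simp add: p mult.commute)
    finally have YY: "(\<Sum>b<d. (cmod (Y i b))\<^sup>2) = (\<Sum>l<n. p l * k l)" by (simp only: of_real_eq_iff)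
    have "complex_of_real (\<Sum>j<n. (cmod (\<Sum>b<d. Y i b * cnj (Y j b)))\<^sup>2) = (A * adj A) $$ (i,i)"
      using i A by (subst index_mult_adj) (auto simp: A_def complex_norm_square simp del: of_real_power)
    also have "A * adj A = U * real_diag n (\<lambda>l. k l * k l) * adj U"
    proof -
      have "adj A = A" using psdA by (simp add: psd_def)
      then have "A * adj A = U * real_diag n k * ((adj U * U) * (real_diag n k * adj U))"
        using u(1) unfolding Ak by (simp add: mult_mat_assoc)
      also have "\<dots> = U * (real_diag n k * real_diag n k) * adj U"
        using u by (simp add: mult_mat_assoc left_mult_one_mat[of _ n n])
      finally show ?thesis by (simp add: real_diag_mult)
    qed
    also have "(U * real_diag n (\<lambda>l. k l * k l) * adj U) $$ (i,i) = of_real (\<Sum>l<n. p l * (k l * k l))"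
      unfolding index_unitary_conj[OF U i i] by (simp add: p mult_ac)
    finally have YYYY: "(\<Sum>j<n. (cmod (\<Sum>b<d. Y i b * cnj (Y j b)))\<^sup>2) = (\<Sum>l<n. p l * (k l * k l))"
      by (simp only: of_real_eq_iff)
    have sc: "3 * t - t * t \<le> 2 * sqrt t" if t: "t \<ge> 0" for t :: real
    proof -
      define s where "s = sqrt t"
      have s: "s \<ge> 0" "t = s * s" using t by (auto simp: s_def)
      have "2 * s - (3 * (s*s) - (s*s) * (s*s)) = s * ((s - 1)\<^sup>2 * (s + 2))"
        by (simp add: power2_eq_square algebra_simps)
      also have "\<dots> \<ge> 0" using s by auto
      finally show ?thesis by (simp add: s s_def[symmetric])
    qed
    have "(\<Sum>l<n. p l * (3 * k l - k l * k l)) \<le> (\<Sum>l<n. p l * (2 * sqrt (k l)))"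
      using k sc by (intro sum_mono mult_left_mono) (auto simp: p_def)
    then show "2 * Re (\<Sum>b<d. Y i b * cnj (V i b))
      \<ge> 3 * (\<Sum>b<d. (cmod (Y i b))\<^sup>2) - (\<Sum>j<n. (cmod (\<Sum>b<d. Y i b * cnj (Y j b)))\<^sup>2)"
      unfolding YV YY YYYY by (simp add: algebra_simps sum_subtractf sum_distrib_left)
  next
    fix b i assume "b < d" "\<And>j. j < n \<Longrightarrow> Y j b = 0"
    then show "V i b = 0" by (simp add: V_def e_def w_def)
  qed
qed

subsection \<open>One-shot hashing\<close>

lemma sum_add_index:
  fixes f :: "nat \<Rightarrow> 'a::comm_monoid_add"
  shows "(\<Sum>k<n+m. f k) = (\<Sum>k<n. f k) + (\<Sum>k<m. f (n+k))"
  by (induction m) (auto simp: add_ac)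

lemma sum_Times: "(\<Sum>z\<in>A\<times>B. f z) = (\<Sum>a\<in>A. \<Sum>b\<in>B. f (a,b))"
  by (simp add: sum.cartesian_product)

text \<open>The fourth moment leaves two pairings: \<open>z = y\<close>, which gives the sum of
  squares, and, when \<open>k = k'\<close>, both \<open>z\<close> and \<open>y\<close> on the
  diagonal, which gives the squared trace of \<open>h\<close>. Their overlap is counted twice and
  has to be subtracted; discarding this negative term leaves the bound.\<close>

lemma phase_quadratic_bound:
  fixes x :: "nat \<Rightarrow> nat \<Rightarrow> complex" and h :: "nat \<times> nat \<Rightarrow> complex"
  assumes four: "\<And>p q u v. p < K*n \<Longrightarrow> q < K*n \<Longrightarrow> u < K*n \<Longrightarrow> v < K*n \<Longrightarrow>
      (\<Sum>s<P. (x s p * cnj (x s q)) * cnj (x s u * cnj (x s v))) = (if (p = q \<and> v = u) \<or> (p = u \<and> v = q) then of_nat P else 0)"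
    and k: "k < K" "k' < K"
  shows "(\<Sum>s<P. (cmod (\<Sum>z\<in>{..<n}\<times>{..<n}. (x s (k*n + fst z) * cnj (x s (k'*n + snd z))) * h z))\<^sup>2)
     \<le> P * ((\<Sum>z\<in>{..<n}\<times>{..<n}. (cmod (h z))\<^sup>2) + (if k = k' then (cmod (\<Sum>a<n. h (a,a)))\<^sup>2 else 0))"
proof -
  let ?S = "{..<n}\<times>{..<n}"
  define X where "X s z = x s (k*n + fst z) * cnj (x s (k'*n + snd z))" for s z
  define g where "g z = (if fst z = snd z then h z else 0)" for z
  define \<delta> :: complex where "\<delta> = (if k = k' then 1 else 0)"
  have idx: "k*n+a = k'*n+a' \<longleftrightarrow> k = k' \<and> a = a'" if "a < n" "a' < n" for k k' a a' :: nat
    using that by (metis index_div_mod)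
  have XX: "(\<Sum>s<P. X s z * cnj (X s y)) * (h z * cnj (h y)) = of_nat P *
      ((if z = y then h z * cnj (h y) else 0) + \<delta> * (g z * cnj (g y)) - (if z = y then \<delta> * (g z * cnj (g y)) else 0))"
    if zy: "z \<in> ?S" "y \<in> ?S" for z y
  proof -
    have l: "k*n + fst z < K*n" "k'*n + snd z < K*n" "k*n + fst y < K*n" "k'*n + snd y < K*n"
      using zy k by (auto intro: prod_index_less)
    have "(\<Sum>s<P. X s z * cnj (X s y)) = (if (k = k' \<and> fst z = snd z \<and> fst y = snd y) \<or> z = y then of_nat P else 0)"
      unfolding X_def four[OF l] using zy by (auto simp: idx prod_eq_iff)
    then show ?thesis by (auto simp: \<delta>_def g_def)
  qed
  have "complex_of_real (\<Sum>s<P. (cmod (\<Sum>z\<in>?S. X s z * h z))\<^sup>2)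
      = (\<Sum>s<P. \<Sum>z\<in>?S. \<Sum>y\<in>?S. (X s z * cnj (X s y)) * (h z * cnj (h y)))"
    by (simp add: complex_norm_square sum_product del: of_real_power) (simp add: mult_ac)
  also have "\<dots> = (\<Sum>z\<in>?S. \<Sum>y\<in>?S. (\<Sum>s<P. X s z * cnj (X s y)) * (h z * cnj (h y)))"
    by (subst sum_rotate[symmetric]) (simp add: sum_distrib_right)
  also have "\<dots> = (\<Sum>z\<in>?S. \<Sum>y\<in>?S. of_nat P *
      ((if z = y then h z * cnj (h y) else 0) + \<delta> * (g z * cnj (g y)) - (if z = y then \<delta> * (g z * cnj (g y)) else 0)))"
    by (intro sum.cong refl XX)
  also have "\<dots> = of_nat P * ((\<Sum>z\<in>?S. h z * cnj (h z)) + \<delta> * (\<Sum>z\<in>?S. \<Sum>y\<in>?S. g z * cnj (g y)) - \<delta> * (\<Sum>z\<in>?S. g z * cnj (g z)))"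
    by (simp add: sum_distrib_left[symmetric] sum.distrib sum_subtractf)
  also have "(\<Sum>z\<in>?S. \<Sum>y\<in>?S. g z * cnj (g y)) = (\<Sum>z\<in>?S. g z) * cnj (\<Sum>z\<in>?S. g z)"
    by (simp add: sum_product)
  also have "(\<Sum>z\<in>?S. g z) = (\<Sum>a<n. h (a,a))"
    by (simp add: sum_Times g_def)
  also have "of_nat P * ((\<Sum>z\<in>?S. h z * cnj (h z)) + \<delta> * ((\<Sum>a<n. h (a,a)) * cnj (\<Sum>a<n. h (a,a))) - \<delta> * (\<Sum>z\<in>?S. g z * cnj (g z)))
     = of_real (P * ((\<Sum>z\<in>?S. (cmod (h z))\<^sup>2) + (if k = k' then (cmod (\<Sum>a<n. h (a,a)))\<^sup>2 else 0) - (if k = k' then \<Sum>z\<in>?S. (cmod (g z))\<^sup>2 else 0)))"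
    by (simp add: \<delta>_def complex_norm_square del: of_real_power cnj_sum)
  finally have "(\<Sum>s<P. (cmod (\<Sum>z\<in>?S. X s z * h z))\<^sup>2)
     = P * ((\<Sum>z\<in>?S. (cmod (h z))\<^sup>2) + (if k = k' then (cmod (\<Sum>a<n. h (a,a)))\<^sup>2 else 0) - (if k = k' then \<Sum>z\<in>?S. (cmod (g z))\<^sup>2 else 0))"
    by (simp only: of_real_eq_iff)
  also have "\<dots> \<le> P * ((\<Sum>z\<in>?S. (cmod (h z))\<^sup>2) + (if k = k' then (cmod (\<Sum>a<n. h (a,a)))\<^sup>2 else 0))"
    by (intro mult_left_mono) (auto intro!: sum_nonneg)
  finally show ?thesis by (simp add: X_def)
qed

text \<open>For \<open>r'\<close> in \<open>TR\<close> the normalized vectors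
  \<open>\<phi> r'\<close> are orthonormal, so Bessel's inequality bounds the overlaps with the
  truncation of \<open>\<phi> r\<close> to \<open>TB\<close> by the squared norm of that truncation.
  This controls the squared-trace term of the fourth moment: truncation spoils the orthogonality of
  different \<open>r\<close>, but no more than this.\<close>

lemma one_shot_error_diag:
  fixes \<phi> :: "nat \<Rightarrow> nat \<Rightarrow> nat \<Rightarrow> complex"
  assumes orth: "\<And>r r'. r < R \<Longrightarrow> r' < R \<Longrightarrow>
        (\<Sum>a<dA. \<Sum>b<dB. \<phi> r a b * cnj (\<phi> r' a b)) = (if r = r' then complex_of_real (\<mu> r) else 0)"
    and TR: "TR \<subseteq> {..<R}" "\<And>r. r \<in> TR \<Longrightarrow> \<mu> r > 0" and TB: "TB \<subseteq> {..<dB}" and r: "r \<in> TR"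
    and g: "\<And>r a b. g r a b = (if r \<in> TR \<and> b \<in> TB then \<phi> r a b / complex_of_real (sqrt (\<mu> r)) else 0)"
  shows "\<mu> r * (\<Sum>r'<R. (cmod (\<Sum>a<dA. \<Sum>b<dB. g r a b * cnj (g r' a b)))\<^sup>2) \<le> (\<Sum>a<dA. \<Sum>b\<in>TB. (cmod (\<phi> r a b))\<^sup>2)"
proof -
  let ?S = "{..<dA}\<times>{..<dB}"
  define w where "w z = (if snd z \<in> TB then \<phi> r (fst z) (snd z) else 0)" for z
  define e where "e r' z = \<phi> r' (fst z) (snd z) / complex_of_real (sqrt (\<mu> r'))" for r' z
  have fTR: "finite TR" using TR(1) finite_subset by blast
  have "\<mu> r * (\<Sum>r'<R. (cmod (\<Sum>a<dA. \<Sum>b<dB. g r a b * cnj (g r' a b)))\<^sup>2)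
      = \<mu> r * (\<Sum>r'\<in>TR. (cmod (\<Sum>a<dA. \<Sum>b<dB. g r a b * cnj (g r' a b)))\<^sup>2)"
    using TR(1) by (intro arg_cong[of _ _ "(*) _"] sum.mono_neutral_right) (auto simp: g)
  also have "\<dots> = (\<Sum>r'\<in>TR. (cmod (\<Sum>z\<in>?S. w z * cnj (e r' z)))\<^sup>2)"
    unfolding sum_distrib_left
  proof (intro sum.cong refl)
    fix r' assume r': "r' \<in> TR"
    have "(\<Sum>a<dA. \<Sum>b<dB. g r a b * cnj (g r' a b)) = (\<Sum>z\<in>?S. w z * cnj (e r' z)) / complex_of_real (sqrt (\<mu> r))"
      unfolding sum.cartesian_product sum_divide_distrib using r r'
      by (intro sum.cong refl) (auto simp: g w_def e_def)
    moreover have "\<mu> r > 0" using TR r by auto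
    ultimately show "\<mu> r * (cmod (\<Sum>a<dA. \<Sum>b<dB. g r a b * cnj (g r' a b)))\<^sup>2 = (cmod (\<Sum>z\<in>?S. w z * cnj (e r' z)))\<^sup>2"
      by (simp add: norm_divide power_divide)
  qed
  also have "\<dots> \<le> 1 * (\<Sum>z\<in>?S. (cmod (w z))\<^sup>2)"
  proof (rule bessel[OF fTR, where c = "\<lambda>_. 1"])
    fix i j assume ij: "i \<in> TR" "j \<in> TR"
    have "(\<Sum>z\<in>?S. e i z * cnj (e j z)) = (\<Sum>a<dA. \<Sum>b<dB. \<phi> i a b * cnj (\<phi> j a b)) / (complex_of_real (sqrt (\<mu> i)) * complex_of_real (sqrt (\<mu> j)))"
      unfolding sum.cartesian_product sum_divide_distrib by (intro sum.cong refl) (auto simp: e_def)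
    also have "\<dots> = (if i = j then of_real (\<mu> i / (sqrt (\<mu> i) * sqrt (\<mu> i))) else 0)"
      using TR(1) ij by (subst orth) (auto simp del: real_sqrt_mult_self)
    finally show "(\<Sum>z\<in>?S. e i z * cnj (e j z)) = (if i = j then complex_of_real 1 else 0)"
      using TR(2)[OF ij(1)] by auto
  qed auto
  also have "1 * (\<Sum>z\<in>?S. (cmod (w z))\<^sup>2) = (\<Sum>a<dA. \<Sum>b<dB. if b \<in> TB then (cmod (\<phi> r a b))\<^sup>2 else 0)"
    unfolding sum.cartesian_product by (simp, intro sum.cong refl) (auto simp: w_def)
  also have "\<dots> = (\<Sum>a<dA. \<Sum>b\<in>TB. (cmod (\<phi> r a b))\<^sup>2)"
    using TB by (intro sum.cong[OF refl] sum.mono_neutral_cong_right) auto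
  finally show ?thesis .
qed

text \<open>The weight \<open>\<mu> r\<close> cancels one normalization and
  \<open>\<mu> r' \<ge> \<mu>0\<close> bounds the other. What remains is a squared Frobenius norm
  over pairs \<open>(r, a)\<close>; rewritten over pairs \<open>(b, c)\<close> it is the purity of a
  truncated \<open>B\<close> marginal, which Bessel's inequality bounds through
  \<open>\<nu> b \<le> \<nu>0\<close>. The ratio \<open>\<nu>0 / \<mu>0\<close> originates
  here.\<close>

lemma one_shot_error_offdiag:
  fixes \<phi> :: "nat \<Rightarrow> nat \<Rightarrow> nat \<Rightarrow> complex"
  assumes orthB: "\<And>b c. b < dB \<Longrightarrow> c < dB \<Longrightarrow>
        (\<Sum>r<R. \<Sum>a<dA. \<phi> r a b * cnj (\<phi> r a c)) = (if b = c then complex_of_real (\<nu> b) else 0)"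
    and TR: "TR \<subseteq> {..<R}" "\<And>r. r \<in> TR \<Longrightarrow> \<mu> r \<ge> \<mu>0" "\<mu>0 > 0"
    and TB: "TB \<subseteq> {..<dB}" "\<And>b. b \<in> TB \<Longrightarrow> \<nu> b \<le> \<nu>0" "\<nu>0 > 0"
    and g: "\<And>r a b. g r a b = (if r \<in> TR \<and> b \<in> TB then \<phi> r a b / complex_of_real (sqrt (\<mu> r)) else 0)"
  shows "(\<Sum>r\<in>TR. \<mu> r * (\<Sum>r'<R. \<Sum>z\<in>{..<dA}\<times>{..<dA}. (cmod (\<Sum>b<dB. g r (fst z) b * cnj (g r' (snd z) b)))\<^sup>2))
     \<le> \<nu>0 / \<mu>0 * (\<Sum>r\<in>TR. \<Sum>a<dA. \<Sum>b\<in>TB. (cmod (\<phi> r a b))\<^sup>2)"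
proof -
  let ?AA = "{..<dA}\<times>{..<dA}" and ?S = "TR\<times>{..<dA}"
  have fTR: "finite TR" and fTB: "finite TB" using TR(1) TB(1) finite_subset by blast+
  define v where "v s b = \<phi> (fst s) (snd s) b" for s b
  have "(\<Sum>r\<in>TR. \<mu> r * (\<Sum>r'<R. \<Sum>z\<in>?AA. (cmod (\<Sum>b<dB. g r (fst z) b * cnj (g r' (snd z) b)))\<^sup>2))
    = (\<Sum>r\<in>TR. \<mu> r * (\<Sum>r'\<in>TR. \<Sum>z\<in>?AA. (cmod (\<Sum>b<dB. g r (fst z) b * cnj (g r' (snd z) b)))\<^sup>2))"
    using TR(1) by (intro sum.cong[OF refl] arg_cong[of _ _ "(*) _"] sum.mono_neutral_right) (auto simp: g)
  also have "\<dots> \<le> (\<Sum>r\<in>TR. \<Sum>r'\<in>TR. \<Sum>z\<in>?AA. 1/\<mu>0 * (cmod (\<Sum>b\<in>TB. v (r,fst z) b * cnj (v (r',snd z) b)))\<^sup>2)"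
    unfolding sum_distrib_left
  proof (intro sum_mono)
    fix r r' z assume r: "r \<in> TR" and r': "r' \<in> TR"
    have pos: "\<mu> r > 0" "\<mu> r' \<ge> \<mu>0" "\<mu> r' > 0" using TR(2)[OF r] TR(2)[OF r'] TR(3) by auto
    have "(\<Sum>b<dB. g r (fst z) b * cnj (g r' (snd z) b)) = (\<Sum>b\<in>TB. g r (fst z) b * cnj (g r' (snd z) b))"
      using TB(1) by (intro sum.mono_neutral_right) (auto simp: g)
    also have "\<dots> = (\<Sum>b\<in>TB. v (r,fst z) b * cnj (v (r',snd z) b)) / complex_of_real (sqrt (\<mu> r) * sqrt (\<mu> r'))"
      unfolding sum_divide_distrib using r r' by (intro sum.cong refl) (auto simp: g v_def)
    finally have "(cmod (\<Sum>b<dB. g r (fst z) b * cnj (g r' (snd z) b)))\<^sup>2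
        = (cmod (\<Sum>b\<in>TB. v (r,fst z) b * cnj (v (r',snd z) b)))\<^sup>2 / (\<mu> r * \<mu> r')"
      using pos by (simp add: norm_divide power_divide norm_mult power_mult_distrib)
    then have "\<mu> r * (cmod (\<Sum>b<dB. g r (fst z) b * cnj (g r' (snd z) b)))\<^sup>2
        = (cmod (\<Sum>b\<in>TB. v (r,fst z) b * cnj (v (r',snd z) b)))\<^sup>2 / \<mu> r'"
      using pos by simp
    also have "\<dots> \<le> (cmod (\<Sum>b\<in>TB. v (r,fst z) b * cnj (v (r',snd z) b)))\<^sup>2 / \<mu>0"
      using pos TR(3) by (intro divide_left_mono) auto
    finally show "\<mu> r * (cmod (\<Sum>b<dB. g r (fst z) b * cnj (g r' (snd z) b)))\<^sup>2
        \<le> 1/\<mu>0 * (cmod (\<Sum>b\<in>TB. v (r,fst z) b * cnj (v (r',snd z) b)))\<^sup>2" by simp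
  qed
  also have "\<dots> = 1/\<mu>0 * (\<Sum>s\<in>?S. \<Sum>t\<in>?S. (cmod (\<Sum>b\<in>TB. v s b * cnj (v t b)))\<^sup>2)"
  proof -
    have "(\<Sum>s\<in>?S. \<Sum>t\<in>?S. (cmod (\<Sum>b\<in>TB. v s b * cnj (v t b)))\<^sup>2)
        = (\<Sum>r\<in>TR. \<Sum>a<dA. \<Sum>r'\<in>TR. \<Sum>a'<dA. (cmod (\<Sum>b\<in>TB. v (r,a) b * cnj (v (r',a') b)))\<^sup>2)"
      unfolding sum_Times ..
    also have "\<dots> = (\<Sum>r\<in>TR. \<Sum>r'\<in>TR. \<Sum>a<dA. \<Sum>a'<dA. (cmod (\<Sum>b\<in>TB. v (r,a) b * cnj (v (r',a') b)))\<^sup>2)"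
      by (intro sum.cong[OF refl] sum.swap)
    finally show ?thesis by (simp add: sum.cartesian_product case_prod_beta sum_distrib_left)
  qed
  also have "(\<Sum>s\<in>?S. \<Sum>t\<in>?S. (cmod (\<Sum>b\<in>TB. v s b * cnj (v t b)))\<^sup>2) = (\<Sum>b\<in>TB. \<Sum>c\<in>TB. (cmod (\<Sum>s\<in>?S. v s b * cnj (v s c)))\<^sup>2)"
    by (rule frobenius_swap)
  also have "\<dots> \<le> (\<Sum>b\<in>TB. \<nu>0 * (\<Sum>s\<in>?S. (cmod (v s b))\<^sup>2))"
  proof (intro sum_mono)
    fix b assume b: "b \<in> TB"
    let ?S' = "{..<R}\<times>{..<dA}"
    \<comment> \<open>The orthogonality \<open>orthB\<close> holds only for sums over all
      \<open>r < R\<close>, so the truncated vector is extended by 0 to the full index set.\<close>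
    define w where "w s = (if s \<in> ?S then v s b else 0)" for s
    have sub: "?S \<subseteq> ?S'" using TR(1) by auto
    have "(\<Sum>c\<in>TB. (cmod (\<Sum>s\<in>?S'. w s * cnj (v s c)))\<^sup>2) \<le> \<nu>0 * (\<Sum>s\<in>?S'. (cmod (w s))\<^sup>2)"
    proof (rule bessel[OF fTB TB(3), where c = \<nu>])
      fix i j assume "i \<in> TB" "j \<in> TB"
      then have "i < dB" "j < dB" using TB(1) by auto
      then show "(\<Sum>s\<in>?S'. v s i * cnj (v s j)) = (if i = j then complex_of_real (\<nu> i) else 0)"
        using orthB[of i j] by (simp add: sum.cartesian_product case_prod_beta v_def)
    qed (use TB in auto)
    moreover have "(\<Sum>s\<in>?S'. w s * cnj (v s c)) = (\<Sum>s\<in>?S. v s b * cnj (v s c))" for c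
      using sub by (intro sum.mono_neutral_cong_right) (auto simp: w_def)
    moreover have "(\<Sum>s\<in>?S'. (cmod (w s))\<^sup>2) = (\<Sum>s\<in>?S. (cmod (v s b))\<^sup>2)"
      using sub by (intro sum.mono_neutral_cong_right) (auto simp: w_def)
    ultimately show "(\<Sum>c\<in>TB. (cmod (\<Sum>s\<in>?S. v s b * cnj (v s c)))\<^sup>2) \<le> \<nu>0 * (\<Sum>s\<in>?S. (cmod (v s b))\<^sup>2)"
      by simp
  qed
  also have "(\<Sum>b\<in>TB. \<nu>0 * (\<Sum>s\<in>?S. (cmod (v s b))\<^sup>2)) = \<nu>0 * (\<Sum>r\<in>TR. \<Sum>a<dA. \<Sum>b\<in>TB. (cmod (\<phi> r a b))\<^sup>2)"
    unfolding sum_distrib_left[symmetric]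
    by (subst sum.swap) (simp add: sum_Times v_def)
  finally show ?thesis using TR(3) by (simp add: divide_right_mono)
qed


text \<open>Here \<open>r\<close> indexes the purifying system, \<open>X s\<close> are the operators
  of the measuring party, \<open>D s j\<close> those of the decoding party after outcome
  \<open>s\<close>, and the last sum is the fidelity with the maximally entangled state. With
  \<open>m\<close> the typical mass, the bound arises as \<open>3 * m\<close> from the traces of the
  Gram matrices, minus \<open>m\<close> and \<open>K * \<nu>0 / \<mu>0\<close> from their squares,
  minus 1 from linearizing a square.\<close>

theorem one_shot_hashing:
  fixes \<phi> :: "nat \<Rightarrow> nat \<Rightarrow> nat \<Rightarrow> complex"
  assumes orth: "\<And>r r'. r < R \<Longrightarrow> r' < R \<Longrightarrow>
        (\<Sum>a<dA. \<Sum>b<dB. \<phi> r a b * cnj (\<phi> r' a b)) = (if r = r' then complex_of_real (\<mu> r) else 0)"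
    and orthB: "\<And>b c. b < dB \<Longrightarrow> c < dB \<Longrightarrow>
        (\<Sum>r<R. \<Sum>a<dA. \<phi> r a b * cnj (\<phi> r a c)) = (if b = c then complex_of_real (\<nu> b) else 0)"
    and \<mu>1: "(\<Sum>r<R. \<mu> r) = 1" and \<mu>nonneg: "\<And>r. r < R \<Longrightarrow> \<mu> r \<ge> 0"
    and pos: "\<mu>0 > 0" "\<nu>0 > 0" "K > 0"
    and TR: "TR = {r. r < R \<and> \<mu> r \<ge> \<mu>0}" and TB: "TB = {b. b < dB \<and> \<nu> b \<le> \<nu>0}"
  obtains P J :: nat and X :: "nat \<Rightarrow> nat \<Rightarrow> nat \<Rightarrow> complex" and D :: "nat \<Rightarrow> nat \<Rightarrow> nat \<Rightarrow> nat \<Rightarrow> complex" where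
    "\<And>a a'. a < dA \<Longrightarrow> a' < dA \<Longrightarrow> (\<Sum>s<P. \<Sum>k<K. cnj (X s k a) * X s k a') = (if a = a' then 1 else 0)"
    "\<And>s b b'. b < dB \<Longrightarrow> b' < dB \<Longrightarrow> (\<Sum>j<J. \<Sum>k<K. cnj (D s j k b) * D s j k b') = (if b = b' then 1 else 0)"
    "(\<Sum>s<P. \<Sum>j<J. \<Sum>r<R. (cmod (\<Sum>k<K. \<Sum>a<dA. \<Sum>b<dB. X s k a * D s j k b * \<phi> r a b))\<^sup>2 / K)
      \<ge> 2 * (\<Sum>r\<in>TR. \<Sum>a<dA. \<Sum>b\<in>TB. (cmod (\<phi> r a b))\<^sup>2) - 1 - K * \<nu>0 / \<mu>0"
proof -
  obtain P :: nat and x where P: "P > 0"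
    and two: "\<And>p q. p < K*dA \<Longrightarrow> q < K*dA \<Longrightarrow> (\<Sum>s<P. x s p * cnj (x s q)) = (if p = q then of_nat P else 0)"
    and four: "\<And>p q u v. p < K*dA \<Longrightarrow> q < K*dA \<Longrightarrow> u < K*dA \<Longrightarrow> v < K*dA \<Longrightarrow>
      (\<Sum>s<P. (x s p * cnj (x s q)) * cnj (x s u * cnj (x s v))) = (if (p = q \<and> v = u) \<or> (p = u \<and> v = q) then of_nat P else 0)"
    by (rule phase_ensemble[of "K*dA"]) blast
  have TR': "TR \<subseteq> {..<R}" "\<And>r. r \<in> TR \<Longrightarrow> \<mu> r > 0" "\<And>r. r \<in> TR \<Longrightarrow> \<mu> r \<ge> \<mu>0" "finite TR" using pos by (auto simp: TR)
  have TB': "TB \<subseteq> {..<dB}" "\<And>b. b \<in> TB \<Longrightarrow> \<nu> b \<le> \<nu>0" "finite TB" by (auto simp: TB)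
  \<comment> \<open>The division by \<open>sqrt (\<mu> r)\<close> aims at Gram matrices close to the
    identity, where the polar estimate is tight. The row index \<open>r * K + k\<close> of
    \<open>Y s\<close> pairs the purifying system with the output \<open>k\<close>: orthonormal rows
    would mean that these two are decoupled and \<open>k\<close> is uniform.\<close>
  define g where "g r a b = (if r \<in> TR \<and> b \<in> TB then \<phi> r a b / complex_of_real (sqrt (\<mu> r)) else 0)" for r a b
  define Y where "Y s i b = (\<Sum>a<dA. x s ((i mod K)*dA+a) * g (i div K) a b)" for s i b
  define h where "h r r' z = (\<Sum>b<dB. g r (fst z) b * cnj (g r' (snd z) b))" for r r' and z :: "nat \<times> nat"
  define mr where "mr r = (\<Sum>a<dA. \<Sum>b\<in>TB. (cmod (\<phi> r a b))\<^sup>2)" for r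
  define m where "m = (\<Sum>r\<in>TR. mr r)"
  define \<alpha> where "\<alpha> s i = (\<Sum>b<dB. (cmod (Y s i b))\<^sup>2)" for s i
  define \<beta> where "\<beta> s i = (\<Sum>j<R*K. (cmod (\<Sum>b<dB. Y s i b * cnj (Y s j b)))\<^sup>2)" for s i
  define Q where "Q s V L \<longleftrightarrow> (\<forall>b c. b < dB \<longrightarrow> c < dB \<longrightarrow>
      (\<Sum>i<R*K. cnj (V i b) * V i c) + (\<Sum>l<dB. cnj (L l b) * L l c) = (if b = c then 1 else 0)) \<and>
    (\<forall>i<R*K. 2 * Re (\<Sum>b<dB. Y s i b * cnj (V i b)) \<ge> 3 * \<alpha> s i - \<beta> s i) \<and>
    (\<forall>b i. b < dB \<longrightarrow> (\<forall>j<R*K. Y s j b = 0) \<longrightarrow> V i b = 0)" for s and V L :: "nat \<Rightarrow> nat \<Rightarrow> complex"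
  have "\<exists>VL. Q s (fst VL) (snd VL)" for s
  proof -
    obtain V L where "\<And>b c. b < dB \<Longrightarrow> c < dB \<Longrightarrow>
        (\<Sum>i<R*K. cnj (V i b) * V i c) + (\<Sum>l<dB. cnj (L l b) * L l c) = (if b = c then 1 else 0)"
      "\<And>i. i < R*K \<Longrightarrow> 2 * Re (\<Sum>b<dB. Y s i b * cnj (V i b)) \<ge> 3 * \<alpha> s i - \<beta> s i"
      "\<And>b i. b < dB \<Longrightarrow> (\<And>j. j < R*K \<Longrightarrow> Y s j b = 0) \<Longrightarrow> V i b = 0"
      unfolding \<alpha>_def \<beta>_def by (rule polar_isometry[where d = dB and n = "R*K" and Y = "Y s"]) blast
    then have "Q s V L" unfolding Q_def by blast
    then show ?thesis by (intro exI[of _ "(V, L)"]) simp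
  qed
  then obtain VL where "\<And>s. Q s (fst (VL s)) (snd (VL s))" by metis
  moreover define V L where "V s = fst (VL s)" and "L s = snd (VL s)" for s
  ultimately have Q: "Q s (V s) (L s)" for s by simp
  have VL: "(\<Sum>i<R*K. cnj (V s i b) * V s i c) + (\<Sum>l<dB. cnj (L s l b) * L s l c) = (if b = c then 1 else 0)"
    if "b < dB" "c < dB" for s b c using Q that unfolding Q_def by blast
  have polar: "2 * Re (\<Sum>b<dB. Y s i b * cnj (V s i b)) \<ge> 3 * \<alpha> s i - \<beta> s i" if "i < R*K" for s i
    using Q that unfolding Q_def by blast
  have V0: "V s i b = 0" if "b < dB" "\<forall>j<R*K. Y s j b = 0" for s b i
    using Q that unfolding Q_def by blast
  define X where "X s k a = x s (k*dA+a) / complex_of_real (sqrt (real K * real P))" for s k a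
  \<comment> \<open>An outcome \<open>j < R\<close> is a guess of \<open>r\<close>, and the rows
    \<open>j * K + k\<close> of the polar factor map to output \<open>k\<close>. The remaining
    \<open>dB\<close> outcomes carry the rows of \<open>L\<close>, all sent to output 0; they only
    complete the measurement.\<close>
  define D where "D s j k b = (if j < R then cnj (V s (j*K+k) b) else if k = 0 then cnj (L s (j-R) b) else 0)" for s j k b
  have KP: "complex_of_real (sqrt (real K * real P)) * complex_of_real (sqrt (real K * real P)) = of_nat K * of_nat P"
    by (simp flip: of_real_mult of_nat_mult)
  show ?thesis
  proof (rule that[where P = P and X = X and J = "R+dB" and D = D])
    fix a a' assume a: "a < dA" "a' < dA"
    have "(\<Sum>s<P. \<Sum>k<K. cnj (X s k a) * X s k a') = (\<Sum>k<K. (\<Sum>s<P. x s (k*dA+a') * cnj (x s (k*dA+a))) / (of_nat K * of_nat P))"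
      by (subst sum.swap) (simp add: X_def KP sum_divide_distrib mult.commute)
    also have "\<dots> = (\<Sum>k<K. (if a = a' then 1 else 0) / of_nat K)"
      using a P by (intro sum.cong refl) (auto simp: two prod_index_less)
    also have "\<dots> = (if a = a' then 1 else 0)" using pos by simp
    finally show "(\<Sum>s<P. \<Sum>k<K. cnj (X s k a) * X s k a') = (if a = a' then 1 else 0)" .
  next
    fix s b b' assume b: "b < dB" "b' < dB"
    have "(\<Sum>j<R+dB. \<Sum>k<K. cnj (D s j k b) * D s j k b')
      = (\<Sum>i<R*K. cnj (V s i b') * V s i b) + (\<Sum>l<dB. cnj (L s l b') * L s l b)"
    proof -
      have "(\<Sum>k<K. cnj (D s (R+l) k b) * D s (R+l) k b') = (\<Sum>k<K. if k = 0 then L s l b * cnj (L s l b') else 0)" for l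
        by (intro sum.cong) (auto simp: D_def)
      then have "(\<Sum>k<K. cnj (D s (R+l) k b) * D s (R+l) k b') = cnj (L s l b') * L s l b" for l
        using pos by (simp add: mult.commute)
      then show ?thesis unfolding sum_add_index sum_prod_index by (simp add: D_def mult.commute)
    qed
    then show "(\<Sum>j<R+dB. \<Sum>k<K. cnj (D s j k b) * D s j k b') = (if b = b' then 1 else 0)"
      using VL[OF b(2,1), of s] by auto
  next
    \<comment> \<open>Up to the factor \<open>1 / sqrt K\<close>, the overlap with the maximally
      entangled vector after outcomes \<open>s\<close> and \<open>j\<close>, in the branch
      \<open>r\<close> of the purifying system.\<close>
    define amp where "amp s j r = (\<Sum>k<K. \<Sum>a<dA. \<Sum>b<dB. X s k a * D s j k b * \<phi> r a b)" for s j r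
    define t where "t s r = (\<Sum>k<K. Re (\<Sum>b<dB. Y s (r*K+k) b * cnj (V s (r*K+k) b)))" for s r
    have mass: "m \<le> 1"
    proof -
      have "m \<le> (\<Sum>r<R. \<Sum>a<dA. \<Sum>b<dB. (cmod (\<phi> r a b))\<^sup>2)"
        unfolding m_def mr_def using TR' TB'
        by (intro order.trans[OF sum_mono2[of "{..<R}" TR] sum_mono] sum_mono sum_mono2 sum_nonneg) auto
      also have "\<dots> = (\<Sum>r<R. \<mu> r)"
      proof (intro sum.cong refl)
        fix r assume "r \<in> {..<R}"
        then have "complex_of_real (\<Sum>a<dA. \<Sum>b<dB. (cmod (\<phi> r a b))\<^sup>2) = of_real (\<mu> r)"
          using orth[of r r] by (simp add: complex_norm_square del: of_real_power)
        then show "(\<Sum>a<dA. \<Sum>b<dB. (cmod (\<phi> r a b))\<^sup>2) = \<mu> r" by (simp only: of_real_eq_iff)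
      qed
      finally show ?thesis using \<mu>1 by simp
    qed
    have amp: "(cmod (amp s r r))\<^sup>2 / K \<ge> \<mu> r / P * ((\<Sum>k<K. 3 * \<alpha> s (r*K+k) - \<beta> s (r*K+k)) / K - 1)"
      if r: "r \<in> TR" for s r
    proof -
      from r TR' have r': "r < R" "\<mu> r > 0" by auto
      have inner: "(\<Sum>a<dA. x s (k*dA+a) * (cnj (V s (r*K+k) b) * \<phi> r a b)) = complex_of_real (sqrt (\<mu> r)) * (Y s (r*K+k) b * cnj (V s (r*K+k) b))"
        if k: "k < K" and b: "b < dB" for k b
      proof (cases "b \<in> TB")
        case True
        then show ?thesis using r r' k
          by (simp add: Y_def g_def sum_distrib_left sum_distrib_right mult_ac)
      next
        case False
        \<comment> \<open>Columns outside \<open>TB\<close> vanish in \<open>Y s\<close> and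
          therefore in its polar factor. The decoder thus filters the atypical \<open>b\<close> by
          itself, and the untruncated \<open>\<phi>\<close> may stand in for
          \<open>g\<close>.\<close>
        then have "V s (r*K+k) b = 0" using b by (intro V0) (auto simp: Y_def g_def)
        then show ?thesis by simp
      qed
      have "amp s r r = (\<Sum>k<K. \<Sum>b<dB. (\<Sum>a<dA. x s (k*dA+a) * (cnj (V s (r*K+k) b) * \<phi> r a b)) / complex_of_real (sqrt (real K * real P)))"
        unfolding amp_def using r'
        by (intro sum.cong[OF refl], subst sum.swap) (simp add: X_def D_def sum_divide_distrib mult_ac)
      also have "\<dots> = (\<Sum>k<K. \<Sum>b<dB. Y s (r*K+k) b * cnj (V s (r*K+k) b)) * complex_of_real (sqrt (\<mu> r) / sqrt (real K * real P))"
        by (simp add: inner) (simp add: sum_distrib_left sum_divide_distrib mult.commute)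
      finally have "cmod (amp s r r) = cmod (\<Sum>k<K. \<Sum>b<dB. Y s (r*K+k) b * cnj (V s (r*K+k) b)) * (sqrt (\<mu> r) / sqrt (real K * real P))"
        using r' by (simp only: norm_mult norm_of_real) simp
      moreover have "\<bar>t s r\<bar> \<le> cmod (\<Sum>k<K. \<Sum>b<dB. Y s (r*K+k) b * cnj (V s (r*K+k) b))"
        using abs_Re_le_cmod[of "\<Sum>k<K. \<Sum>b<dB. Y s (r*K+k) b * cnj (V s (r*K+k) b)"] unfolding t_def Re_sum .
      ultimately have "\<bar>t s r\<bar> * (sqrt (\<mu> r) / sqrt (real K * real P)) \<le> cmod (amp s r r)"
        using r' by (simp only:) (intro mult_right_mono, auto)
      then have "(\<bar>t s r\<bar> * (sqrt (\<mu> r) / sqrt (real K * real P)))\<^sup>2 \<le> (cmod (amp s r r))\<^sup>2"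
        using r' by (intro power_mono) auto
      then have "(t s r)\<^sup>2 * \<mu> r / (real K * real P) \<le> (cmod (amp s r r))\<^sup>2"
        using r' by (simp add: power_mult_distrib power_divide)
      then have 1: "(t s r)\<^sup>2 * \<mu> r / (real K * real P) / K \<le> (cmod (amp s r r))\<^sup>2 / K"
        by (intro divide_right_mono) auto
      have "(\<Sum>k<K. 3 * \<alpha> s (r*K+k) - \<beta> s (r*K+k)) \<le> (\<Sum>k<K. 2 * Re (\<Sum>b<dB. Y s (r*K+k) b * cnj (V s (r*K+k) b)))"
        using r' by (intro sum_mono polar) (auto intro: prod_index_less)
      also have "\<dots> = 2 * t s r" by (simp add: t_def sum_distrib_left)
      finally have "(\<Sum>k<K. 3 * \<alpha> s (r*K+k) - \<beta> s (r*K+k)) / K - 1 \<le> 2 * t s r / K - 1"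
        by (intro diff_right_mono divide_right_mono) auto
      \<comment> \<open>The square is linearized at 1, since only averages over \<open>s\<close> of
        quantities linear in \<open>t s r\<close> are accessible through the phase moments.\<close>
      also have "\<dots> \<le> (t s r / K)\<^sup>2"
        using zero_le_power2[of "t s r / K - 1"] by (simp add: power2_eq_square algebra_simps)
      finally have "\<mu> r / P * ((\<Sum>k<K. 3 * \<alpha> s (r*K+k) - \<beta> s (r*K+k)) / K - 1) \<le> \<mu> r / P * (t s r / K)\<^sup>2"
        using r' by (intro mult_left_mono) auto
      also have "\<dots> = (t s r)\<^sup>2 * \<mu> r / (real K * real P) / K" by (simp add: power2_eq_square mult_ac)
      also note 1
      finally show ?thesis .
    qed
    have \<alpha>: "(\<Sum>s<P. \<alpha> s (r*K+k)) = P * mr r / \<mu> r" if r: "r \<in> TR" and k: "k < K" for r k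
    proof -
      from r TR' have r': "r < R" "\<mu> r > 0" by auto
      have "complex_of_real (\<Sum>s<P. \<alpha> s (r*K+k))
          = (\<Sum>s<P. \<Sum>b<dB. \<Sum>a<dA. \<Sum>a'<dA. (g r a b * cnj (g r a' b)) * (x s (k*dA+a) * cnj (x s (k*dA+a'))))"
        using k by (simp add: \<alpha>_def complex_norm_square Y_def sum_product del: of_real_power) (simp add: mult_ac)
      also have "\<dots> = (\<Sum>b<dB. \<Sum>a<dA. \<Sum>a'<dA. (g r a b * cnj (g r a' b)) * (\<Sum>s<P. x s (k*dA+a) * cnj (x s (k*dA+a'))))"
        by (simp only: sum.swap[of _ _ "{..<P}"] sum_distrib_left)
      also have "\<dots> = (\<Sum>b<dB. \<Sum>a<dA. \<Sum>a'<dA. if a = a' then (g r a b * cnj (g r a' b)) * of_nat P else 0)"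
        using k by (intro sum.cong refl) (simp add: two prod_index_less)
      also have "\<dots> = (\<Sum>b<dB. \<Sum>a<dA. of_real (P * (cmod (g r a b))\<^sup>2))"
        by (simp add: complex_norm_square mult.commute del: of_real_power)
      finally have "(\<Sum>s<P. \<alpha> s (r*K+k)) = (\<Sum>b<dB. \<Sum>a<dA. P * (cmod (g r a b))\<^sup>2)"
        by (simp only: of_real_sum[symmetric] of_real_eq_iff)
      also have "\<dots> = (\<Sum>b\<in>TB. \<Sum>a<dA. P * (cmod (g r a b))\<^sup>2)"
        using TB' by (intro sum.mono_neutral_right) (auto simp: g_def)
      also have "\<dots> = (\<Sum>b\<in>TB. \<Sum>a<dA. P * (cmod (\<phi> r a b))\<^sup>2 / \<mu> r)"
        using r r' by (intro sum.cong refl) (simp add: g_def norm_divide power_divide)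
      also have "\<dots> = P * mr r / \<mu> r"
        unfolding mr_def by (subst sum.swap) (simp add: sum_distrib_left sum_divide_distrib)
      finally show ?thesis .
    qed
    \<comment> \<open>The two pairings of the fourth moment. \<open>H1\<close> occurs only for
      \<open>k' = k\<close>, while \<open>H2\<close> occurs for every \<open>k'\<close> and so picks
      up the factor \<open>K\<close>.\<close>
    define H1 where "H1 r r' = (cmod (\<Sum>a<dA. h r r' (a,a)))\<^sup>2" for r r'
    define H2 where "H2 r r' = (\<Sum>z\<in>{..<dA}\<times>{..<dA}. (cmod (h r r' z))\<^sup>2)" for r r'
    have \<beta>: "(\<Sum>s<P. \<beta> s (r*K+k)) \<le> P * (\<Sum>r'<R. K * H2 r r' + H1 r r')" if r: "r \<in> TR" and k: "k < K" for r k
    proof -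
      have YY: "(\<Sum>b<dB. Y s (r*K+k) b * cnj (Y s (r'*K+k') b))
          = (\<Sum>z\<in>{..<dA}\<times>{..<dA}. (x s (k*dA + fst z) * cnj (x s (k'*dA + snd z))) * h r r' z)" if "k' < K" for s r' k'
      proof -
        have "(\<Sum>b<dB. Y s (r*K+k) b * cnj (Y s (r'*K+k') b))
          = (\<Sum>b<dB. \<Sum>a<dA. \<Sum>a'<dA. (x s (k*dA + a) * cnj (x s (k'*dA + a'))) * (g r a b * cnj (g r' a' b)))"
          using k that by (simp add: Y_def sum_product) (simp add: mult_ac)
        also have "\<dots> = (\<Sum>a<dA. \<Sum>a'<dA. (x s (k*dA + a) * cnj (x s (k'*dA + a'))) * (\<Sum>b<dB. g r a b * cnj (g r' a' b)))"
          by (subst sum_rotate[symmetric]) (simp add: sum_distrib_left)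
        finally show ?thesis by (simp add: sum_Times h_def)
      qed
      have "(\<Sum>s<P. \<beta> s (r*K+k)) = (\<Sum>r'<R. \<Sum>k'<K. \<Sum>s<P. (cmod (\<Sum>z\<in>{..<dA}\<times>{..<dA}. (x s (k*dA + fst z) * cnj (x s (k'*dA + snd z))) * h r r' z))\<^sup>2)"
        unfolding \<beta>_def sum_prod_index by (subst sum_rotate) (simp add: YY)
      also have "\<dots> \<le> (\<Sum>r'<R. \<Sum>k'<K. P * (H2 r r' + (if k = k' then H1 r r' else 0)))"
        unfolding H1_def H2_def using k by (intro sum_mono phase_quadratic_bound[OF four]) auto
      also have "\<dots> = P * (\<Sum>r'<R. K * H2 r r' + H1 r r')"
        using k by (simp add: sum_distrib_left[symmetric] sum.distrib)
      finally show ?thesis .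
    qed
    have "2 * m - 1 - K * \<nu>0 / \<mu>0 \<le> (\<Sum>r\<in>TR. 3 * mr r - \<mu> r * (\<Sum>r'<R. K * H2 r r' + H1 r r') - \<mu> r)"
    proof -
      have "(\<Sum>r\<in>TR. \<mu> r * (\<Sum>r'<R. H2 r r')) \<le> \<nu>0 / \<mu>0 * m"
        unfolding H2_def h_def m_def mr_def
        by (rule one_shot_error_offdiag[OF orthB TR'(1,3) pos(1) TB'(1,2) pos(2) g_def]) auto
      also have "\<dots> \<le> \<nu>0 / \<mu>0 * 1" using mass pos by (intro mult_left_mono) auto
      finally have "K * (\<Sum>r\<in>TR. \<mu> r * (\<Sum>r'<R. H2 r r')) \<le> K * (\<nu>0 / \<mu>0 * 1)"
        by (intro mult_left_mono) auto
      moreover have "(\<Sum>r\<in>TR. \<mu> r * (\<Sum>r'<R. H1 r r')) \<le> m"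
        unfolding H1_def h_def m_def mr_def fst_conv snd_conv
        by (intro sum_mono one_shot_error_diag[OF orth TR'(1,2) TB'(1) _ g_def]) auto
      moreover have "(\<Sum>r\<in>TR. \<mu> r) \<le> 1"
        unfolding \<mu>1[symmetric] using TR' \<mu>nonneg by (intro sum_mono2) auto
      moreover have "(\<Sum>r\<in>TR. 3 * mr r - \<mu> r * (\<Sum>r'<R. K * H2 r r' + H1 r r') - \<mu> r)
        = 3 * m - K * (\<Sum>r\<in>TR. \<mu> r * (\<Sum>r'<R. H2 r r')) - (\<Sum>r\<in>TR. \<mu> r * (\<Sum>r'<R. H1 r r')) - (\<Sum>r\<in>TR. \<mu> r)"
        by (simp add: m_def sum_subtractf sum.distrib sum_distrib_left distrib_left) (simp add: mult_ac)
      ultimately show ?thesis by simp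
    qed
    also have "\<dots> \<le> (\<Sum>r\<in>TR. \<Sum>s<P. \<mu> r / P * ((\<Sum>k<K. 3 * \<alpha> s (r*K+k) - \<beta> s (r*K+k)) / K - 1))"
    proof (intro sum_mono)
      fix r assume r: "r \<in> TR"
      then have \<mu>: "\<mu> r > 0" using TR' by auto
      have "(\<Sum>s<P. \<mu> r / P * ((\<Sum>k<K. 3 * \<alpha> s (r*K+k) - \<beta> s (r*K+k)) / K - 1))
        = \<mu> r / P * ((\<Sum>s<P. \<Sum>k<K. 3 * \<alpha> s (r*K+k) - \<beta> s (r*K+k)) / K - P)"
        by (simp add: sum_distrib_left[symmetric] sum_subtractf sum_divide_distrib[symmetric])
      also have "(\<Sum>s<P. \<Sum>k<K. 3 * \<alpha> s (r*K+k) - \<beta> s (r*K+k)) = (\<Sum>k<K. 3 * (\<Sum>s<P. \<alpha> s (r*K+k)) - (\<Sum>s<P. \<beta> s (r*K+k)))"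
        by (subst sum.swap) (simp add: sum_subtractf sum_distrib_left)
      finally have eq: "(\<Sum>s<P. \<mu> r / P * ((\<Sum>k<K. 3 * \<alpha> s (r*K+k) - \<beta> s (r*K+k)) / K - 1))
        = \<mu> r / P * ((\<Sum>k<K. 3 * (\<Sum>s<P. \<alpha> s (r*K+k)) - (\<Sum>s<P. \<beta> s (r*K+k))) / K - P)" .
      have "(\<Sum>k<K. 3 * (P * mr r / \<mu> r) - P * (\<Sum>r'<R. K * H2 r r' + H1 r r'))
          \<le> (\<Sum>k<K. 3 * (\<Sum>s<P. \<alpha> s (r*K+k)) - (\<Sum>s<P. \<beta> s (r*K+k)))"
        using \<alpha>[OF r] \<beta>[OF r] by (intro sum_mono diff_mono) auto
      then have "\<mu> r / P * ((\<Sum>k<K. 3 * (P * mr r / \<mu> r) - P * (\<Sum>r'<R. K * H2 r r' + H1 r r')) / K - P)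
          \<le> \<mu> r / P * ((\<Sum>k<K. 3 * (\<Sum>s<P. \<alpha> s (r*K+k)) - (\<Sum>s<P. \<beta> s (r*K+k))) / K - P)"
        using \<mu> by (intro mult_left_mono diff_right_mono divide_right_mono) auto
      moreover have "\<mu> r / P * ((\<Sum>k<K. 3 * (P * mr r / \<mu> r) - P * (\<Sum>r'<R. K * H2 r r' + H1 r r')) / K - P)
          = 3 * mr r - \<mu> r * (\<Sum>r'<R. K * H2 r r' + H1 r r') - \<mu> r"
        using \<mu> P pos by (simp add: field_simps)
      ultimately show "3 * mr r - \<mu> r * (\<Sum>r'<R. K * H2 r r' + H1 r r') - \<mu> r
          \<le> (\<Sum>s<P. \<mu> r / P * ((\<Sum>k<K. 3 * \<alpha> s (r*K+k) - \<beta> s (r*K+k)) / K - 1))"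
        unfolding eq by simp
    qed
    also have "\<dots> \<le> (\<Sum>r\<in>TR. \<Sum>s<P. (cmod (amp s r r))\<^sup>2 / K)"
      by (intro sum_mono amp)
    also have "\<dots> = (\<Sum>s<P. \<Sum>r\<in>TR. (cmod (amp s r r))\<^sup>2 / K)" by (rule sum.swap)
    \<comment> \<open>So far only correct guesses \<open>j = r\<close> of a typical \<open>r\<close>
      were counted; all other outcomes contribute nonnegative terms.\<close>
    also have "\<dots> \<le> (\<Sum>s<P. \<Sum>j<R+dB. \<Sum>r<R. (cmod (amp s j r))\<^sup>2 / K)"
    proof (rule sum_mono)
      fix s
      have "(\<Sum>r\<in>TR. (cmod (amp s r r))\<^sup>2 / K) \<le> (\<Sum>j\<in>TR. \<Sum>r<R. (cmod (amp s j r))\<^sup>2 / K)"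
      proof (rule sum_mono)
        fix j assume "j \<in> TR"
        then show "(cmod (amp s j j))\<^sup>2 / K \<le> (\<Sum>r<R. (cmod (amp s j r))\<^sup>2 / K)"
          using TR' member_le_sum[of j "{..<R}" "\<lambda>r. (cmod (amp s j r))\<^sup>2 / K"] by auto
      qed
      also have "\<dots> \<le> (\<Sum>j<R+dB. \<Sum>r<R. (cmod (amp s j r))\<^sup>2 / K)"
        using TR' by (intro sum_mono2) (auto intro!: sum_nonneg)
      finally show "(\<Sum>r\<in>TR. (cmod (amp s r r))\<^sup>2 / K) \<le> (\<Sum>j<R+dB. \<Sum>r<R. (cmod (amp s j r))\<^sup>2 / K)" .
    qed
    finally show "2 * (\<Sum>r\<in>TR. \<Sum>a<dA. \<Sum>b\<in>TB. (cmod (\<phi> r a b))\<^sup>2) - 1 - K * \<nu>0 / \<mu>0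
      \<le> (\<Sum>s<P. \<Sum>j<R+dB. \<Sum>r<R. (cmod (\<Sum>k<K. \<Sum>a<dA. \<Sum>b<dB. X s k a * D s j k b * \<phi> r a b))\<^sup>2 / K)"
      by (simp add: m_def mr_def amp_def)
  qed
qed

subsection \<open>Maximally entangled output of a one-way protocol\<close>

lemma form_unitary_conj:
  assumes U: "unitary_mat n U" and A: "A = U * real_diag n d * adj U"
  shows "(\<Sum>i<n. \<Sum>j<n. cnj (z i) * A $$ (i,j) * z j) = of_real (\<Sum>l<n. d l * (cmod (\<Sum>j<n. cnj (U $$ (j,l)) * z j))\<^sup>2)"
proof -
  have "(\<Sum>i<n. \<Sum>j<n. cnj (z i) * A $$ (i,j) * z j)
      = (\<Sum>i<n. \<Sum>j<n. \<Sum>l<n. of_real (d l) * ((cnj (z i) * U $$ (i,l)) * (cnj (U $$ (j,l)) * z j)))"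
    unfolding A by (intro sum.cong refl) (auto simp: index_unitary_conj[OF U] sum_distrib_left sum_distrib_right mult_ac)
  also have "\<dots> = (\<Sum>l<n. \<Sum>i<n. \<Sum>j<n. of_real (d l) * ((cnj (z i) * U $$ (i,l)) * (cnj (U $$ (j,l)) * z j)))"
    by (rule sum_rotate)
  also have "\<dots> = (\<Sum>l<n. of_real (d l) * ((\<Sum>i<n. cnj (z i) * U $$ (i,l)) * (\<Sum>j<n. cnj (U $$ (j,l)) * z j)))"
    by (rule sum.cong[OF refl], subst sum_product, simp add: sum_distrib_left)
  also have "\<dots> = (\<Sum>l<n. of_real (d l) * of_real ((cmod (\<Sum>j<n. cnj (U $$ (j,l)) * z j))\<^sup>2))"
  proof (intro sum.cong refl)
    fix l
    have "(\<Sum>i<n. cnj (z i) * U $$ (i,l)) = cnj (\<Sum>j<n. cnj (U $$ (j,l)) * z j)" by (simp add: mult.commute)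
    then show "of_real (d l) * ((\<Sum>i<n. cnj (z i) * U $$ (i,l)) * (\<Sum>j<n. cnj (U $$ (j,l)) * z j))
        = of_real (d l) * of_real ((cmod (\<Sum>j<n. cnj (U $$ (j,l)) * z j))\<^sup>2)"
      by (simp only: complex_norm_square mult_ac)
  qed
  finally show ?thesis by simp
qed

lemma frobenius_unitary_conj:
  assumes U: "unitary_mat n U" and A: "A = U * real_diag n d * adj U"
  shows "(\<Sum>i<n. \<Sum>j<n. (cmod (A $$ (i,j)))\<^sup>2) = (\<Sum>l<n. (d l)\<^sup>2)"
    and "adj A * A = U * real_diag n (\<lambda>l. d l * d l) * adj U"
proof -
  note u = unitary_matD[OF U]
  have adjD: "adj (real_diag n d) = real_diag n d" by (rule eq_matI) (auto simp: real_diag_def)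
  have "adj A = U * (real_diag n d * adj U)"
    unfolding A using u(1) by (simp add: adj_mult[of _ n n _ n] adjD)
  then have herm: "adj A = A" unfolding A using u(1) by (simp add: mult_mat_assoc)
  have "A * A = U * real_diag n d * ((adj U * U) * (real_diag n d * adj U))"
    using u(1) unfolding A by (simp add: mult_mat_assoc)
  also have "\<dots> = U * (real_diag n d * real_diag n d) * adj U"
    using u by (simp add: mult_mat_assoc left_mult_one_mat[of _ n n])
  finally have AA: "A * A = U * real_diag n (\<lambda>l. d l * d l) * adj U" by (simp add: real_diag_mult)
  then show "adj A * A = U * real_diag n (\<lambda>l. d l * d l) * adj U" by (simp add: herm)
  have dimA: "dim_row A = n" "dim_col A = n" unfolding A using u(1) by auto
  have "complex_of_real (\<Sum>i<n. \<Sum>j<n. (cmod (A $$ (i,j)))\<^sup>2) = (\<Sum>i<n. (A * adj A) $$ (i,i))"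
    unfolding of_real_sum using dimA
    by (intro sum.cong[OF refl], subst index_mult_adj) (auto simp: complex_norm_square simp del: of_real_power)
  also have "\<dots> = of_real (\<Sum>l<n. d l * d l)" unfolding herm by (rule trace_unitary_conj[OF U AA])
  finally show "(\<Sum>i<n. \<Sum>j<n. (cmod (A $$ (i,j)))\<^sup>2) = (\<Sum>l<n. (d l)\<^sup>2)"
    by (simp only: of_real_eq_iff power2_eq_square)
qed

text \<open>Subtracting a rank-one projection from a positive operator creates at most one negative
  eigenvalue, so a traceless difference has trace norm at most twice its Hilbert--Schmidt norm.\<close>

lemma trace_norm_diff_pure:
  assumes \<omega>: "density_op n \<omega>" and v: "v \<in> carrier_vec n" "unit_vector v"
  defines "F \<equiv> Re (\<Sum>i<n. \<Sum>j<n. cnj (v $ i) * \<omega> $$ (i,j) * v $ j)"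
  shows "trace_norm (\<omega> - proj v) \<le> 2 * sqrt (2 * (1 - F))"
proof -
  have \<omega>': "\<omega> \<in> carrier_mat n n" "psd \<omega>" "mtrace \<omega> = 1" using \<omega> by (auto simp: density_op_def)
  have v1: "(\<Sum>i<n. (cmod (v $ i))\<^sup>2) = 1" using v by (auto simp: unit_vector_def)
  define A where "A = \<omega> - proj v"
  have A: "A \<in> carrier_mat n n" using \<omega>' v by (auto simp: A_def proj_def)
  have Aij: "A $$ (i,j) = \<omega> $$ (i,j) - v $ i * cnj (v $ j)" if "i < n" "j < n" for i j
    using that \<omega>' v by (auto simp: A_def proj_def)
  have "adj \<omega> = \<omega>" using \<omega>'(2) by (simp add: psd_def)
  then have herm\<omega>: "cnj (\<omega> $$ (j,i)) = \<omega> $$ (i,j)" if "i < n" "j < n" for i j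
    using that \<omega>'(1) by (metis carrier_matD index_adj)
  have "adj A = A" using A by (intro eq_matI) (auto simp: Aij herm\<omega>)
  from hermitian_diagonalization[OF A this] obtain U d
    where U: "unitary_mat n U" and Ad: "A = U * real_diag n d * adj U" by blast
  define N where "N = {i. i < n \<and> d i < 0}"
  have N: "N \<subseteq> {..<n}" "finite N" by (auto simp: N_def)
  \<comment> \<open>On the orthogonal complement of \<open>v\<close> the form of \<open>A\<close>
    agrees with that of \<open>\<omega>\<close>.\<close>
  have form: "(\<Sum>l<n. d l * (cmod (\<Sum>j<n. cnj (U $$ (j,l)) * z j))\<^sup>2) \<ge> 0"
    if z: "(\<Sum>j<n. cnj (v $ j) * z j) = 0" for z
  proof -
    have "complex_of_real (\<Sum>l<n. d l * (cmod (\<Sum>j<n. cnj (U $$ (j,l)) * z j))\<^sup>2)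
        = (\<Sum>i<n. \<Sum>j<n. cnj (z i) * A $$ (i,j) * z j)"
      by (rule form_unitary_conj[OF U Ad, symmetric])
    also have "\<dots> = (\<Sum>i<n. \<Sum>j<n. cnj (z i) * \<omega> $$ (i,j) * z j) - (\<Sum>i<n. cnj (z i) * v $ i * (\<Sum>j<n. cnj (v $ j) * z j))"
      by (simp add: Aij sum_subtractf[symmetric] sum_distrib_left algebra_simps)
    also have "\<dots> = (\<Sum>i<n. \<Sum>j<n. cnj (z i) * \<omega> $$ (i,j) * z j)" by (simp add: z)
    finally have c: "complex_of_real (\<Sum>l<n. d l * (cmod (\<Sum>j<n. cnj (U $$ (j,l)) * z j))\<^sup>2)
        = (\<Sum>i<n. \<Sum>j<n. cnj (z i) * \<omega> $$ (i,j) * z j)" .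
    have "0 \<le> Re (\<Sum>i<n. \<Sum>j<n. cnj (z i) * \<omega> $$ (i,j) * z j)"
      using \<omega>'(2) unfolding psd_iff_form[OF \<omega>'(1)] by blast
    then show ?thesis unfolding c[symmetric] Re_complex_of_real .
  qed
  define \<alpha> where "\<alpha> l = (\<Sum>j<n. cnj (v $ j) * U $$ (j,l))" for l
  have comb: "(\<Sum>l<n. d l * (cmod (\<Sum>j<n. cnj (U $$ (j,l)) * (p * U $$ (j,a) - q * U $$ (j,b))))\<^sup>2)
      = d a * (cmod p)\<^sup>2 + d b * (cmod q)\<^sup>2" if ab: "a < n" "b < n" "a \<noteq> b" for a b p q
  proof -
    have "(\<Sum>j<n. cnj (U $$ (j,l)) * (p * U $$ (j,a) - q * U $$ (j,b))) = p * (if l = a then 1 else 0) - q * (if l = b then 1 else 0)"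
      if "l < n" for l
      unfolding unitary_cols_orthonormal[OF U that ab(1), symmetric] unitary_cols_orthonormal[OF U that ab(2), symmetric]
      by (simp add: sum_distrib_left sum_subtractf[symmetric] algebra_simps)
    then have "(\<Sum>l<n. d l * (cmod (\<Sum>j<n. cnj (U $$ (j,l)) * (p * U $$ (j,a) - q * U $$ (j,b))))\<^sup>2)
      = (\<Sum>l<n. (if l = a then d a * (cmod p)\<^sup>2 else 0) + (if l = b then d b * (cmod q)\<^sup>2 else 0))"
      using ab by (intro sum.cong) auto
    then show ?thesis using ab by (simp add: sum.distrib)
  qed
  have one: "a = b" if ab: "a \<in> N" "b \<in> N" for a b
  proof (rule ccontr)
    assume "a \<noteq> b"
    have l: "a < n" "b < n" "d a < 0" "d b < 0" using ab by (auto simp: N_def)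
    have lin: "(\<Sum>j<n. cnj (v $ j) * (p * U $$ (j,a) - q * U $$ (j,b))) = p * \<alpha> a - q * \<alpha> b" for p q
      by (simp add: \<alpha>_def sum_distrib_left sum_subtractf[symmetric] algebra_simps)
    have ineq: "p * \<alpha> a - q * \<alpha> b = 0 \<Longrightarrow> d a * (cmod p)\<^sup>2 + d b * (cmod q)\<^sup>2 \<ge> 0" for p q
      using form[of "\<lambda>j. p * U $$ (j,a) - q * U $$ (j,b)"] comb[OF l(1,2) \<open>a \<noteq> b\<close>, of p q] lin[of p q] by simp
    \<comment> \<open>If \<open>\<alpha> a = 0\<close>, the eigenvector for \<open>a\<close> is
      itself orthogonal to \<open>v\<close>. Otherwise the coefficients \<open>\<alpha> b\<close>
      and \<open>\<alpha> a\<close> produce a nonzero combination orthogonal to \<open>v\<close>. In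
      both cases two negative eigenvalues would contradict \<open>form\<close>.\<close>
    have "\<alpha> a \<noteq> 0" using ineq[of 1 0] l by auto
    then have "d b * (cmod (\<alpha> a))\<^sup>2 < 0" using l by (simp add: mult_neg_pos)
    moreover have "d a * (cmod (\<alpha> b))\<^sup>2 \<le> 0" using l by (simp add: mult_nonpos_nonneg)
    ultimately show False using ineq[of "\<alpha> b" "\<alpha> a"] by simp
  qed
  have sum0: "(\<Sum>l<n. d l) = 0"
  proof -
    have "complex_of_real (\<Sum>l<n. d l) = (\<Sum>i<n. A $$ (i,i))" by (rule trace_unitary_conj[OF U Ad, symmetric])
    also have "\<dots> = (\<Sum>i<n. \<omega> $$ (i,i)) - (\<Sum>i<n. of_real ((cmod (v $ i))\<^sup>2))"
      by (simp add: Aij sum_subtractf complex_norm_square del: of_real_power)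
    also have "\<dots> = 0" using \<omega>' v1 by (simp add: mtrace_def del: of_real_power flip: of_real_sum)
    finally show ?thesis by (simp only: of_real_eq_0_iff)
  qed
  have "trace_norm (\<omega> - proj v) = (\<Sum>l<n. \<bar>d l\<bar>)"
    unfolding trace_norm_def A_def[symmetric] sum_eigvals_unitary_conj[OF U frobenius_unitary_conj(2)[OF U Ad]] by simp
  also have "\<dots> = (\<Sum>l<n. d l) + (\<Sum>l<n. if l \<in> N then - 2 * d l else 0)"
    unfolding sum.distrib[symmetric] by (intro sum.cong refl) (auto simp: N_def)
  also have "\<dots> = 2 * (\<Sum>l\<in>N. - d l)"
    using N sum0 by (simp add: sum.inter_restrict[symmetric] Int_absorb1 sum_distrib_left sum_negf)
  also have "(\<Sum>l\<in>N. - d l) \<le> sqrt (\<Sum>l<n. (d l)\<^sup>2)"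
  proof (cases "N = {}")
    case True
    then show ?thesis by (simp add: sum_nonneg)
  next
    case False
    then obtain a where a: "a \<in> N" by blast
    then have Na: "N = {a}" using one by blast
    then have "a < n" using N by auto
    then have "(d a)\<^sup>2 \<le> (\<Sum>l<n. (d l)\<^sup>2)" using member_le_sum[of a "{..<n}" "\<lambda>l. (d l)\<^sup>2"] by auto
    then have "\<bar>d a\<bar> \<le> sqrt (\<Sum>l<n. (d l)\<^sup>2)" by (metis real_sqrt_abs real_sqrt_le_iff)
    then show ?thesis using Na by simp
  qed
  \<comment> \<open>The squared Hilbert-Schmidt norm of the difference is the purity of
    \<open>\<omega>\<close> plus \<open>1 - 2 * F\<close>, and a purity is at most 1.\<close>
  also have "(\<Sum>l<n. (d l)\<^sup>2) \<le> 2 * (1 - F)"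
  proof -
    obtain W e where W: "unitary_mat n W" and we: "\<omega> = W * real_diag n e * adj W" and e: "\<And>i. i < n \<Longrightarrow> e i \<ge> 0"
      using psd_diagonalization[OF \<omega>'(1,2)] by metis
    have "of_real (\<Sum>i<n. e i) = complex_of_real 1"
      using trace_unitary_conj[OF W we] \<omega>' by (simp add: mtrace_def)
    then have se: "(\<Sum>i<n. e i) = 1" by (simp only: of_real_eq_iff)
    have purity: "(\<Sum>i<n. \<Sum>j<n. (cmod (\<omega> $$ (i,j)))\<^sup>2) \<le> 1"
    proof -
      have "e l \<le> 1" if "l < n" for l using member_le_sum[of l "{..<n}" e] e that se by auto
      then have "(\<Sum>l<n. (e l)\<^sup>2) \<le> (\<Sum>l<n. e l * 1)"
        using e unfolding power2_eq_square by (intro sum_mono mult_left_mono) auto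
      then show ?thesis unfolding frobenius_unitary_conj(1)[OF W we] using se by simp
    qed
    have "complex_of_real (\<Sum>i<n. \<Sum>j<n. (cmod (A $$ (i,j)))\<^sup>2)
        = (\<Sum>i<n. \<Sum>j<n. (\<omega> $$ (i,j) - v $ i * cnj (v $ j)) * cnj (\<omega> $$ (i,j) - v $ i * cnj (v $ j)))"
      by (simp add: Aij complex_norm_square del: of_real_power)
    also have "\<dots> = (\<Sum>i<n. \<Sum>j<n. \<omega> $$ (i,j) * cnj (\<omega> $$ (i,j)) + (v $ i * cnj (v $ i)) * (v $ j * cnj (v $ j))
        - (cnj (v $ i) * \<omega> $$ (i,j) * v $ j + cnj (cnj (v $ i) * \<omega> $$ (i,j) * v $ j)))"
      by (intro sum.cong refl) (simp add: algebra_simps)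
    also have "\<dots> = (\<Sum>i<n. \<Sum>j<n. \<omega> $$ (i,j) * cnj (\<omega> $$ (i,j))) + (\<Sum>i<n. v $ i * cnj (v $ i)) * (\<Sum>j<n. v $ j * cnj (v $ j))
        - ((\<Sum>i<n. \<Sum>j<n. cnj (v $ i) * \<omega> $$ (i,j) * v $ j) + cnj (\<Sum>i<n. \<Sum>j<n. cnj (v $ i) * \<omega> $$ (i,j) * v $ j))"
      by (simp only: sum.distrib sum_subtractf sum_product cnj_sum)
    also have "(\<Sum>i<n. v $ i * cnj (v $ i)) = 1"
      using v1 by (simp add: complex_norm_square[symmetric] del: of_real_power flip: of_real_sum)
    also have "(\<Sum>i<n. \<Sum>j<n. cnj (v $ i) * \<omega> $$ (i,j) * v $ j) + cnj (\<Sum>i<n. \<Sum>j<n. cnj (v $ i) * \<omega> $$ (i,j) * v $ j) = of_real (2 * F)"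
      unfolding F_def complex_add_cnj by simp
    also have "(\<Sum>i<n. \<Sum>j<n. \<omega> $$ (i,j) * cnj (\<omega> $$ (i,j))) + 1 * 1 - of_real (2 * F)
        = complex_of_real ((\<Sum>i<n. \<Sum>j<n. (cmod (\<omega> $$ (i,j)))\<^sup>2) + 1 - 2 * F)"
      by (simp add: complex_norm_square del: of_real_power)
    finally have "(\<Sum>i<n. \<Sum>j<n. (cmod (A $$ (i,j)))\<^sup>2) = (\<Sum>i<n. \<Sum>j<n. (cmod (\<omega> $$ (i,j)))\<^sup>2) + 1 - 2 * F"
      by (simp only: of_real_eq_iff)
    then show ?thesis using purity unfolding frobenius_unitary_conj(1)[OF U Ad] by simp
  qed
  finally show ?thesis by (simp add: mult_left_mono)
qed

section \<open>The maximally entangled state\<close>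

definition max_entangled :: "nat \<Rightarrow> complex vec" where
  "max_entangled K = vec (K*K) (\<lambda>i. if i div K = i mod K then complex_of_real (1 / sqrt K) else 0)"

lemma max_entangled_carrier [simp]: "max_entangled K \<in> carrier_vec (K*K)"
  by (simp add: max_entangled_def)

lemma index_max_entangled:
  "k < K \<Longrightarrow> k' < K \<Longrightarrow> max_entangled K $ (k*K+k') = (if k = k' then complex_of_real (1 / sqrt K) else 0)"
  by (simp add: max_entangled_def prod_index_less)

lemma max_entangled_unit: "K > 0 \<Longrightarrow> unit_vector (max_entangled K)"
  by (simp add: unit_vector_def carrier_vecD[OF max_entangled_carrier] sum_prod_index index_max_entangled
      if_distrib[of cmod] if_distrib[of "\<lambda>x. x\<^sup>2"] norm_divide power_divide cong: if_cong)

lemma max_entangled_entropy: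
  assumes K: "K > 0"
  shows "vN_entropy (ptrace_B K K (proj (max_entangled K))) = log 2 K"
proof -
  have KK: "complex_of_real (sqrt K) * complex_of_real (sqrt K) = of_nat K"
    by (simp flip: of_real_mult)
  have "ptrace_B K K (proj (max_entangled K)) = real_diag K (\<lambda>_. 1 / K)"
  proof (rule eq_matI)
    fix a a' assume "a < dim_row (real_diag K (\<lambda>_. 1 / K))" "a' < dim_col (real_diag K (\<lambda>_. 1 / K))"
    then have a: "a < K" "a' < K" by auto
    have "ptrace_B K K (proj (max_entangled K)) $$ (a,a') = (\<Sum>b<K. if b = a then (if a = a' then of_real (1 / K) else 0) else 0)"
      unfolding index_ptrace_B[OF a] using a
      by (intro sum.cong refl)
        (auto simp: proj_def carrier_vecD[OF max_entangled_carrier] prod_index_less index_max_entangled KK)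
    then show "ptrace_B K K (proj (max_entangled K)) $$ (a,a') = real_diag K (\<lambda>_. 1 / K) $$ (a,a')"
      using a by (simp add: real_diag_def)
  qed (auto simp: ptrace_B_def)
  also have "\<dots> = 1\<^sub>m K * real_diag K (\<lambda>_. 1 / K) * adj (1\<^sub>m K)"
    by (simp add: right_mult_one_mat[OF real_diag_carrier(1)] left_mult_one_mat[OF real_diag_carrier(1)])
  finally have "vN_entropy (ptrace_B K K (proj (max_entangled K))) = - (\<Sum>i<K. xlogx (1 / K))"
    by (rule vN_entropy_unitary_conj[OF unitary_mat_one])
  also have "\<dots> = log 2 K" using K by (simp add: xlogx_def log_divide)
  finally show ?thesis .
qed

section \<open>Kraus sums and the one-way protocols as LOCC instruments\<close>

lemma apply_kraus_carrier_index:
  assumes "\<forall>K\<in>set Ks. K \<in> carrier_mat d' d" "\<rho> \<in> carrier_mat d d"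
  shows "apply_kraus d' Ks \<rho> \<in> carrier_mat d' d' \<and>
    (\<forall>i<d'. \<forall>j<d'. apply_kraus d' Ks \<rho> $$ (i,j) = (\<Sum>K\<leftarrow>Ks. (K * \<rho> * adj K) $$ (i,j)))"
  using assms(1)
proof (induction Ks)
  case (Cons K Ks)
  have "apply_kraus d' (K # Ks) \<rho> = K * \<rho> * adj K + apply_kraus d' Ks \<rho>" by (simp add: apply_kraus_def)
  moreover have "K * \<rho> * adj K \<in> carrier_mat d' d'" using Cons.prems assms(2) by auto
  ultimately show ?case using Cons by (auto simp del: index_mult_mat(1))
qed (simp add: apply_kraus_def)

lemma kraus_sum_carrier_index:
  assumes "\<forall>K\<in>set Ks. K \<in> carrier_mat d' d"
  shows "kraus_sum d Ks \<in> carrier_mat d d \<and>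
    (\<forall>i<d. \<forall>j<d. kraus_sum d Ks $$ (i,j) = (\<Sum>K\<leftarrow>Ks. (adj K * K) $$ (i,j)))"
  using assms
proof (induction Ks)
  case (Cons K Ks)
  have "kraus_sum d (K # Ks) = adj K * K + kraus_sum d Ks" by (simp add: kraus_sum_def)
  moreover have "adj K * K \<in> carrier_mat d d" using Cons.prems by auto
  ultimately show ?case using Cons by (auto simp del: index_mult_mat(1))
qed (simp add: kraus_sum_def)

lemma kraus_sum_eq_one:
  assumes "\<And>a a'. a < d \<Longrightarrow> a' < d \<Longrightarrow> (\<Sum>s<P. \<Sum>k<K. cnj (X s k a) * X s k a') = (if a = a' then 1 else 0)"
  shows "kraus_sum d (map (\<lambda>s. mat K d (\<lambda>(k,a). X s k a)) [0..<P]) = 1\<^sub>m d"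
proof -
  let ?Ks = "map (\<lambda>s. mat K d (\<lambda>(k,a). X s k a)) [0..<P]"
  have c: "\<forall>M\<in>set ?Ks. M \<in> carrier_mat K d" by auto
  show ?thesis
  proof (rule eq_matI)
    fix i j assume "i < dim_row (1\<^sub>m d :: complex mat)" "j < dim_col (1\<^sub>m d :: complex mat)"
    then have ij: "i < d" "j < d" by auto
    have "kraus_sum d ?Ks $$ (i,j) = (\<Sum>s<P. (adj (mat K d (\<lambda>(k,a). X s k a)) * mat K d (\<lambda>(k,a). X s k a)) $$ (i,j))"
      using kraus_sum_carrier_index[OF c] ij by (simp add: o_def interv_sum_list_conv_sum_set_nat atLeast0LessThan del: index_mult_mat(1))
    also have "\<dots> = (\<Sum>s<P. \<Sum>k<K. cnj (X s k i) * X s k j)"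
      using ij by (intro sum.cong[OF refl], subst index_adj_mult) auto
    finally show "kraus_sum d ?Ks $$ (i,j) = 1\<^sub>m d $$ (i,j)" using assms ij by simp
  qed (use kraus_sum_carrier_index[OF c] in auto)
qed

lemma isometry_sum:
  fixes M :: "'i \<Rightarrow> nat \<Rightarrow> complex"
  assumes "\<And>b b'. b < d \<Longrightarrow> b' < d \<Longrightarrow> (\<Sum>i\<in>I. cnj (M i b) * M i b') = (if b = b' then 1 else 0)"
  shows "(\<Sum>i\<in>I. (cmod (\<Sum>b<d. M i b * y b))\<^sup>2) = (\<Sum>b<d. (cmod (y b))\<^sup>2)"
proof -
  have "complex_of_real (\<Sum>i\<in>I. (cmod (\<Sum>b<d. M i b * y b))\<^sup>2)
      = (\<Sum>i\<in>I. \<Sum>b<d. \<Sum>c<d. (y b * cnj (y c)) * (cnj (M i c) * M i b))"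
    by (simp add: complex_norm_square sum_product del: of_real_power) (simp add: mult_ac)
  also have "\<dots> = (\<Sum>b<d. \<Sum>c<d. (y b * cnj (y c)) * (\<Sum>i\<in>I. cnj (M i c) * M i b))"
    by (subst sum_rotate[symmetric]) (simp add: sum_distrib_left)
  also have "\<dots> = (\<Sum>b<d. \<Sum>c<d. if c = b then y b * cnj (y c) else 0)"
    by (intro sum.cong refl) (simp add: assms)
  also have "\<dots> = of_real (\<Sum>b<d. (cmod (y b))\<^sup>2)"
    by (simp add: complex_norm_square del: of_real_power)
  finally show ?thesis by (simp only: of_real_eq_iff)
qed

text \<open>Both operator families carry both outcome indices, so that one computation serves either
  order of the two parties. The hypothesis \<open>iso\<close> expresses trace preservation on
  vectors, applied to each \<open>f r\<close>.\<close>

lemma kron_kraus_output: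
  fixes \<alpha> \<beta> :: "nat \<Rightarrow> nat \<Rightarrow> nat \<Rightarrow> nat \<Rightarrow> complex" and f :: "nat \<Rightarrow> nat \<Rightarrow> complex"
  assumes \<rho>: "\<rho> \<in> carrier_mat (dA*dB) (dA*dB)"
      "\<And>i j. i < dA*dB \<Longrightarrow> j < dA*dB \<Longrightarrow> \<rho> $$ (i,j) = (\<Sum>r<R. f r i * cnj (f r j))"
    and tr: "(\<Sum>r<R. \<Sum>i<dA*dB. (cmod (f r i))\<^sup>2) = 1"
    and iso: "\<And>y. (\<Sum>s<P. \<Sum>j<J. \<Sum>k<K. \<Sum>k'<K. (cmod (\<Sum>a<dA. \<Sum>b<dB. \<alpha> s j k a * \<beta> s j k' b * y a b))\<^sup>2)
        = (\<Sum>a<dA. \<Sum>b<dB. (cmod (y a b))\<^sup>2)"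
    and K: "K > 0"
  defines "\<omega> \<equiv> apply_kraus (K*K) (concat (map (\<lambda>s. map (\<lambda>j. kron (mat K dA (\<lambda>(k,a). \<alpha> s j k a)) (mat K dB (\<lambda>(k,b). \<beta> s j k b))) [0..<J]) [0..<P])) \<rho>"
  shows "bstate K K \<omega>"
    and "Re (\<Sum>i<K*K. \<Sum>j<K*K. cnj (max_entangled K $ i) * \<omega> $$ (i,j) * max_entangled K $ j)
      = (\<Sum>s<P. \<Sum>j<J. \<Sum>r<R. (cmod (\<Sum>k<K. \<Sum>a<dA. \<Sum>b<dB. \<alpha> s j k a * \<beta> s j k b * f r (a*dB+b)))\<^sup>2 / K)"
proof -
  define M where "M s j = kron (mat K dA (\<lambda>(k,a). \<alpha> s j k a)) (mat K dB (\<lambda>(k,b). \<beta> s j k b))" for s j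
  have M: "M s j \<in> carrier_mat (K*K) (dA*dB)" for s j by (simp add: M_def)
  define w where "w s j r i = (\<Sum>l<dA*dB. M s j $$ (i,l) * f r l)" for s j r i
  have w: "w s j r (k*K+k') = (\<Sum>a<dA. \<Sum>b<dB. \<alpha> s j k a * \<beta> s j k' b * f r (a*dB+b))" if "k < K" "k' < K" for s j r k k'
    unfolding w_def sum_prod_index M_def using that
    by (intro sum.cong refl) (simp add: index_kron prod_index_less)
  have conj: "(M s j * \<rho> * adj (M s j)) $$ (i,i') = (\<Sum>r<R. w s j r i * cnj (w s j r i'))" if ii: "i < K*K" "i' < K*K" for s j i i'
  proof -
    have "(M s j * \<rho> * adj (M s j)) $$ (i,i') = (adj (adj (M s j)) * \<rho> * adj (M s j)) $$ (i,i')" by simp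
    also have "\<dots> = (\<Sum>k<dA*dB. \<Sum>l<dA*dB. \<Sum>r<R. (M s j $$ (i,k) * f r k) * cnj (M s j $$ (i',l) * f r l))"
      using M[of s j] ii by (subst index_conj[OF \<rho>(1) _ ii]) (auto simp: \<rho>(2) sum_distrib_left sum_distrib_right mult_ac intro!: sum.cong)
    also have "\<dots> = (\<Sum>r<R. \<Sum>k<dA*dB. \<Sum>l<dA*dB. (M s j $$ (i,k) * f r k) * cnj (M s j $$ (i',l) * f r l))"
      by (rule sum_rotate)
    finally show ?thesis by (simp add: w_def sum_product)
  qed
  let ?Ks = "concat (map (\<lambda>s. map (M s) [0..<J]) [0..<P])"
  have Ks: "\<forall>N\<in>set ?Ks. N \<in> carrier_mat (K*K) (dA*dB)" using M by auto
  have \<omega>: "\<omega> = apply_kraus (K*K) ?Ks \<rho>" by (simp add: \<omega>_def M_def[abs_def])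
  have \<omega>c: "\<omega> \<in> carrier_mat (K*K) (K*K)" using apply_kraus_carrier_index[OF Ks \<rho>(1)] by (simp add: \<omega>)
  have sl: "(\<Sum>N\<leftarrow>?Ks. G N) = (\<Sum>s<P. \<Sum>j<J. G (M s j))" for G :: "complex mat \<Rightarrow> complex"
  proof -
    have "(\<Sum>N\<leftarrow>concat (map (\<lambda>s. map (M s) [0..<J]) ss). G N) = (\<Sum>s\<leftarrow>ss. \<Sum>j<J. G (M s j))" for ss
      by (induction ss) (simp_all add: o_def interv_sum_list_conv_sum_set_nat atLeast0LessThan)
    then show ?thesis by (simp add: interv_sum_list_conv_sum_set_nat atLeast0LessThan)
  qed
  have "\<omega> $$ (i,i') = (\<Sum>s<P. \<Sum>j<J. (M s j * \<rho> * adj (M s j)) $$ (i,i'))" if "i < K*K" "i' < K*K" for i i'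
    using apply_kraus_carrier_index[OF Ks \<rho>(1)] that unfolding \<omega> by (simp only: sl)
  then have \<omega>i: "\<omega> $$ (i,i') = (\<Sum>z\<in>{..<P}\<times>{..<J}\<times>{..<R}. w (fst z) (fst (snd z)) (snd (snd z)) i * cnj (w (fst z) (fst (snd z)) (snd (snd z)) i'))"
    if "i < K*K" "i' < K*K" for i i' using that by (simp add: conj sum_Times)
  have psd: "psd \<omega>"
    by (rule psd_gram[OF \<omega>c, where S = "{..<P}\<times>{..<J}\<times>{..<R}" and f = "\<lambda>z i. w (fst z) (fst (snd z)) (snd (snd z)) i"]) (rule \<omega>i)
  have "mtrace \<omega> = (\<Sum>i<K*K. \<omega> $$ (i,i))" using \<omega>c by (simp add: mtrace_def)
  also have "\<dots> = of_real (\<Sum>i<K*K. \<Sum>s<P. \<Sum>j<J. \<Sum>r<R. (cmod (w s j r i))\<^sup>2)"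
    by (simp add: \<omega>i sum_Times complex_norm_square del: of_real_power)
  also have "(\<Sum>i<K*K. \<Sum>s<P. \<Sum>j<J. \<Sum>r<R. (cmod (w s j r i))\<^sup>2) = (\<Sum>r<R. \<Sum>s<P. \<Sum>j<J. \<Sum>k<K. \<Sum>k'<K. (cmod (w s j r (k*K+k')))\<^sup>2)"
  proof -
    have "(\<Sum>i<K*K. \<Sum>s<P. \<Sum>j<J. \<Sum>r<R. (cmod (w s j r i))\<^sup>2) = (\<Sum>s<P. \<Sum>j<J. \<Sum>r<R. \<Sum>i<K*K. (cmod (w s j r i))\<^sup>2)"
      by (subst sum_rotate[symmetric], subst sum.swap, rule sum.cong[OF refl], subst sum.swap, rule sum.cong[OF refl]) (rule sum.swap)
    also have "\<dots> = (\<Sum>r<R. \<Sum>s<P. \<Sum>j<J. \<Sum>i<K*K. (cmod (w s j r i))\<^sup>2)" by (rule sum_rotate)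
    finally show ?thesis unfolding sum_prod_index .
  qed
  also have "\<dots> = (\<Sum>r<R. \<Sum>a<dA. \<Sum>b<dB. (cmod (f r (a*dB+b)))\<^sup>2)"
    by (simp add: w iso)
  also have "\<dots> = 1" using tr by (simp add: sum_prod_index)
  finally show "bstate K K \<omega>" using \<omega>c psd by (simp add: bstate_def density_op_def)
  have "(\<Sum>i<K*K. \<Sum>j<K*K. cnj (max_entangled K $ i) * \<omega> $$ (i,j) * max_entangled K $ j)
      = (\<Sum>i<K*K. \<Sum>j<K*K. cnj (max_entangled K $ i) * (\<Sum>z\<in>{..<P}\<times>{..<J}\<times>{..<R}.
          w (fst z) (fst (snd z)) (snd (snd z)) i * cnj (w (fst z) (fst (snd z)) (snd (snd z)) j)) * max_entangled K $ j)"
    by (intro sum.cong refl) (simp add: \<omega>i)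
  also have "\<dots> = of_real (\<Sum>z\<in>{..<P}\<times>{..<J}\<times>{..<R}. (cmod (\<Sum>i<K*K. cnj (w (fst z) (fst (snd z)) (snd (snd z)) i) * max_entangled K $ i))\<^sup>2)"
    by (rule sum_form_gram)
  finally have F: "Re (\<Sum>i<K*K. \<Sum>j<K*K. cnj (max_entangled K $ i) * \<omega> $$ (i,j) * max_entangled K $ j)
      = (\<Sum>s<P. \<Sum>j<J. \<Sum>r<R. (cmod (\<Sum>i<K*K. cnj (w s j r i) * max_entangled K $ i))\<^sup>2)"
    by (simp add: sum_Times)
  have "(cmod (\<Sum>i<K*K. cnj (w s j r i) * max_entangled K $ i))\<^sup>2 = (cmod (\<Sum>k<K. w s j r (k*K+k)))\<^sup>2 / K" for s j r
  proof -
    have "(\<Sum>i<K*K. cnj (w s j r i) * max_entangled K $ i) = (\<Sum>k<K. \<Sum>k'<K. if k' = k then cnj (w s j r (k*K+k')) * of_real (1 / sqrt K) else 0)"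
      unfolding sum_prod_index by (intro sum.cong refl) (simp add: index_max_entangled)
    also have "\<dots> = cnj (\<Sum>k<K. w s j r (k*K+k)) * of_real (1 / sqrt K)"
      by (simp add: sum_divide_distrib)
    finally have "cmod (\<Sum>i<K*K. cnj (w s j r i) * max_entangled K $ i) = cmod (\<Sum>k<K. w s j r (k*K+k)) * (1 / sqrt K)"
      by (simp only: norm_mult complex_mod_cnj norm_of_real) simp
    then show ?thesis by (simp add: power_divide)
  qed
  then show "Re (\<Sum>i<K*K. \<Sum>j<K*K. cnj (max_entangled K $ i) * \<omega> $$ (i,j) * max_entangled K $ j)
      = (\<Sum>s<P. \<Sum>j<J. \<Sum>r<R. (cmod (\<Sum>k<K. \<Sum>a<dA. \<Sum>b<dB. \<alpha> s j k a * \<beta> s j k b * f r (a*dB+b)))\<^sup>2 / K)"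
    unfolding F by (simp add: w)
qed

text \<open>Alice's outcomes remain separate, with one Kraus operator each, because Bob's instrument
  depends on \<open>s\<close>. Bob's operators for given \<open>s\<close> form a single outcome,
  since no later round uses \<open>j\<close>.\<close>

lemma LOCC_A_to_B:
  assumes X: "\<And>a a'. a < dA \<Longrightarrow> a' < dA \<Longrightarrow> (\<Sum>s<P. \<Sum>k<K. cnj (X s k a) * X s k a') = (if a = a' then 1 else 0)"
    and D: "\<And>s b b'. b < dB \<Longrightarrow> b' < dB \<Longrightarrow> (\<Sum>j<J. \<Sum>k<K. cnj (D s j k b) * D s j k b') = (if b = b' then 1 else 0)"
  obtains Ks where "LOCC_instr dA dB K K Ks"
    "concat Ks = concat (map (\<lambda>s. map (\<lambda>j. kron (mat K dA (\<lambda>(k,a). X s k a)) (mat K dB (\<lambda>(k,b). D s j k b))) [0..<J]) [0..<P])"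
proof -
  define Xm where "Xm s = mat K dA (\<lambda>(k,a). X s k a)" for s
  define Dm where "Dm s j = mat K dB (\<lambda>(k,b). D s j k b)" for s j
  have Xc: "Xm s \<in> carrier_mat K dA" and Dc: "Dm s j \<in> carrier_mat K dB" for s j by (simp_all add: Xm_def Dm_def)
  have mul: "kron (1\<^sub>m K) (Dm s j) * kron (Xm s) (1\<^sub>m dB) = kron (Xm s) (Dm s j)" for s j
    using kron_mult[of "1\<^sub>m K" K K "Dm s j" K dB "Xm s" dA "1\<^sub>m dB" dB] Xc[of s] Dc[of s j] by simp
  let ?Ks = "map (map (\<lambda>M. kron M (1\<^sub>m dB))) (map (\<lambda>s. [Xm s]) [0..<P])"
  let ?L = "\<lambda>s. map (map (\<lambda>M. kron (1\<^sub>m K) M)) [map (Dm s) [0..<J]]"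
  let ?Ls = "map ?L [0..<P]"
  have c1: "concat (map (\<lambda>s. [Xm s]) [0..<P]) = map Xm [0..<P]" by (simp add: concat_map_singleton)
  have 1: "LOCC_instr dA dB K dB ?Ks"
    by (rule localA) (use kraus_sum_eq_one[where d = dA and P = P and K = K and X = X] X Xc in \<open>auto simp: c1 Xm_def\<close>)
  have 2: "LOCC_instr K dB K K (?L s)" for s
    by (rule localB) (use kraus_sum_eq_one[where d = dB and P = J and K = K and X = "D s"] D Dc in \<open>auto simp: Dm_def[abs_def]\<close>)
  let ?C = "concat (map (\<lambda>(K, Lk). map (\<lambda>L. [l * k. l \<leftarrow> L, k \<leftarrow> K]) Lk) (zip ?Ks ?Ls))"
  have "LOCC_instr dA dB K K ?C" by (rule compose[OF 1]) (use 2 in auto)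
  moreover have "zip ?Ks ?Ls = map (\<lambda>s. ([kron (Xm s) (1\<^sub>m dB)], ?L s)) [0..<P]"
    by (simp add: zip_map_map zip_same_conv_map o_def)
  then have "concat ?C = concat (map (\<lambda>s. map (\<lambda>j. kron (Xm s) (Dm s j)) [0..<J]) [0..<P])"
    by (simp add: o_def mul concat_map_singleton map_concat)
  ultimately show ?thesis using that[of ?C] by (simp add: Xm_def Dm_def)
qed

lemma LOCC_B_to_A:
  assumes X: "\<And>b b'. b < dB \<Longrightarrow> b' < dB \<Longrightarrow> (\<Sum>s<P. \<Sum>k<K. cnj (X s k b) * X s k b') = (if b = b' then 1 else 0)"
    and D: "\<And>s a a'. a < dA \<Longrightarrow> a' < dA \<Longrightarrow> (\<Sum>j<J. \<Sum>k<K. cnj (D s j k a) * D s j k a') = (if a = a' then 1 else 0)"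
  obtains Ks where "LOCC_instr dA dB K K Ks"
    "concat Ks = concat (map (\<lambda>s. map (\<lambda>j. kron (mat K dA (\<lambda>(k,a). D s j k a)) (mat K dB (\<lambda>(k,b). X s k b))) [0..<J]) [0..<P])"
proof -
  define Xm where "Xm s = mat K dB (\<lambda>(k,a). X s k a)" for s
  define Dm where "Dm s j = mat K dA (\<lambda>(k,b). D s j k b)" for s j
  have Xc: "Xm s \<in> carrier_mat K dB" and Dc: "Dm s j \<in> carrier_mat K dA" for s j by (simp_all add: Xm_def Dm_def)
  have mul: "kron (Dm s j) (1\<^sub>m K) * kron (1\<^sub>m dA) (Xm s) = kron (Dm s j) (Xm s)" for s j
    using kron_mult[of "Dm s j" K dA "1\<^sub>m K" K K "1\<^sub>m dA" dA "Xm s" dB] Xc[of s] Dc[of s j] by simp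
  let ?Ks = "map (map (\<lambda>M. kron (1\<^sub>m dA) M)) (map (\<lambda>s. [Xm s]) [0..<P])"
  let ?L = "\<lambda>s. map (map (\<lambda>M. kron M (1\<^sub>m K))) [map (Dm s) [0..<J]]"
  let ?Ls = "map ?L [0..<P]"
  have c1: "concat (map (\<lambda>s. [Xm s]) [0..<P]) = map Xm [0..<P]" by (simp add: concat_map_singleton)
  have 1: "LOCC_instr dA dB dA K ?Ks"
    by (rule localB) (use kraus_sum_eq_one[where d = dB and P = P and K = K and X = X] X Xc in \<open>auto simp: c1 Xm_def\<close>)
  have 2: "LOCC_instr dA K K K (?L s)" for s
    by (rule localA) (use kraus_sum_eq_one[where d = dA and P = J and K = K and X = "D s"] D Dc in \<open>auto simp: Dm_def[abs_def]\<close>)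
  let ?C = "concat (map (\<lambda>(K, Lk). map (\<lambda>L. [l * k. l \<leftarrow> L, k \<leftarrow> K]) Lk) (zip ?Ks ?Ls))"
  have "LOCC_instr dA dB K K ?C" by (rule compose[OF 1]) (use 2 in auto)
  moreover have "zip ?Ks ?Ls = map (\<lambda>s. ([kron (1\<^sub>m dA) (Xm s)], ?L s)) [0..<P]"
    by (simp add: zip_map_map zip_same_conv_map o_def)
  then have "concat ?C = concat (map (\<lambda>s. map (\<lambda>j. kron (Dm s j) (Xm s)) [0..<J]) [0..<P])"
    by (simp add: o_def mul concat_map_singleton map_concat)
  ultimately show ?thesis using that[of ?C] by (simp add: Xm_def Dm_def)
qed

subsection \<open>Tensor powers\<close>

text \<open>The positions of the two factors of a basis vector of \<open>(A1 A2)(B1 B2)\<close> in \<open>A1 B1\<close> and \<open>A2 B2\<close>.\<close>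

definition bidx1 :: "nat \<Rightarrow> nat \<Rightarrow> nat \<Rightarrow> nat \<Rightarrow> nat" where
  "bidx1 dB1 dA2 dB2 i = (i div (dB1*dB2) div dA2) * dB1 + i mod (dB1*dB2) div dB2"

definition bidx2 :: "nat \<Rightarrow> nat \<Rightarrow> nat \<Rightarrow> nat \<Rightarrow> nat" where
  "bidx2 dB1 dA2 dB2 i = (i div (dB1*dB2) mod dA2) * dB2 + i mod (dB1*dB2) mod dB2"

lemma btensor_carrier [simp]:
  "btensor dA1 dB1 dA2 dB2 \<rho>1 \<rho>2 \<in> carrier_mat ((dA1*dA2)*(dB1*dB2)) ((dA1*dA2)*(dB1*dB2))"
  "dim_row (btensor dA1 dB1 dA2 dB2 \<rho>1 \<rho>2) = (dA1*dA2)*(dB1*dB2)"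
  "dim_col (btensor dA1 dB1 dA2 dB2 \<rho>1 \<rho>2) = (dA1*dA2)*(dB1*dB2)"
  by (simp_all add: btensor_def)

lemma index_btensor:
  "i < (dA1*dA2)*(dB1*dB2) \<Longrightarrow> j < (dA1*dA2)*(dB1*dB2) \<Longrightarrow>
    btensor dA1 dB1 dA2 dB2 \<rho>1 \<rho>2 $$ (i,j) =
      \<rho>1 $$ (bidx1 dB1 dA2 dB2 i, bidx1 dB1 dA2 dB2 j) * \<rho>2 $$ (bidx2 dB1 dA2 dB2 i, bidx2 dB1 dA2 dB2 j)"
  by (simp add: btensor_def bidx1_def bidx2_def Let_def)

lemma bidx_pair:
  assumes "a2 < dA2" "b1 < dB1" "b2 < dB2"
  shows "bidx1 dB1 dA2 dB2 ((a1*dA2+a2)*(dB1*dB2)+(b1*dB2+b2)) = a1*dB1+b1"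
    "bidx2 dB1 dA2 dB2 ((a1*dA2+a2)*(dB1*dB2)+(b1*dB2+b2)) = a2*dB2+b2"
  unfolding bidx1_def bidx2_def index_div_mod(1)[OF prod_index_less[OF assms(2,3)]]
    index_div_mod(2)[OF prod_index_less[OF assms(2,3)]] using assms by simp_all

lemma bidx_less:
  assumes "i < (dA1*dA2)*(dB1*dB2)"
  shows "bidx1 dB1 dA2 dB2 i < dA1*dB1" "bidx2 dB1 dA2 dB2 i < dA2*dB2"
proof -
  note 1 = less_mult_divmod[OF assms]
  note 2 = less_mult_divmod[OF conjunct1[OF 1]] and 3 = less_mult_divmod[OF conjunct2[OF 1]]
  show "bidx1 dB1 dA2 dB2 i < dA1*dB1" "bidx2 dB1 dA2 dB2 i < dA2*dB2"
    unfolding bidx1_def bidx2_def using 2 3 by (auto intro: prod_index_less)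
qed

lemma bidx_inject:
  assumes i: "i < (dA1*dA2)*(dB1*dB2)" and j: "j < (dA1*dA2)*(dB1*dB2)"
    and eq: "bidx1 dB1 dA2 dB2 i = bidx1 dB1 dA2 dB2 j" "bidx2 dB1 dA2 dB2 i = bidx2 dB1 dA2 dB2 j"
  shows "i = j"
proof -
  note bi = conjunct2[OF less_mult_divmod[OF i]] and bj = conjunct2[OF less_mult_divmod[OF j]]
  note bi' = less_mult_divmod[OF bi] and bj' = less_mult_divmod[OF bj]
  have a1: "i div (dB1*dB2) div dA2 = j div (dB1*dB2) div dA2" and b1: "i mod (dB1*dB2) div dB2 = j mod (dB1*dB2) div dB2"
    using eq(1) bi' bj' unfolding bidx1_def by (metis index_div_mod)+
  have a2: "i div (dB1*dB2) mod dA2 = j div (dB1*dB2) mod dA2" and b2: "i mod (dB1*dB2) mod dB2 = j mod (dB1*dB2) mod dB2"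
    using eq(2) bi' bj' unfolding bidx2_def by (metis index_div_mod)+
  have "i div (dB1*dB2) = j div (dB1*dB2)" using a1 a2 by (metis div_mult_mod_eq)
  moreover have "i mod (dB1*dB2) = j mod (dB1*dB2)" using b1 b2 by (metis div_mult_mod_eq)
  ultimately show ?thesis by (metis div_mult_mod_eq)
qed

text \<open>The reordering of the tensor factors \<open>A1 A2 B1 B2\<close> into
  \<open>A1 B1 A2 B2\<close>, as a reindexing of sums; it reduces products, traces and spectra of
  \<open>btensor\<close> to those of the two factors.\<close>

lemma sum_bidx:
  "(\<Sum>k<(dA1*dA2)*(dB1*dB2). g (bidx1 dB1 dA2 dB2 k) (bidx2 dB1 dA2 dB2 k)) = (\<Sum>x<dA1*dB1. \<Sum>y<dA2*dB2. g x y)"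
proof -
  have "(\<Sum>k<(dA1*dA2)*(dB1*dB2). g (bidx1 dB1 dA2 dB2 k) (bidx2 dB1 dA2 dB2 k))
      = (\<Sum>a1<dA1. \<Sum>a2<dA2. \<Sum>b1<dB1. \<Sum>b2<dB2. g (a1*dB1+b1) (a2*dB2+b2))"
    unfolding sum_prod_index by (intro sum.cong refl) (simp only: bidx_pair lessThan_iff)
  also have "\<dots> = (\<Sum>a1<dA1. \<Sum>b1<dB1. \<Sum>a2<dA2. \<Sum>b2<dB2. g (a1*dB1+b1) (a2*dB2+b2))"
    by (rule sum.cong[OF refl], rule sum.swap)
  finally show ?thesis unfolding sum_prod_index .
qed

context
  fixes dA1 dB1 dA2 dB2 :: nat
begin

private abbreviation (input) "bt \<equiv> btensor dA1 dB1 dA2 dB2"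
private abbreviation (input) "i1 \<equiv> bidx1 dB1 dA2 dB2"
private abbreviation (input) "i2 \<equiv> bidx2 dB1 dA2 dB2"
private abbreviation (input) "d1 \<equiv> dA1*dB1"
private abbreviation (input) "d2 \<equiv> dA2*dB2"
private abbreviation (input) "d12 \<equiv> (dA1*dA2)*(dB1*dB2)"

lemma btensor_mult:
  assumes "A \<in> carrier_mat d1 d1" "B \<in> carrier_mat d2 d2" "C \<in> carrier_mat d1 d1" "D \<in> carrier_mat d2 d2"
  shows "bt A B * bt C D = bt (A * C) (B * D)"
proof (rule eq_matI)
  fix i j assume "i < dim_row (bt (A * C) (B * D))" "j < dim_col (bt (A * C) (B * D))"
  then have ij: "i < d12" "j < d12" by auto
  have "(bt A B * bt C D) $$ (i,j) = (\<Sum>k<d12. (A $$ (i1 i, i1 k) * B $$ (i2 i, i2 k)) * (C $$ (i1 k, i1 j) * D $$ (i2 k, i2 j)))"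
    using ij by (subst index_mult_mat_sum) (auto simp: index_btensor)
  also have "\<dots> = (\<Sum>x<d1. \<Sum>y<d2. (A $$ (i1 i, x) * B $$ (i2 i, y)) * (C $$ (x, i1 j) * D $$ (y, i2 j)))"
    by (rule sum_bidx)
  also have "\<dots> = (\<Sum>x<d1. A $$ (i1 i, x) * C $$ (x, i1 j)) * (\<Sum>y<d2. B $$ (i2 i, y) * D $$ (y, i2 j))"
    by (simp add: sum_product mult_ac)
  also have "\<dots> = bt (A * C) (B * D) $$ (i,j)"
    using assms ij bidx_less[OF ij(1)] bidx_less[OF ij(2)]
    by (auto simp: index_btensor index_mult_mat_sum simp del: index_mult_mat(1))
  finally show "(bt A B * bt C D) $$ (i,j) = bt (A * C) (B * D) $$ (i,j)" .
qed auto

lemma adj_btensor: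
  assumes "A \<in> carrier_mat d1 d1" "B \<in> carrier_mat d2 d2"
  shows "adj (bt A B) = bt (adj A) (adj B)"
proof (rule eq_matI)
  fix i j assume "i < dim_row (bt (adj A) (adj B))" "j < dim_col (bt (adj A) (adj B))"
  then have ij: "i < d12" "j < d12" by auto
  show "adj (bt A B) $$ (i,j) = bt (adj A) (adj B) $$ (i,j)"
    using ij assms bidx_less[OF ij(1)] bidx_less[OF ij(2)] by (simp add: index_btensor)
qed auto

lemma btensor_real_diag: "bt (real_diag d1 d) (real_diag d2 e) = real_diag d12 (\<lambda>k. d (i1 k) * e (i2 k))"
proof (rule eq_matI)
  fix i j assume "i < dim_row (real_diag d12 (\<lambda>k. d (i1 k) * e (i2 k)))" "j < dim_col (real_diag d12 (\<lambda>k. d (i1 k) * e (i2 k)))"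
  then have ij: "i < d12" "j < d12" by auto
  show "bt (real_diag d1 d) (real_diag d2 e) $$ (i,j) = real_diag d12 (\<lambda>k. d (i1 k) * e (i2 k)) $$ (i,j)"
    using ij bidx_less[OF ij(1)] bidx_less[OF ij(2)] bidx_inject[OF ij]
    by (auto simp: index_btensor real_diag_def)
qed auto

lemma btensor_one: "bt (1\<^sub>m d1) (1\<^sub>m d2) = 1\<^sub>m d12"
proof -
  have "1\<^sub>m k = real_diag k (\<lambda>_. 1)" for k by (rule eq_matI) (auto simp: real_diag_def)
  then show ?thesis using btensor_real_diag[of "\<lambda>_. 1" "\<lambda>_. 1"] by simp
qed

lemma unitary_btensor:
  assumes U: "unitary_mat d1 U" and V: "unitary_mat d2 V"
  shows "unitary_mat d12 (bt U V)"
proof (rule unitary_matI)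
  note u = unitary_matD[OF U] and v = unitary_matD[OF V]
  show "adj (bt U V) * bt U V = 1\<^sub>m d12"
    unfolding adj_btensor[OF u(1) v(1)] btensor_mult[OF u(2) v(2) u(1) v(1)] u v btensor_one ..
qed simp

lemma btensor_diagonalization:
  assumes U: "unitary_mat d1 U" and A: "A = U * real_diag d1 d * adj U"
    and V: "unitary_mat d2 V" and B: "B = V * real_diag d2 e * adj V"
  shows "bt A B = bt U V * real_diag d12 (\<lambda>k. d (i1 k) * e (i2 k)) * adj (bt U V)"
proof -
  note u = unitary_matD[OF U] and v = unitary_matD[OF V]
  have "U * real_diag d1 d \<in> carrier_mat d1 d1" "V * real_diag d2 e \<in> carrier_mat d2 d2"
    using u(1) v(1) by auto
  then show ?thesis
    unfolding A B using u(1,2) v(1,2)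
    by (simp add: adj_btensor btensor_mult btensor_real_diag[symmetric])
qed

lemma density_btensor:
  assumes A: "density_op d1 A" and B: "density_op d2 B"
  shows "density_op d12 (bt A B)"
proof -
  from A B have A': "A \<in> carrier_mat d1 d1" "psd A" "mtrace A = 1" and B': "B \<in> carrier_mat d2 d2" "psd B" "mtrace B = 1"
    by (auto simp: density_op_def)
  obtain f where f: "\<And>i j. i < d1 \<Longrightarrow> j < d1 \<Longrightarrow> A $$ (i,j) = (\<Sum>l<d1. f l i * cnj (f l j))"
    using psd_gram_decomposition[OF A'(1,2)] by metis
  obtain g where g: "\<And>i j. i < d2 \<Longrightarrow> j < d2 \<Longrightarrow> B $$ (i,j) = (\<Sum>l<d2. g l i * cnj (g l j))"
    using psd_gram_decomposition[OF B'(1,2)] by metis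
  have psd: "psd (bt A B)"
  proof (rule psd_gram[OF btensor_carrier(1), where S = "{..<d1}\<times>{..<d2}" and f = "\<lambda>l i. f (fst l) (i1 i) * g (snd l) (i2 i)"])
    fix i j assume ij: "i < d12" "j < d12"
    show "bt A B $$ (i,j) = (\<Sum>l\<in>{..<d1}\<times>{..<d2}. f (fst l) (i1 i) * g (snd l) (i2 i) * cnj (f (fst l) (i1 j) * g (snd l) (i2 j)))"
      using bidx_less[OF ij(1)] bidx_less[OF ij(2)]
      by (simp add: index_btensor[OF ij] f g sum_Times sum_product mult_ac)
  qed
  have "mtrace (bt A B) = (\<Sum>k<d12. A $$ (i1 k, i1 k) * B $$ (i2 k, i2 k))"
    by (simp add: mtrace_def index_btensor)
  then have "mtrace (bt A B) = (\<Sum>x<d1. \<Sum>y<d2. A $$ (x,x) * B $$ (y,y))"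
    by (simp only: sum_bidx[of "\<lambda>x y. A $$ (x,x) * B $$ (y,y)"])
  also have "\<dots> = mtrace A * mtrace B" using A'(1) B'(1) by (auto simp: mtrace_def sum_product)
  finally have "mtrace (bt A B) = mtrace A * mtrace B" .
  then show ?thesis using psd A' B' by (simp add: density_op_def)
qed

lemma ptrace_btensor:
  "ptrace_A (dA1*dA2) (dB1*dB2) (bt A B) = kron (ptrace_A dA1 dB1 A) (ptrace_A dA2 dB2 B)"
  "ptrace_B (dA1*dA2) (dB1*dB2) (bt A B) = kron (ptrace_B dA1 dB1 A) (ptrace_B dA2 dB2 B)"
proof -
  have ent: "bt A B $$ ((a1*dA2+a2)*(dB1*dB2)+(b1*dB2+b2), (a1'*dA2+a2')*(dB1*dB2)+(b1'*dB2+b2'))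
      = A $$ (a1*dB1+b1, a1'*dB1+b1') * B $$ (a2*dB2+b2, a2'*dB2+b2')"
    if "a1 < dA1" "a2 < dA2" "b1 < dB1" "b2 < dB2" "a1' < dA1" "a2' < dA2" "b1' < dB1" "b2' < dB2"
    for a1 a2 b1 b2 a1' a2' b1' b2'
    using that by (subst index_btensor) (auto simp: bidx_pair intro!: prod_index_less)
  show "ptrace_A (dA1*dA2) (dB1*dB2) (bt A B) = kron (ptrace_A dA1 dB1 A) (ptrace_A dA2 dB2 B)"
  proof (rule eq_matI)
    fix i j assume "i < dim_row (kron (ptrace_A dA1 dB1 A) (ptrace_A dA2 dB2 B))" "j < dim_col (kron (ptrace_A dA1 dB1 A) (ptrace_A dA2 dB2 B))"
    then have ij: "i < dB1*dB2" "j < dB1*dB2" by (auto simp: ptrace_A_def)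
    note i = less_mult_divmod[OF ij(1)] and j = less_mult_divmod[OF ij(2)]
    have "ptrace_A (dA1*dA2) (dB1*dB2) (bt A B) $$ (i,j)
        = (\<Sum>a1<dA1. \<Sum>a2<dA2. bt A B $$ ((a1*dA2+a2)*(dB1*dB2)+(i div dB2*dB2+i mod dB2), (a1*dA2+a2)*(dB1*dB2)+(j div dB2*dB2+j mod dB2)))"
      unfolding index_ptrace_A[OF ij] sum_prod_index div_mult_mod_eq ..
    also have "\<dots> = (\<Sum>a1<dA1. \<Sum>a2<dA2. A $$ (a1*dB1+i div dB2, a1*dB1+j div dB2) * B $$ (a2*dB2+i mod dB2, a2*dB2+j mod dB2))"
      using i j by (intro sum.cong[OF refl] ent) auto
    also have "\<dots> = kron (ptrace_A dA1 dB1 A) (ptrace_A dA2 dB2 B) $$ (i,j)"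
      using ij i j by (simp add: kron_def ptrace_A_def sum_product)
    finally show "ptrace_A (dA1*dA2) (dB1*dB2) (bt A B) $$ (i,j) = kron (ptrace_A dA1 dB1 A) (ptrace_A dA2 dB2 B) $$ (i,j)" .
  qed (auto simp: ptrace_A_def)
  show "ptrace_B (dA1*dA2) (dB1*dB2) (bt A B) = kron (ptrace_B dA1 dB1 A) (ptrace_B dA2 dB2 B)"
  proof (rule eq_matI)
    fix i j assume "i < dim_row (kron (ptrace_B dA1 dB1 A) (ptrace_B dA2 dB2 B))" "j < dim_col (kron (ptrace_B dA1 dB1 A) (ptrace_B dA2 dB2 B))"
    then have ij: "i < dA1*dA2" "j < dA1*dA2" by (auto simp: ptrace_B_def)
    note i = less_mult_divmod[OF ij(1)] and j = less_mult_divmod[OF ij(2)]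
    have "ptrace_B (dA1*dA2) (dB1*dB2) (bt A B) $$ (i,j)
        = (\<Sum>b1<dB1. \<Sum>b2<dB2. bt A B $$ ((i div dA2*dA2+i mod dA2)*(dB1*dB2)+(b1*dB2+b2), (j div dA2*dA2+j mod dA2)*(dB1*dB2)+(b1*dB2+b2)))"
      unfolding index_ptrace_B[OF ij] sum_prod_index div_mult_mod_eq ..
    also have "\<dots> = (\<Sum>b1<dB1. \<Sum>b2<dB2. A $$ (i div dA2*dB1+b1, j div dA2*dB1+b1) * B $$ (i mod dA2*dB2+b2, j mod dA2*dB2+b2))"
      using i j by (intro sum.cong[OF refl] ent) auto
    also have "\<dots> = kron (ptrace_B dA1 dB1 A) (ptrace_B dA2 dB2 B) $$ (i,j)"
      using ij i j by (simp add: kron_def ptrace_B_def sum_product)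
    finally show "ptrace_B (dA1*dA2) (dB1*dB2) (bt A B) $$ (i,j) = kron (ptrace_B dA1 dB1 A) (ptrace_B dA2 dB2 B) $$ (i,j)" .
  qed (auto simp: ptrace_B_def)
qed

end

section \<open>Marginals, spectra and power traces of tensor powers\<close>

lemma density_ptrace:
  assumes "bstate dA dB \<rho>"
  shows "density_op dA (ptrace_B dA dB \<rho>)" "density_op dB (ptrace_A dA dB \<rho>)"
proof -
  from assms have \<rho>: "\<rho> \<in> carrier_mat (dA*dB) (dA*dB)" "psd \<rho>" "mtrace \<rho> = 1" by (auto simp: bstate_def density_op_def)
  then have "(\<Sum>a<dA. \<Sum>b<dB. \<rho> $$ (a*dB+b, a*dB+b)) = 1" by (simp add: mtrace_def sum_prod_index)
  moreover from this have "(\<Sum>b<dB. \<Sum>a<dA. \<rho> $$ (a*dB+b, a*dB+b)) = 1" by (subst sum.swap)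
  ultimately show "density_op dA (ptrace_B dA dB \<rho>)" "density_op dB (ptrace_A dA dB \<rho>)"
    using psd_ptrace[OF \<rho>(1,2)] by (simp_all add: density_op_def mtrace_def ptrace_A_def ptrace_B_def)
qed

lemma psd_one: "psd (1\<^sub>m n)"
  using psd_mult_adj[of "1\<^sub>m n"] by simp

lemma bstate_btensor_list:
  assumes "\<forall>r\<in>set rs. bstate dA dB r"
  shows "bstate (dA ^ length rs) (dB ^ length rs) (btensor_list dA dB rs)"
  using assms
proof (induction rs)
  case Nil
  then show ?case using psd_one[of 1] by (simp add: bstate_def density_op_def mtrace_def)
next
  case (Cons r rs)
  then show ?case using density_btensor[of dA dB r "dA ^ length rs" "dB ^ length rs"] by (simp add: bstate_def)
qed

lemma density_diagonalization:
  assumes "density_op n A"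
  obtains U d where "unitary_mat n U" "A = U * real_diag n d * adj U" "\<And>i. i < n \<Longrightarrow> d i \<ge> 0" "(\<Sum>i<n. d i) = 1"
proof -
  from assms have A: "A \<in> carrier_mat n n" "psd A" "mtrace A = 1" by (auto simp: density_op_def)
  obtain U d where U: "unitary_mat n U" "A = U * real_diag n d * adj U" and d: "\<And>i. i < n \<Longrightarrow> d i \<ge> 0"
    using psd_diagonalization[OF A(1,2)] by metis
  have "of_real (\<Sum>i<n. d i) = complex_of_real 1"
    using trace_unitary_conj[OF U] A by (simp add: mtrace_def)
  then have "(\<Sum>i<n. d i) = 1" by (simp only: of_real_eq_iff)
  with U d show ?thesis by (rule that)
qed

text \<open>For a density operator, the trace of its power \<open>s\<close> on the support, since
  \<open>0 powr s = 0\<close> for every \<open>s\<close>. At \<open>1 + t\<close> it is the moment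
  generating function of the logarithm of an eigenvalue drawn with its own weight; being
  multiplicative under tensor products, it replaces any counting of typical eigenvalues of
  \<open>N\<close> copies.\<close>

definition power_trace :: "complex mat \<Rightarrow> real \<Rightarrow> real" where
  "power_trace A s = sum_mset (image_mset (\<lambda>x. Re x powr s) (eigvals A))"

lemma power_trace_unitary_conj:
  "unitary_mat n U \<Longrightarrow> A = U * real_diag n d * adj U \<Longrightarrow> power_trace A s = (\<Sum>i<n. d i powr s)"
  unfolding power_trace_def by (subst sum_eigvals_unitary_conj) auto

lemma power_trace_kron:
  assumes A: "density_op n A" and B: "density_op m B"
  shows "power_trace (kron A B) s = power_trace A s * power_trace B s"
proof -
  obtain U d where U: "unitary_mat n U" "A = U * real_diag n d * adj U"
    using density_diagonalization[OF A] by metis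
  obtain V e where V: "unitary_mat m V" "B = V * real_diag m e * adj V"
    using density_diagonalization[OF B] by metis
  have "power_trace (kron A B) s = (\<Sum>i<n. \<Sum>j<m. (d i * e j) powr s)"
    using power_trace_unitary_conj[OF unitary_kron[OF U(1) V(1)] kron_diagonalization[OF U V]] by (simp add: sum_prod_index)
  also have "\<dots> = (\<Sum>i<n. \<Sum>j<m. d i powr s * e j powr s)"
    by (simp add: powr_mult)
  finally show ?thesis unfolding power_trace_unitary_conj[OF U] power_trace_unitary_conj[OF V] by (simp add: sum_product)
qed

lemma power_trace_btensor:
  assumes A: "density_op (dA1*dB1) A" and B: "density_op (dA2*dB2) B"
  shows "power_trace (btensor dA1 dB1 dA2 dB2 A B) s = power_trace A s * power_trace B s"
proof -
  obtain U d where U: "unitary_mat (dA1*dB1) U" "A = U * real_diag (dA1*dB1) d * adj U"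
    using density_diagonalization[OF A] by metis
  obtain V e where V: "unitary_mat (dA2*dB2) V" "B = V * real_diag (dA2*dB2) e * adj V"
    using density_diagonalization[OF B] by metis
  have "power_trace (btensor dA1 dB1 dA2 dB2 A B) s = (\<Sum>i<dA1*dB1. \<Sum>j<dA2*dB2. (d i * e j) powr s)"
    unfolding power_trace_unitary_conj[OF unitary_btensor[OF U(1) V(1)] btensor_diagonalization[OF U V]]
    by (rule sum_bidx)
  also have "\<dots> = (\<Sum>i<dA1*dB1. \<Sum>j<dA2*dB2. d i powr s * e j powr s)"
    by (simp add: powr_mult)
  finally show ?thesis unfolding power_trace_unitary_conj[OF U] power_trace_unitary_conj[OF V] by (simp add: sum_product)
qed

lemma power_trace_one: "power_trace (1\<^sub>m 1) s = 1"
proof -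
  have "1\<^sub>m 1 = 1\<^sub>m 1 * real_diag 1 (\<lambda>_. 1) * adj (1\<^sub>m 1)"
    by (rule eq_matI) (auto simp: real_diag_def scalar_prod_def)
  from power_trace_unitary_conj[OF unitary_mat_one this] show ?thesis by simp
qed

lemma power_trace_btensor_power:
  assumes "bstate dA dB \<rho>"
  shows "power_trace (btensor_list dA dB (replicate N \<rho>)) s = power_trace \<rho> s ^ N"
    "power_trace (ptrace_A (dA^N) (dB^N) (btensor_list dA dB (replicate N \<rho>))) s = power_trace (ptrace_A dA dB \<rho>) s ^ N"
    "power_trace (ptrace_B (dA^N) (dB^N) (btensor_list dA dB (replicate N \<rho>))) s = power_trace (ptrace_B dA dB \<rho>) s ^ N"
proof -
  have st: "bstate (dA^N) (dB^N) (btensor_list dA dB (replicate N \<rho>))" for N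
    using bstate_btensor_list[of "replicate N \<rho>" dA dB] assms by auto
  have one: "ptrace_A 1 1 (1\<^sub>m 1) = 1\<^sub>m 1" "ptrace_B 1 1 (1\<^sub>m 1) = 1\<^sub>m 1"
    by (auto simp: ptrace_A_def ptrace_B_def intro!: eq_matI)
  show "power_trace (btensor_list dA dB (replicate N \<rho>)) s = power_trace \<rho> s ^ N"
  proof (induction N)
    case (Suc N)
    then show ?case using assms st[of N] by (simp add: power_trace_btensor bstate_def)
  qed (use power_trace_one in simp)
  show "power_trace (ptrace_A (dA^N) (dB^N) (btensor_list dA dB (replicate N \<rho>))) s = power_trace (ptrace_A dA dB \<rho>) s ^ N"
  proof (induction N)
    case (Suc N)
    then show ?case
      using power_trace_kron[OF density_ptrace(2)[OF assms] density_ptrace(2)[OF st[of N]]] by (simp add: ptrace_btensor)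
  qed (use power_trace_one one in simp)
  show "power_trace (ptrace_B (dA^N) (dB^N) (btensor_list dA dB (replicate N \<rho>))) s = power_trace (ptrace_B dA dB \<rho>) s ^ N"
  proof (induction N)
    case (Suc N)
    then show ?case
      using power_trace_kron[OF density_ptrace(1)[OF assms] density_ptrace(1)[OF st[of N]]] by (simp add: ptrace_btensor)
  qed (use power_trace_one one in simp)
qed

text \<open>The Chernoff exponent: the derivative of \<open>t \<mapsto> 2 powr (t * (\<epsilon> * S - \<delta>)) * Tr (A powr (1 + \<epsilon> * t))\<close> at \<open>0\<close>
  is \<open>- \<delta> * ln 2\<close>.\<close>

lemma power_trace_chernoff:
  assumes A: "density_op n A" and \<delta>: "\<delta> > 0"
  shows "\<exists>t0>0. \<forall>t. 0 < t \<and> t < t0 \<longrightarrow> 2 powr (t * (\<epsilon> * vN_entropy A - \<delta>)) * power_trace A (1 + \<epsilon> * t) < 1"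
proof -
  obtain U d where U: "unitary_mat n U" "A = U * real_diag n d * adj U" and d: "\<And>i. i < n \<Longrightarrow> d i \<ge> 0" "(\<Sum>i<n. d i) = 1"
    using density_diagonalization[OF A] by metis
  define S where "S = vN_entropy A"
  have S: "S = - (\<Sum>i<n. xlogx (d i))" unfolding S_def by (rule vN_entropy_unitary_conj[OF U])
  \<comment> \<open>Under the weights \<open>d i\<close> the mean of \<open>ln (d i)\<close> is
    \<open>- S * ln 2\<close>, so the first summand is centred and the mean of \<open>c\<close> is
    the announced derivative.\<close>
  define c where "c i = \<epsilon> * (ln (d i) + S * ln 2) - \<delta> * ln 2" for i
  define f where "f t = (\<Sum>i<n. d i * exp (t * c i))" for t
  have f: "2 powr (t * (\<epsilon> * S - \<delta>)) * power_trace A (1 + \<epsilon> * t) = f t" for t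
    unfolding power_trace_unitary_conj[OF U] f_def sum_distrib_left
  proof (intro sum.cong refl)
    fix i assume i: "i \<in> {..<n}"
    show "2 powr (t * (\<epsilon> * S - \<delta>)) * d i powr (1 + \<epsilon> * t) = d i * exp (t * c i)"
    proof (cases "d i = 0")
      case False
      then have pos: "d i > 0" using d i by force
      have "2 powr (t * (\<epsilon> * S - \<delta>)) * d i powr (1 + \<epsilon> * t) = exp (t * (\<epsilon> * S - \<delta>) * ln 2 + (1 + \<epsilon> * t) * ln (d i))"
        using pos by (simp add: powr_def exp_add)
      also have "t * (\<epsilon> * S - \<delta>) * ln 2 + (1 + \<epsilon> * t) * ln (d i) = ln (d i) + t * c i"
        by (simp add: c_def algebra_simps)
      finally show ?thesis using pos by (simp add: exp_add)
    qed simp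
  qed
  have "(f has_real_derivative (\<Sum>i<n. d i * (exp (0 * c i) * c i))) (at 0)"
    unfolding f_def by (auto intro!: derivative_eq_intros sum.cong)
  moreover have "(\<Sum>i<n. d i * (exp (0 * c i) * c i)) = - \<delta> * ln 2"
  proof -
    have "d i * (exp (0 * c i) * c i) = \<epsilon> * ln 2 * xlogx (d i) + d i * ((\<epsilon> * S - \<delta>) * ln 2)" if "i < n" for i
      using d(1)[OF that] by (auto simp: c_def xlogx_def log_def algebra_simps)
    then have "(\<Sum>i<n. d i * (exp (0 * c i) * c i)) = \<epsilon> * ln 2 * (\<Sum>i<n. xlogx (d i)) + (\<Sum>i<n. d i) * ((\<epsilon> * S - \<delta>) * ln 2)"
      by (simp add: sum.distrib sum_distrib_left sum_distrib_right)
    also have "(\<Sum>i<n. xlogx (d i)) = - S" using S by simp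
    finally show ?thesis using d by (simp add: algebra_simps)
  qed
  ultimately have "(f has_real_derivative (- \<delta> * ln 2)) (at 0)" by simp
  moreover have "- \<delta> * ln 2 < 0" using \<delta> by simp
  ultimately obtain t0 where "t0 > 0" "\<forall>h>0. h < t0 \<longrightarrow> f 0 > f (0 + h)"
    using DERIV_neg_dec_right by blast
  moreover have "f 0 = 1" using d by (simp add: f_def)
  ultimately show ?thesis unfolding S_def[symmetric] f by auto
qed

subsection \<open>Distillation from a single state\<close>

text \<open>\<open>p r b\<close> is a joint distribution with marginals \<open>\<mu>\<close> and
  \<open>\<nu>\<close>. A union bound removes the mass outside \<open>TR\<close> and outside
  \<open>TB\<close>; each part is estimated as in Markov's inequality, by comparing a power of the
  eigenvalue with the same power of its threshold.\<close>

lemma typical_mass_bound: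
  fixes \<phi> :: "nat \<Rightarrow> nat \<Rightarrow> nat \<Rightarrow> complex"
  assumes orth: "\<And>r r'. r < R \<Longrightarrow> r' < R \<Longrightarrow>
        (\<Sum>a<dA. \<Sum>b<dB. \<phi> r a b * cnj (\<phi> r' a b)) = (if r = r' then complex_of_real (\<mu> r) else 0)"
    and orthB: "\<And>b c. b < dB \<Longrightarrow> c < dB \<Longrightarrow>
        (\<Sum>r<R. \<Sum>a<dA. \<phi> r a b * cnj (\<phi> r a c)) = (if b = c then complex_of_real (\<nu> b) else 0)"
    and \<mu>1: "(\<Sum>r<R. \<mu> r) = 1" and t: "t > 0" and pos: "\<mu>0 > 0" "\<nu>0 > 0"
    and TR: "TR = {r. r < R \<and> \<mu> r \<ge> \<mu>0}" and TB: "TB = {b. b < dB \<and> \<nu> b \<le> \<nu>0}"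
  shows "(\<Sum>r\<in>TR. \<Sum>a<dA. \<Sum>b\<in>TB. (cmod (\<phi> r a b))\<^sup>2)
    \<ge> 1 - \<mu>0 powr t * (\<Sum>r<R. \<mu> r powr (1 - t)) - \<nu>0 powr (- t) * (\<Sum>b<dB. \<nu> b powr (1 + t))"
proof -
  define p where "p r b = (\<Sum>a<dA. (cmod (\<phi> r a b))\<^sup>2)" for r b
  have p0: "p r b \<ge> 0" for r b by (simp add: p_def sum_nonneg)
  have \<mu>: "\<mu> r = (\<Sum>b<dB. p r b)" if "r < R" for r
  proof -
    have "complex_of_real (\<mu> r) = of_real (\<Sum>a<dA. \<Sum>b<dB. (cmod (\<phi> r a b))\<^sup>2)"
      using orth[OF that that] by (simp add: complex_norm_square del: of_real_power)
    then have "\<mu> r = (\<Sum>a<dA. \<Sum>b<dB. (cmod (\<phi> r a b))\<^sup>2)" by (simp only: of_real_eq_iff)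
    then show ?thesis unfolding p_def by (subst sum.swap)
  qed
  have \<nu>: "\<nu> b = (\<Sum>r<R. p r b)" if "b < dB" for b
  proof -
    have "complex_of_real (\<nu> b) = of_real (\<Sum>r<R. \<Sum>a<dA. (cmod (\<phi> r a b))\<^sup>2)"
      using orthB[OF that that] by (simp add: complex_norm_square del: of_real_power)
    then show ?thesis unfolding p_def by (simp only: of_real_eq_iff)
  qed
  have \<mu>0: "\<mu> r \<ge> 0" if "r < R" for r using p0 that by (simp add: \<mu> sum_nonneg)
  have \<nu>0: "\<nu> b \<ge> 0" if "b < dB" for b using p0 that by (simp add: \<nu> sum_nonneg)
  have tail\<mu>: "(if r \<in> TR then 0 else \<mu> r) \<le> \<mu>0 powr t * \<mu> r powr (1 - t)" if r: "r < R" for r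
  proof (cases "r \<in> TR \<or> \<mu> r = 0")
    case False
    then have m: "0 < \<mu> r" "\<mu> r \<le> \<mu>0" using \<mu>0[OF r] r by (auto simp: TR)
    have "\<mu> r = \<mu> r powr t * \<mu> r powr (1 - t)" using m by (simp add: powr_add[symmetric])
    also have "\<dots> \<le> \<mu>0 powr t * \<mu> r powr (1 - t)" using m t by (intro mult_right_mono powr_mono2) auto
    finally show ?thesis using False by simp
  qed auto
  have tail\<nu>: "(if b \<in> TB then 0 else \<nu> b) \<le> \<nu>0 powr (- t) * \<nu> b powr (1 + t)" if b: "b < dB" for b
  proof (cases "b \<in> TB \<or> \<nu> b = 0")
    case False
    then have m: "0 < \<nu> b" "\<nu>0 \<le> \<nu> b" using \<nu>0[OF b] b by (auto simp: TB)
    have "\<nu> b = \<nu> b powr (- t) * \<nu> b powr (1 + t)" using m by (simp add: powr_add[symmetric])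
    also have "\<dots> \<le> \<nu>0 powr (- t) * \<nu> b powr (1 + t)" using m t pos by (intro mult_right_mono powr_mono2') auto
    finally show ?thesis using False by simp
  qed auto
  have "(\<Sum>r<R. \<Sum>b<dB. p r b) - (\<Sum>r<R. if r \<in> TR then 0 else \<mu> r) - (\<Sum>b<dB. if b \<in> TB then 0 else \<nu> b)
      = (\<Sum>r<R. \<Sum>b<dB. p r b - (if r \<in> TR then 0 else p r b) - (if b \<in> TB then 0 else p r b))"
  proof -
    have "(\<Sum>r<R. if r \<in> TR then 0 else \<mu> r) = (\<Sum>r<R. \<Sum>b<dB. if r \<in> TR then 0 else p r b)"
      by (intro sum.cong refl) (auto simp: \<mu>)
    moreover have "(\<Sum>b<dB. if b \<in> TB then 0 else \<nu> b) = (\<Sum>r<R. \<Sum>b<dB. if b \<in> TB then 0 else p r b)"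
      by (subst sum.swap, intro sum.cong refl) (auto simp: \<nu>)
    ultimately show ?thesis by (simp add: sum_subtractf)
  qed
  also have "\<dots> \<le> (\<Sum>r<R. \<Sum>b<dB. if r \<in> TR \<and> b \<in> TB then p r b else 0)"
    using p0 by (intro sum_mono) auto
  also have "\<dots> = (\<Sum>r\<in>TR. \<Sum>b\<in>TB. p r b)"
  proof -
    have pb: "(\<Sum>b<dB. if r \<in> TR \<and> b \<in> TB then p r b else 0) = (if r \<in> TR then \<Sum>b\<in>TB. p r b else 0)" for r
      by (auto simp: TB intro!: sum.mono_neutral_cong_right split: if_splits)
    show ?thesis unfolding pb by (auto simp: TR intro!: sum.mono_neutral_cong_right split: if_splits)
  qed
  also have "\<dots> = (\<Sum>r\<in>TR. \<Sum>a<dA. \<Sum>b\<in>TB. (cmod (\<phi> r a b))\<^sup>2)"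
    unfolding p_def by (rule sum.cong[OF refl], rule sum.swap)
  finally have "(\<Sum>r<R. \<Sum>b<dB. p r b) - (\<Sum>r<R. if r \<in> TR then 0 else \<mu> r) - (\<Sum>b<dB. if b \<in> TB then 0 else \<nu> b)
      \<le> (\<Sum>r\<in>TR. \<Sum>a<dA. \<Sum>b\<in>TB. (cmod (\<phi> r a b))\<^sup>2)" .
  moreover have "(\<Sum>r<R. \<Sum>b<dB. p r b) = 1" using \<mu>1 by (simp add: \<mu>)
  moreover have "(\<Sum>r<R. if r \<in> TR then 0 else \<mu> r) \<le> \<mu>0 powr t * (\<Sum>r<R. \<mu> r powr (1 - t))"
    unfolding sum_distrib_left using tail\<mu> by (intro sum_mono) auto
  moreover have "(\<Sum>b<dB. if b \<in> TB then 0 else \<nu> b) \<le> \<nu>0 powr (- t) * (\<Sum>b<dB. \<nu> b powr (1 + t))"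
    unfolding sum_distrib_left using tail\<nu> by (intro sum_mono) auto
  ultimately show ?thesis by linarith
qed

text \<open>\<open>one_shot_hashing\<close> wants the decoder's marginal diagonal. The change to the
  eigenbasis \<open>V\<close> of \<open>\<sigma>\<close> is therefore absorbed into the decoding
  operators \<open>D'\<close>, which remain complete because \<open>V\<close> is unitary. The
  typical mass is replaced by its bound in terms of power traces, which accounts for the two factors
  2.\<close>

lemma one_shot_hashing_marginal:
  fixes f :: "nat \<Rightarrow> nat \<Rightarrow> nat \<Rightarrow> complex"
  assumes orth: "\<And>r r'. r < R \<Longrightarrow> r' < R \<Longrightarrow>
        (\<Sum>a<dA. \<Sum>b<dB. f r a b * cnj (f r' a b)) = (if r = r' then complex_of_real (\<mu> r) else 0)"
    and \<mu>: "(\<Sum>r<R. \<mu> r) = 1" "\<And>r. r < R \<Longrightarrow> \<mu> r \<ge> 0"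
    and \<sigma>: "density_op dB \<sigma>" "\<And>b b'. b < dB \<Longrightarrow> b' < dB \<Longrightarrow> \<sigma> $$ (b,b') = (\<Sum>r<R. \<Sum>a<dA. f r a b * cnj (f r a b'))"
    and pos: "\<mu>0 > 0" "\<nu>0 > 0" "K > 0" "t > 0"
  obtains P J :: nat and X :: "nat \<Rightarrow> nat \<Rightarrow> nat \<Rightarrow> complex" and D :: "nat \<Rightarrow> nat \<Rightarrow> nat \<Rightarrow> nat \<Rightarrow> complex" where
    "\<And>a a'. a < dA \<Longrightarrow> a' < dA \<Longrightarrow> (\<Sum>s<P. \<Sum>k<K. cnj (X s k a) * X s k a') = (if a = a' then 1 else 0)"
    "\<And>s b b'. b < dB \<Longrightarrow> b' < dB \<Longrightarrow> (\<Sum>j<J. \<Sum>k<K. cnj (D s j k b) * D s j k b') = (if b = b' then 1 else 0)"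
    "(\<Sum>s<P. \<Sum>j<J. \<Sum>r<R. (cmod (\<Sum>k<K. \<Sum>a<dA. \<Sum>b<dB. X s k a * D s j k b * f r a b))\<^sup>2 / K)
      \<ge> 1 - 2 * (\<mu>0 powr t * (\<Sum>r<R. \<mu> r powr (1 - t))) - 2 * (\<nu>0 powr (- t) * power_trace \<sigma> (1 + t)) - K * \<nu>0 / \<mu>0"
proof -
  obtain V \<nu> where V: "unitary_mat dB V" "\<sigma> = V * real_diag dB \<nu> * adj V"
    using density_diagonalization[OF \<sigma>(1)] by metis
  note v = unitary_matD[OF V(1)]
  have \<sigma>c: "\<sigma> \<in> carrier_mat dB dB" using \<sigma>(1) by (simp add: density_op_def)
  define \<phi> where "\<phi> r a c = (\<Sum>b<dB. cnj (V $$ (b,c)) * f r a b)" for r a c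
  have inner: "(\<Sum>c<dB. (\<Sum>b<dB. cnj (V $$ (b,c)) * x b) * cnj (\<Sum>b<dB. cnj (V $$ (b,c)) * y b)) = (\<Sum>b<dB. x b * cnj (y b))" for x y
  proof -
    have "(\<Sum>c<dB. (\<Sum>b<dB. cnj (V $$ (b,c)) * x b) * cnj (\<Sum>b<dB. cnj (V $$ (b,c)) * y b))
       = (\<Sum>c<dB. \<Sum>b<dB. \<Sum>b'<dB. (x b * cnj (y b')) * (V $$ (b',c) * cnj (V $$ (b,c))))"
      by (simp add: sum_product) (simp add: mult_ac)
    also have "\<dots> = (\<Sum>b<dB. \<Sum>b'<dB. (x b * cnj (y b')) * (\<Sum>c<dB. V $$ (b',c) * cnj (V $$ (b,c))))"
      by (subst sum_rotate[symmetric]) (simp add: sum_distrib_left)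
    also have "\<dots> = (\<Sum>b<dB. \<Sum>b'<dB. if b' = b then x b * cnj (y b') else 0)"
      by (intro sum.cong refl) (simp add: unitary_rows_orthonormal[OF V(1)])
    finally show ?thesis by simp
  qed
  have orth\<phi>: "(\<Sum>a<dA. \<Sum>c<dB. \<phi> r a c * cnj (\<phi> r' a c)) = (if r = r' then complex_of_real (\<mu> r) else 0)"
    if "r < R" "r' < R" for r r' unfolding \<phi>_def inner using orth[OF that] .
  have orthB: "(\<Sum>r<R. \<Sum>a<dA. \<phi> r a c * cnj (\<phi> r a c')) = (if c = c' then complex_of_real (\<nu> c) else 0)"
    if c: "c < dB" "c' < dB" for c c'
  proof -
    have "(\<Sum>r<R. \<Sum>a<dA. \<phi> r a c * cnj (\<phi> r a c'))
        = (\<Sum>r<R. \<Sum>a<dA. \<Sum>b<dB. \<Sum>b'<dB. cnj (V $$ (b,c)) * (f r a b * cnj (f r a b')) * V $$ (b',c'))"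
      by (simp add: \<phi>_def sum_product) (simp add: mult_ac)
    also have "\<dots> = (\<Sum>b<dB. \<Sum>b'<dB. \<Sum>r<R. \<Sum>a<dA. cnj (V $$ (b,c)) * (f r a b * cnj (f r a b')) * V $$ (b',c'))"
      by (subst sum_rotate, rule sum.cong[OF refl], rule sum_rotate)
    also have "\<dots> = (adj V * \<sigma> * V) $$ (c,c')"
      unfolding index_conj[OF \<sigma>c v(1) c] by (simp add: \<sigma>(2) sum_distrib_left sum_distrib_right)
    finally show ?thesis using c by (simp add: adj_conj_diagonalization[OF V] real_diag_def)
  qed
  define TR where "TR = {r. r < R \<and> \<mu> r \<ge> \<mu>0}"
  define TB where "TB = {b. b < dB \<and> \<nu> b \<le> \<nu>0}"
  obtain P J :: nat and X D where
    X: "\<And>a a'. a < dA \<Longrightarrow> a' < dA \<Longrightarrow> (\<Sum>s<P. \<Sum>k<K. cnj (X s k a) * X s k a') = (if a = a' then 1 else 0)"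
    and D: "\<And>s b b'. b < dB \<Longrightarrow> b' < dB \<Longrightarrow> (\<Sum>j<J. \<Sum>k<K. cnj (D s j k b) * D s j k b') = (if b = b' then 1 else 0)"
    and F: "(\<Sum>s<P. \<Sum>j<J. \<Sum>r<R. (cmod (\<Sum>k<K. \<Sum>a<dA. \<Sum>b<dB. X s k a * D s j k b * \<phi> r a b))\<^sup>2 / K)
      \<ge> 2 * (\<Sum>r\<in>TR. \<Sum>a<dA. \<Sum>b\<in>TB. (cmod (\<phi> r a b))\<^sup>2) - 1 - K * \<nu>0 / \<mu>0"
    by (rule one_shot_hashing[OF orth\<phi> orthB \<mu> pos(1-3) TR_def TB_def]) blast+
  have mass: "(\<Sum>r\<in>TR. \<Sum>a<dA. \<Sum>b\<in>TB. (cmod (\<phi> r a b))\<^sup>2)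
    \<ge> 1 - \<mu>0 powr t * (\<Sum>r<R. \<mu> r powr (1 - t)) - \<nu>0 powr (- t) * (\<Sum>b<dB. \<nu> b powr (1 + t))"
    by (rule typical_mass_bound[OF orth\<phi> orthB \<mu>(1) pos(4,1,2) TR_def TB_def])
  define D' where "D' s j k b = (\<Sum>c<dB. D s j k c * cnj (V $$ (b,c)))" for s j k b
  show ?thesis
  proof (rule that[where P = P and J = J and X = X and D = D', OF X])
    fix s b b' assume b: "b < dB" "b' < dB"
    have "(\<Sum>j<J. \<Sum>k<K. cnj (D' s j k b) * D' s j k b')
       = (\<Sum>j<J. \<Sum>k<K. \<Sum>c<dB. \<Sum>c'<dB. (V $$ (b,c) * cnj (V $$ (b',c'))) * (cnj (D s j k c) * D s j k c'))"
      by (simp add: D'_def sum_product) (simp add: mult_ac)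
    also have "\<dots> = (\<Sum>c<dB. \<Sum>c'<dB. \<Sum>j<J. \<Sum>k<K. (V $$ (b,c) * cnj (V $$ (b',c'))) * (cnj (D s j k c) * D s j k c'))"
      by (subst sum_rotate, rule sum.cong[OF refl], rule sum_rotate)
    also have "\<dots> = (\<Sum>c<dB. \<Sum>c'<dB. (V $$ (b,c) * cnj (V $$ (b',c'))) * (\<Sum>j<J. \<Sum>k<K. cnj (D s j k c) * D s j k c'))"
      by (simp add: sum_distrib_left)
    also have "\<dots> = (\<Sum>c<dB. \<Sum>c'<dB. if c = c' then V $$ (b,c) * cnj (V $$ (b',c')) else 0)"
      by (intro sum.cong refl) (simp add: D)
    also have "\<dots> = (if b = b' then 1 else 0)"
      using unitary_rows_orthonormal[OF V(1) b] by simp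
    finally show "(\<Sum>j<J. \<Sum>k<K. cnj (D' s j k b) * D' s j k b') = (if b = b' then 1 else 0)" .
  next
    have "(\<Sum>c<dB. X s k a * D s j k c * \<phi> r a c) = (\<Sum>b<dB. X s k a * D' s j k b * f r a b)" for s j k r a
    proof -
      have "(\<Sum>c<dB. X s k a * D s j k c * \<phi> r a c) = (\<Sum>c<dB. \<Sum>b<dB. X s k a * (D s j k c * cnj (V $$ (b,c))) * f r a b)"
        by (simp add: \<phi>_def sum_distrib_left mult_ac)
      also have "\<dots> = (\<Sum>b<dB. \<Sum>c<dB. X s k a * (D s j k c * cnj (V $$ (b,c))) * f r a b)" by (rule sum.swap)
      finally show ?thesis by (simp add: D'_def sum_distrib_left sum_distrib_right)
    qed
    then show "(\<Sum>s<P. \<Sum>j<J. \<Sum>r<R. (cmod (\<Sum>k<K. \<Sum>a<dA. \<Sum>b<dB. X s k a * D' s j k b * f r a b))\<^sup>2 / K)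
      \<ge> 1 - 2 * (\<mu>0 powr t * (\<Sum>r<R. \<mu> r powr (1 - t))) - 2 * (\<nu>0 powr (- t) * power_trace \<sigma> (1 + t)) - K * \<nu>0 / \<mu>0"
      using F mass unfolding power_trace_unitary_conj[OF V] by simp
  qed
qed

text \<open>Completeness composes round by round: \<open>D\<close> depends on \<open>s\<close>, so
  its sum over \<open>j\<close> and \<open>k'\<close> is carried out first for fixed
  \<open>s\<close> and \<open>k\<close>, and only then the sum over the operators
  \<open>X\<close>.\<close>

lemma product_isometry:
  fixes X :: "nat \<Rightarrow> nat \<Rightarrow> nat \<Rightarrow> complex" and D :: "nat \<Rightarrow> nat \<Rightarrow> nat \<Rightarrow> nat \<Rightarrow> complex"
  assumes X: "\<And>a a'. a < dA \<Longrightarrow> a' < dA \<Longrightarrow> (\<Sum>s<P. \<Sum>k<K. cnj (X s k a) * X s k a') = (if a = a' then 1 else 0)"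
    and D: "\<And>s b b'. b < dB \<Longrightarrow> b' < dB \<Longrightarrow> (\<Sum>j<J. \<Sum>k<K. cnj (D s j k b) * D s j k b') = (if b = b' then 1 else 0)"
  shows "(\<Sum>s<P. \<Sum>j<J. \<Sum>k<K. \<Sum>k'<K. (cmod (\<Sum>a<dA. \<Sum>b<dB. X s k a * D s j k' b * y a b))\<^sup>2)
        = (\<Sum>a<dA. \<Sum>b<dB. (cmod (y a b))\<^sup>2)"
proof -
  have isoD: "(\<Sum>j<J. \<Sum>k<K. (cmod (\<Sum>b<dB. D s j k b * u b))\<^sup>2) = (\<Sum>b<dB. (cmod (u b))\<^sup>2)" for s u
    using isometry_sum[where d = dB and I = "{..<J}\<times>{..<K}" and M = "\<lambda>z b. D s (fst z) (snd z) b" and y = u] D by (simp add: sum_Times)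
  have isoX: "(\<Sum>s<P. \<Sum>k<K. (cmod (\<Sum>a<dA. X s k a * u a))\<^sup>2) = (\<Sum>a<dA. (cmod (u a))\<^sup>2)" for u
    using isometry_sum[where d = dA and I = "{..<P}\<times>{..<K}" and M = "\<lambda>z a. X (fst z) (snd z) a" and y = u] X by (simp add: sum_Times)
  have "(\<Sum>a<dA. \<Sum>b<dB. X s k a * D s j k' b * y a b) = (\<Sum>b<dB. D s j k' b * (\<Sum>a<dA. X s k a * y a b))" for s j k k'
    by (subst sum.swap) (simp add: sum_distrib_left mult_ac)
  then have "(\<Sum>s<P. \<Sum>j<J. \<Sum>k<K. \<Sum>k'<K. (cmod (\<Sum>a<dA. \<Sum>b<dB. X s k a * D s j k' b * y a b))\<^sup>2)
      = (\<Sum>s<P. \<Sum>k<K. \<Sum>j<J. \<Sum>k'<K. (cmod (\<Sum>b<dB. D s j k' b * (\<Sum>a<dA. X s k a * y a b)))\<^sup>2)"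
    by (simp only:) (rule sum.cong[OF refl], rule sum.swap)
  also have "\<dots> = (\<Sum>s<P. \<Sum>k<K. \<Sum>b<dB. (cmod (\<Sum>a<dA. X s k a * y a b))\<^sup>2)" by (simp only: isoD)
  also have "\<dots> = (\<Sum>b<dB. \<Sum>s<P. \<Sum>k<K. (cmod (\<Sum>a<dA. X s k a * y a b))\<^sup>2)" by (rule sum_rotate)
  also have "\<dots> = (\<Sum>b<dB. \<Sum>a<dA. (cmod (y a b))\<^sup>2)" by (simp only: isoX)
  finally show ?thesis by (subst sum.swap)
qed

definition fidelity_me :: "nat \<Rightarrow> complex mat \<Rightarrow> real" where
  "fidelity_me K \<omega> = Re (\<Sum>i<K*K. \<Sum>j<K*K. cnj (max_entangled K $ i) * \<omega> $$ (i,j) * max_entangled K $ j)"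

text \<open>\<open>\<sigma>\<close> is the marginal of the decoding party: \<open>ptrace_A\<close>
  leaves the state of \<open>B\<close> and belongs to the protocol in which Alice measures,
  \<open>ptrace_B\<close> to its mirror image. The eigenvectors of \<open>\<rho>\<close> scaled by
  \<open>sqrt (\<mu> r)\<close> supply the purification.\<close>

lemma distill_step:
  assumes E: "LOCC_monotone E" and \<rho>: "bstate dA dB \<rho>"
    and pos: "\<mu>0 > 0" "\<nu>0 > 0" "K > 0" "t > 0"
    and \<sigma>: "\<sigma> = ptrace_A dA dB \<rho> \<or> \<sigma> = ptrace_B dA dB \<rho>"
  shows "\<exists>\<omega>. bstate K K \<omega> \<and> E K K \<omega> \<le> E dA dB \<rho> \<and> fidelity_me K \<omega>
    \<ge> 1 - 2 * (\<mu>0 powr t * power_trace \<rho> (1 - t)) - 2 * (\<nu>0 powr (- t) * power_trace \<sigma> (1 + t)) - K * \<nu>0 / \<mu>0"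
proof -
  let ?d = "dA*dB"
  have \<rho>d: "density_op ?d \<rho>" using \<rho> by (simp add: bstate_def)
  then have \<rho>c: "\<rho> \<in> carrier_mat ?d ?d" by (simp add: density_op_def)
  obtain U \<mu> where U: "unitary_mat ?d U" "\<rho> = U * real_diag ?d \<mu> * adj U"
    and \<mu>: "\<And>i. i < ?d \<Longrightarrow> \<mu> i \<ge> 0" "(\<Sum>i<?d. \<mu> i) = 1"
    using density_diagonalization[OF \<rho>d] by metis
  define f where "f r i = complex_of_real (sqrt (\<mu> r)) * U $$ (i,r)" for r i
  have sq: "complex_of_real (sqrt (\<mu> r)) * of_real (sqrt (\<mu> r)) = of_real (\<mu> r)" if "r < ?d" for r
    using \<mu>(1)[OF that] by (simp flip: of_real_mult)
  have gram: "\<rho> $$ (i,j) = (\<Sum>r<?d. f r i * cnj (f r j))" if "i < ?d" "j < ?d" for i j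
  proof -
    have "f r i * cnj (f r j) = (complex_of_real (sqrt (\<mu> r)) * of_real (sqrt (\<mu> r))) * (U $$ (i,r) * cnj (U $$ (j,r)))" for r
      by (simp add: f_def mult_ac)
    then show ?thesis unfolding U(2) index_unitary_conj[OF U(1) that] by (intro sum.cong) (auto simp: sq)
  qed
  have orth: "(\<Sum>i<?d. f r i * cnj (f r' i)) = (if r = r' then complex_of_real (\<mu> r) else 0)" if r: "r < ?d" "r' < ?d" for r r'
  proof -
    have "(\<Sum>i<?d. f r i * cnj (f r' i)) = (complex_of_real (sqrt (\<mu> r)) * of_real (sqrt (\<mu> r'))) * (\<Sum>i<?d. cnj (U $$ (i,r')) * U $$ (i,r))"
      by (simp add: f_def sum_distrib_left mult_ac)
    then show ?thesis unfolding unitary_cols_orthonormal[OF U(1) r(2,1)] using sq[OF r(1)] by auto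
  qed
  have tr: "(\<Sum>r<?d. \<Sum>i<?d. (cmod (f r i))\<^sup>2) = 1"
  proof -
    have "complex_of_real (\<Sum>i<?d. (cmod (f r i))\<^sup>2) = of_real (\<mu> r)" if "r < ?d" for r
      using orth[OF that that] by (simp add: complex_norm_square del: of_real_power)
    then have "(\<Sum>i<?d. (cmod (f r i))\<^sup>2) = \<mu> r" if "r < ?d" for r using that by (simp only: of_real_eq_iff)
    then show ?thesis using \<mu>(2) by simp
  qed
  have pt: "power_trace \<rho> s = (\<Sum>r<?d. \<mu> r powr s)" for s by (rule power_trace_unitary_conj[OF U])
  from \<sigma> show ?thesis
  proof
    assume \<sigma>: "\<sigma> = ptrace_A dA dB \<rho>"
    have o: "(\<Sum>a<dA. \<Sum>b<dB. f r (a*dB+b) * cnj (f r' (a*dB+b))) = (if r = r' then complex_of_real (\<mu> r) else 0)"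
      if "r < ?d" "r' < ?d" for r r' using orth[OF that] unfolding sum_prod_index .
    have s: "\<sigma> $$ (b,b') = (\<Sum>r<?d. \<Sum>a<dA. f r (a*dB+b) * cnj (f r (a*dB+b')))" if "b < dB" "b' < dB" for b b'
      unfolding \<sigma> using that by (simp add: index_ptrace_A gram prod_index_less) (rule sum.swap)
    obtain P J :: nat and X D where
      X: "\<And>a a'. a < dA \<Longrightarrow> a' < dA \<Longrightarrow> (\<Sum>s<P. \<Sum>k<K. cnj (X s k a) * X s k a') = (if a = a' then 1 else 0)"
      and D: "\<And>s b b'. b < dB \<Longrightarrow> b' < dB \<Longrightarrow> (\<Sum>j<J. \<Sum>k<K. cnj (D s j k b) * D s j k b') = (if b = b' then 1 else 0)"
      and F: "(\<Sum>s<P. \<Sum>j<J. \<Sum>r<?d. (cmod (\<Sum>k<K. \<Sum>a<dA. \<Sum>b<dB. X s k a * D s j k b * f r (a*dB+b)))\<^sup>2 / K)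
        \<ge> 1 - 2 * (\<mu>0 powr t * (\<Sum>r<?d. \<mu> r powr (1 - t))) - 2 * (\<nu>0 powr (- t) * power_trace \<sigma> (1 + t)) - K * \<nu>0 / \<mu>0"
      by (rule one_shot_hashing_marginal[OF o \<mu>(2,1) density_ptrace(2)[OF \<rho>, folded \<sigma>] s pos]) blast+
    obtain Ks where Ks: "LOCC_instr dA dB K K Ks"
      "concat Ks = concat (map (\<lambda>s. map (\<lambda>j. kron (mat K dA (\<lambda>(k,a). X s k a)) (mat K dB (\<lambda>(k,b). D s j k b))) [0..<J]) [0..<P])"
      by (rule LOCC_A_to_B[OF X D]) blast+
    note out = kron_kraus_output[OF \<rho>c gram tr product_isometry[where X = X and D = D, OF X D] pos(3), folded Ks(2)]
    have "E K K (apply_kraus (K*K) (concat Ks) \<rho>) \<le> E dA dB \<rho>"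
      using E \<rho> Ks(1) by (simp add: LOCC_monotone_def)
    then show ?thesis using out F unfolding fidelity_me_def pt by (intro exI conjI) auto
  next
    assume \<sigma>: "\<sigma> = ptrace_B dA dB \<rho>"
    have o: "(\<Sum>b<dB. \<Sum>a<dA. f r (a*dB+b) * cnj (f r' (a*dB+b))) = (if r = r' then complex_of_real (\<mu> r) else 0)"
      if "r < ?d" "r' < ?d" for r r' using orth[OF that] unfolding sum_prod_index by (subst sum.swap)
    have s: "\<sigma> $$ (a,a') = (\<Sum>r<?d. \<Sum>b<dB. f r (a*dB+b) * cnj (f r (a'*dB+b)))" if "a < dA" "a' < dA" for a a'
      unfolding \<sigma> using that by (simp add: index_ptrace_B gram prod_index_less) (rule sum.swap)
    obtain P J :: nat and X D where
      X: "\<And>b b'. b < dB \<Longrightarrow> b' < dB \<Longrightarrow> (\<Sum>s<P. \<Sum>k<K. cnj (X s k b) * X s k b') = (if b = b' then 1 else 0)"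
      and D: "\<And>s a a'. a < dA \<Longrightarrow> a' < dA \<Longrightarrow> (\<Sum>j<J. \<Sum>k<K. cnj (D s j k a) * D s j k a') = (if a = a' then 1 else 0)"
      and F: "(\<Sum>s<P. \<Sum>j<J. \<Sum>r<?d. (cmod (\<Sum>k<K. \<Sum>b<dB. \<Sum>a<dA. X s k b * D s j k a * f r (a*dB+b)))\<^sup>2 / K)
        \<ge> 1 - 2 * (\<mu>0 powr t * (\<Sum>r<?d. \<mu> r powr (1 - t))) - 2 * (\<nu>0 powr (- t) * power_trace \<sigma> (1 + t)) - K * \<nu>0 / \<mu>0"
      by (rule one_shot_hashing_marginal[OF o \<mu>(2,1) density_ptrace(1)[OF \<rho>, folded \<sigma>] s pos]) blast+
    obtain Ks where Ks: "LOCC_instr dA dB K K Ks"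
      "concat Ks = concat (map (\<lambda>s. map (\<lambda>j. kron (mat K dA (\<lambda>(k,a). D s j k a)) (mat K dB (\<lambda>(k,b). X s k b))) [0..<J]) [0..<P])"
      by (rule LOCC_B_to_A[OF X D]) blast+
    have iso: "(\<Sum>s<P. \<Sum>j<J. \<Sum>k<K. \<Sum>k'<K. (cmod (\<Sum>a<dA. \<Sum>b<dB. D s j k a * X s k' b * y a b))\<^sup>2)
        = (\<Sum>a<dA. \<Sum>b<dB. (cmod (y a b))\<^sup>2)" for y
    proof -
      have "(\<Sum>a<dA. \<Sum>b<dB. D s j k a * X s k' b * y a b) = (\<Sum>b<dB. \<Sum>a<dA. X s k' b * D s j k a * y a b)" for s j k k'
        by (subst sum.swap) (simp add: mult_ac)
      then have "(\<Sum>s<P. \<Sum>j<J. \<Sum>k<K. \<Sum>k'<K. (cmod (\<Sum>a<dA. \<Sum>b<dB. D s j k a * X s k' b * y a b))\<^sup>2)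
          = (\<Sum>s<P. \<Sum>j<J. \<Sum>k'<K. \<Sum>k<K. (cmod (\<Sum>b<dB. \<Sum>a<dA. X s k' b * D s j k a * y a b))\<^sup>2)"
        by (simp only:) (rule sum.cong[OF refl], rule sum.cong[OF refl], rule sum.swap)
      also have "\<dots> = (\<Sum>b<dB. \<Sum>a<dA. (cmod (y a b))\<^sup>2)" by (rule product_isometry[where X = X and D = D, OF X D])
      finally show ?thesis by (subst sum.swap)
    qed
    note out = kron_kraus_output[where \<alpha> = D and \<beta> = "\<lambda>s j. X s", OF \<rho>c gram tr iso pos(3), folded Ks(2)]
    have "E K K (apply_kraus (K*K) (concat Ks) \<rho>) \<le> E dA dB \<rho>"
      using E \<rho> Ks(1) by (simp add: LOCC_monotone_def)
    moreover have "(\<Sum>a<dA. \<Sum>b<dB. D s j k a * X s k b * f r (a*dB+b)) = (\<Sum>b<dB. \<Sum>a<dA. X s k b * D s j k a * f r (a*dB+b))" for s j k r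
      by (subst sum.swap) (simp add: mult_ac)
    ultimately show ?thesis using out F unfolding fidelity_me_def pt by (intro exI conjI) auto
  qed
qed

lemma trace_norm_nonneg: "trace_norm A \<ge> 0"
proof -
  have "psd (adj A * A)" using psd_mult_adj[of "adj A"] by simp
  then obtain U d where "unitary_mat (dim_col A) U" "adj A * A = U * real_diag (dim_col A) d * adj U" "\<And>i. i < dim_col A \<Longrightarrow> d i \<ge> 0"
    using psd_diagonalization[of "adj A * A" "dim_col A"] by (metis carrier_matI dim_adj(1) index_mult_mat(2,3))
  then show ?thesis unfolding trace_norm_def by (subst sum_eigvals_unitary_conj) (auto intro: sum_nonneg)
qed

subsection \<open>The hashing inequality and the source\<close>

lemma bstate_proj:
  assumes v: "v \<in> carrier_vec (dA*dB)" "unit_vector v"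
  shows "bstate dA dB (proj v)"
proof -
  have c: "proj v \<in> carrier_mat (dA*dB) (dA*dB)" using v by (simp add: proj_def)
  have "psd (proj v)"
    by (rule psd_gram[OF c, where S = "{0::nat}" and f = "\<lambda>_ i. v $ i"]) (use v in \<open>simp add: proj_def\<close>)
  moreover have "mtrace (proj v) = of_real (\<Sum>i<dim_vec v. (cmod (v $ i))\<^sup>2)"
    by (simp add: mtrace_def proj_def complex_norm_square del: of_real_power)
  ultimately show ?thesis using c v by (simp add: bstate_def density_op_def unit_vector_def del: of_real_sum)
qed

text \<open>Continuity is invoked on the output pair of dimension \<open>K N\<close> each, where its
  denominator \<open>1 + 2 * log 2 (K N)\<close> grows at most linearly in \<open>N\<close>; an
  error that vanishes relative to it also vanishes relative to \<open>N\<close>. The slack 1 in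
  \<open>rate\<close> leaves room for rounding \<open>K N\<close> to an integer.\<close>

lemma distillation_rate:
  fixes K :: "nat \<Rightarrow> nat"
  assumes E: "proper_measure E" and K: "\<And>N. K N > 0"
    and \<omega>: "\<And>N. bstate (K N) (K N) (\<omega> N)" and mono: "\<And>N. E (K N) (K N) (\<omega> N) \<le> e N"
    and err: "err \<longlonglongrightarrow> 0" and fid: "\<And>N. fidelity_me (K N) (\<omega> N) \<ge> 1 - err N"
    and c: "c \<ge> 0" and rate: "\<And>N. c * real N - 1 \<le> log 2 (K N)" "\<And>N. log 2 (K N) \<le> c * real N"
    and lim: "(\<lambda>N. e N / real N) \<longlonglongrightarrow> L"
  shows "c \<le> L"
proof -
  define \<Phi> where "\<Phi> N = proj (max_entangled (K N))" for N
  have b\<Phi>: "bstate (K N) (K N) (\<Phi> N)" for N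
    unfolding \<Phi>_def by (intro bstate_proj max_entangled_carrier max_entangled_unit K)
  have tn: "trace_norm (\<omega> N - \<Phi> N) \<le> 2 * sqrt (2 * err N)" for N
  proof -
    have "trace_norm (\<omega> N - \<Phi> N) \<le> 2 * sqrt (2 * (1 - fidelity_me (K N) (\<omega> N)))"
      unfolding \<Phi>_def fidelity_me_def
      by (rule trace_norm_diff_pure) (use \<omega>[of N] max_entangled_unit[OF K] in \<open>auto simp: bstate_def\<close>)
    also have "\<dots> \<le> 2 * sqrt (2 * err N)" using fid[of N] by simp
    finally show ?thesis .
  qed
  have "(\<lambda>N. 2 * sqrt (2 * err N)) \<longlonglongrightarrow> 2 * sqrt (2 * 0)" by (intro tendsto_intros err)
  then have lim0: "(\<lambda>N. 2 * sqrt (2 * err N)) \<longlonglongrightarrow> 0" by (simp only: mult_zero_right real_sqrt_zero)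
  have "(\<lambda>N. trace_norm (\<omega> N - \<Phi> N)) \<longlonglongrightarrow> 0"
    by (rule tendsto_sandwich[OF _ _ tendsto_const lim0]) (intro always_eventually allI trace_norm_nonneg tn)+
  then have "(\<lambda>N. \<bar>E (K N) (K N) (\<omega> N) - E (K N) (K N) (\<Phi> N)\<bar> / (1 + log 2 (real (K N * K N)))) \<longlonglongrightarrow> 0"
    using E \<omega> b\<Phi> unfolding proper_measure_def asymptotically_continuous_def by blast
  then have a: "(\<lambda>N. \<bar>E (K N) (K N) (\<omega> N) - log 2 (K N)\<bar> / (1 + 2 * log 2 (K N))) \<longlonglongrightarrow> 0" (is "?a \<longlonglongrightarrow> 0")
  proof -
    have "E (K N) (K N) (\<Phi> N) = log 2 (K N)" for N
    proof -
      have "E (K N) (K N) (\<Phi> N) = vN_entropy (ptrace_B (K N) (K N) (\<Phi> N))"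
        using E max_entangled_unit[OF K] unfolding proper_measure_def pure_normalized_def \<Phi>_def by simp
      then show ?thesis using max_entangled_entropy[OF K] by (simp add: \<Phi>_def)
    qed
    moreover have "log 2 (real (K N * K N)) = 2 * log 2 (K N)" for N using K by (simp add: log_mult)
    ultimately show ?thesis
      using \<open>(\<lambda>N. \<bar>E (K N) (K N) (\<omega> N) - E (K N) (K N) (\<Phi> N)\<bar> / (1 + log 2 (real (K N * K N)))) \<longlonglongrightarrow> 0\<close> by simp
  qed
  have "c - inverse (real N) - ?a N * (inverse (real N) + 2 * c) \<le> e N / real N" if N: "N \<ge> 1" for N
  proof -
    have l0: "log 2 (K N) \<ge> 0" using K[of N] by simp
    have "\<bar>E (K N) (K N) (\<omega> N) - log 2 (K N)\<bar> = ?a N * (1 + 2 * log 2 (K N))" using l0 by simp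
    also have "\<dots> \<le> ?a N * (1 + 2 * (c * real N))" using rate(2)[of N] l0 by (intro mult_left_mono) auto
    finally have "c * real N - 1 - ?a N * (1 + 2 * (c * real N)) \<le> e N"
      using rate(1)[of N] mono[of N] by linarith
    then have "(c * real N - 1 - ?a N * (1 + 2 * (c * real N))) / real N \<le> e N / real N"
      by (intro divide_right_mono) auto
    moreover have "(c * real N - 1 - z * (1 + 2 * (c * real N))) / real N = c - inverse (real N) - z * (inverse (real N) + 2 * c)" for z
      using N by (simp add: field_simps)
    ultimately show ?thesis by (simp only:)
  qed
  moreover have "(\<lambda>N. c - inverse (real N) - ?a N * (inverse (real N) + 2 * c)) \<longlonglongrightarrow> c - 0 - 0 * (0 + 2 * c)"
    by (intro tendsto_intros a lim_inverse_n)
  ultimately show ?thesis using LIMSEQ_le[OF _ lim] by (auto simp: eventually_sequentially)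
qed

text \<open>The sequence \<open>e N\<close> stands for \<open>E\<close> on \<open>N\<close> copies.
  Keeping it and the single-round estimate \<open>step\<close> abstract lets both choices of the
  marginal share one asymptotic argument.\<close>

lemma hashing_rate:
  assumes E: "proper_measure E" and \<rho>: "density_op d \<rho>" and \<sigma>: "density_op d' \<sigma>"
    and step: "\<And>N K \<mu>0 \<nu>0 t. K > 0 \<Longrightarrow> \<mu>0 > 0 \<Longrightarrow> \<nu>0 > 0 \<Longrightarrow> t > 0 \<Longrightarrow>
      \<exists>\<omega>. bstate K K \<omega> \<and> E K K \<omega> \<le> e N \<and> fidelity_me K \<omega>
        \<ge> 1 - 2 * (\<mu>0 powr t * power_trace \<rho> (1 - t) ^ N) - 2 * (\<nu>0 powr (- t) * power_trace \<sigma> (1 + t) ^ N) - real K * \<nu>0 / \<mu>0"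
    and lim: "(\<lambda>N. e N / real N) \<longlonglongrightarrow> L"
  shows "vN_entropy \<sigma> - vN_entropy \<rho> \<le> L"
proof (cases "vN_entropy \<sigma> - vN_entropy \<rho> \<le> 0")
  case True
  \<comment> \<open>Here \<open>0 \<le> L\<close> is enough, and the trivial target
    \<open>K = 1\<close> gives it at rate 0: on a one-dimensional space every state has fidelity
    1.\<close>
  have "\<forall>N. \<exists>\<omega>. bstate 1 1 \<omega> \<and> E 1 1 \<omega> \<le> e N" using step[of 1 1 1 1] by fastforce
  then obtain \<omega> where \<omega>: "\<And>N. bstate 1 1 (\<omega> N)" "\<And>N. E 1 1 (\<omega> N) \<le> e N" by metis
  have "fidelity_me 1 (\<omega> N) = 1" for N
    using \<omega>(1)[of N] by (auto simp: bstate_def density_op_def mtrace_def fidelity_me_def max_entangled_def)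
  then have "0 \<le> L"
    using distillation_rate[OF E, of "\<lambda>_. 1" \<omega> e "\<lambda>_. 0" 0 L] \<omega> lim by simp
  with True show ?thesis by simp
next
  case False
  define \<Delta> where "\<Delta> = vN_entropy \<sigma> - vN_entropy \<rho>"
  have \<Delta>: "\<Delta> > 0" using False by (simp add: \<Delta>_def)
  show ?thesis
  proof (rule field_le_epsilon)
    fix \<epsilon> :: real assume \<epsilon>: "\<epsilon> > 0"
    \<comment> \<open>Three losses of \<open>\<delta>\<close>: one in each of the thresholds
      \<open>\<mu>0\<close> and \<open>\<nu>0\<close>, and one that makes
      \<open>K * \<nu>0 / \<mu>0\<close> decay exponentially. The bound by a third of
      \<open>\<Delta>\<close> keeps the rate \<open>c\<close> nonnegative.\<close>
    define \<delta> where "\<delta> = min \<epsilon> \<Delta> / 3"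
    have \<delta>: "\<delta> > 0" "3 * \<delta> \<le> \<epsilon>" "3 * \<delta> \<le> \<Delta>" using \<epsilon> \<Delta> by (auto simp: \<delta>_def)
    define c where "c = \<Delta> - 3 * \<delta>"
    have c: "c \<ge> 0" using \<delta> by (simp add: c_def)
    \<comment> \<open>The sign \<open>- 1\<close> controls atypically small eigenvalues of
      \<open>\<rho>\<close>, the sign \<open>1\<close> in the next application atypically large
      eigenvalues of \<open>\<sigma>\<close>.\<close>
    obtain t1 where t1: "t1 > 0" "\<And>t. 0 < t \<Longrightarrow> t < t1 \<Longrightarrow> 2 powr (t * (- 1 * vN_entropy \<rho> - \<delta>)) * power_trace \<rho> (1 + - 1 * t) < 1"
      using power_trace_chernoff[OF \<rho> \<delta>(1), of "- 1"] by blast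
    obtain t2 where t2: "t2 > 0" "\<And>t. 0 < t \<Longrightarrow> t < t2 \<Longrightarrow> 2 powr (t * (1 * vN_entropy \<sigma> - \<delta>)) * power_trace \<sigma> (1 + 1 * t) < 1"
      using power_trace_chernoff[OF \<sigma> \<delta>(1), of 1] by blast
    define t where "t = min t1 t2 / 2"
    have t: "0 < t" "t < t1" "t < t2" using t1(1) t2(1) by (auto simp: t_def)
    define q1 where "q1 = 2 powr (t * (- vN_entropy \<rho> - \<delta>)) * power_trace \<rho> (1 - t)"
    define q2 where "q2 = 2 powr (t * (vN_entropy \<sigma> - \<delta>)) * power_trace \<sigma> (1 + t)"
    have "sum_mset (image_mset (\<lambda>x. Re x powr s) M) \<ge> 0" for M s by (induction M) auto
    then have pt0: "power_trace A s \<ge> 0" for A s by (simp add: power_trace_def)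
    have q1: "0 \<le> q1" "q1 < 1" using t1(2)[OF t(1,2)] pt0 by (auto simp: q1_def)
    have q2: "0 \<le> q2" "q2 < 1" using t2(2)[OF t(1,3)] pt0 by (auto simp: q2_def)
    define \<mu>0 where "\<mu>0 N = 2 powr (real N * (- vN_entropy \<rho> - \<delta>))" for N :: nat
    define \<nu>0 where "\<nu>0 N = 2 powr (- real N * (vN_entropy \<sigma> - \<delta>))" for N :: nat
    define K where "K N = nat \<lfloor>2 powr (c * real N)\<rfloor>" for N :: nat
    define err where "err N = 2 * q1 ^ N + 2 * q2 ^ N + (2 powr (- \<delta>)) ^ N" for N :: nat
    have K1: "1 \<le> (2::real) powr (c * real N)" for N using c by (intro ge_one_powr_ge_zero) auto
    have Kpos: "K N > 0" for N using K1[of N] unfolding K_def by linarith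
    have Kup: "real (K N) \<le> 2 powr (c * real N)" for N unfolding K_def by (simp add: of_nat_nat)
    \<comment> \<open>Rounding down loses less than 1 and \<open>K N\<close> is at least 1, hence at
      most a factor 2; in the logarithm this is the slack 1 of
      \<open>distillation_rate\<close>.\<close>
    have Klow: "2 powr (c * real N) \<le> 2 * real (K N)" for N
      using Kpos[of N] unfolding K_def by linarith
    have p1: "\<mu>0 N powr t * power_trace \<rho> (1 - t) ^ N = q1 ^ N" for N
      by (simp add: \<mu>0_def q1_def powr_powr power_mult_distrib powr_realpow[symmetric] mult_ac)
    have p2: "\<nu>0 N powr (- t) * power_trace \<sigma> (1 + t) ^ N = q2 ^ N" for N
      by (simp add: \<nu>0_def q2_def powr_powr power_mult_distrib powr_realpow[symmetric] mult_ac)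
    have p3: "real (K N) * \<nu>0 N / \<mu>0 N \<le> (2 powr (- \<delta>)) ^ N" for N
    proof -
      have "real (K N) * \<nu>0 N / \<mu>0 N \<le> 2 powr (c * real N) * \<nu>0 N / \<mu>0 N"
        using Kup[of N] by (intro divide_right_mono mult_right_mono) (auto simp: \<mu>0_def \<nu>0_def)
      also have "\<dots> = 2 powr (c * real N + - real N * (vN_entropy \<sigma> - \<delta>) - real N * (- vN_entropy \<rho> - \<delta>))"
        unfolding \<mu>0_def \<nu>0_def powr_add powr_diff ..
      also have "c * real N + - real N * (vN_entropy \<sigma> - \<delta>) - real N * (- vN_entropy \<rho> - \<delta>) = - \<delta> * real N"
        by (simp add: c_def \<Delta>_def algebra_simps)
      also have "2 powr (- \<delta> * real N) = (2 powr (- \<delta>)) ^ N" 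
        using powr_realpow[of "2 powr (- \<delta>)" N] by (simp add: powr_powr)
      finally show ?thesis .
    qed
    have "\<forall>N. \<exists>\<omega>. bstate (K N) (K N) \<omega> \<and> E (K N) (K N) \<omega> \<le> e N \<and> fidelity_me (K N) \<omega> \<ge> 1 - err N"
    proof
      fix N
      have "\<mu>0 N > 0" "\<nu>0 N > 0" by (simp_all add: \<mu>0_def \<nu>0_def)
      from step[OF Kpos[of N] this t(1), of N] obtain \<omega> where
        \<omega>: "bstate (K N) (K N) \<omega>" "E (K N) (K N) \<omega> \<le> e N"
          "fidelity_me (K N) \<omega> \<ge> 1 - 2 * q1 ^ N - 2 * q2 ^ N - real (K N) * \<nu>0 N / \<mu>0 N"
        unfolding p1 p2 by blast
      moreover have "fidelity_me (K N) \<omega> \<ge> 1 - err N" using \<omega>(3) p3[of N] by (simp add: err_def)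
      ultimately show "\<exists>\<omega>. bstate (K N) (K N) \<omega> \<and> E (K N) (K N) \<omega> \<le> e N \<and> fidelity_me (K N) \<omega> \<ge> 1 - err N"
        by blast
    qed
    then obtain \<omega> where \<omega>: "\<And>N. bstate (K N) (K N) (\<omega> N)" "\<And>N. E (K N) (K N) (\<omega> N) \<le> e N"
      "\<And>N. fidelity_me (K N) (\<omega> N) \<ge> 1 - err N" by metis
    have "err \<longlonglongrightarrow> 2 * 0 + 2 * 0 + 0"
      unfolding err_def using q1 q2 \<delta>(1)
      by (intro tendsto_intros LIMSEQ_power_zero) (auto simp: powr_less_one)
    then have err: "err \<longlonglongrightarrow> 0" by simp
    have up: "log 2 (K N) \<le> c * real N" for N
      using Kup[of N] Kpos[of N] by (simp add: log_le_iff)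
    have low: "c * real N - 1 \<le> log 2 (K N)" for N
    proof -
      have "c * real N = log 2 (2 powr (c * real N))" by simp
      also have "\<dots> \<le> log 2 (2 * real (K N))" using Klow[of N] Kpos[of N] by (subst log_le_cancel_iff) auto
      also have "\<dots> = 1 + log 2 (K N)" using Kpos[of N] by (simp add: log_mult)
      finally show ?thesis by simp
    qed
    have "c \<le> L" by (rule distillation_rate[OF E Kpos \<omega>(1,2) err \<omega>(3) c low up lim])
    then show "vN_entropy \<sigma> - vN_entropy \<rho> \<le> L + \<epsilon>" using \<delta> by (simp add: c_def \<Delta>_def)
  qed
qed

theorem hashing_inequality:
  assumes E: "proper_measure E" and \<rho>: "bstate dA dB \<rho>" and lim: "reg_E_seq E dA dB \<rho> \<longlonglongrightarrow> L"
    and \<sigma>: "\<sigma> = ptrace_A dA dB \<rho> \<or> \<sigma> = ptrace_B dA dB \<rho>"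
  shows "vN_entropy \<sigma> - vN_entropy \<rho> \<le> L"
proof -
  let ?R = "\<lambda>N. btensor_list dA dB (replicate N \<rho>)"
  have d: "density_op (dA*dB) \<rho>" using \<rho> by (simp add: bstate_def)
  from \<sigma> obtain d' where d': "density_op d' \<sigma>" using density_ptrace[OF \<rho>] by auto
  have st: "bstate (dA^N) (dB^N) (?R N)" for N
    using bstate_btensor_list[of "replicate N \<rho>" dA dB] \<rho> by auto
  have mono: "LOCC_monotone E" using E by (simp add: proper_measure_def)
  show ?thesis
  proof (rule hashing_rate[OF E d d'])
    show "(\<lambda>N. E (dA^N) (dB^N) (?R N) / real N) \<longlonglongrightarrow> L" using lim by (simp add: reg_E_seq_def[abs_def])
    fix N K :: nat and \<mu>0 \<nu>0 t :: real
    assume pos: "K > 0" "\<mu>0 > 0" "\<nu>0 > 0" "t > 0"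
    from \<sigma> show "\<exists>\<omega>. bstate K K \<omega> \<and> E K K \<omega> \<le> E (dA^N) (dB^N) (?R N) \<and> fidelity_me K \<omega>
        \<ge> 1 - 2 * (\<mu>0 powr t * power_trace \<rho> (1 - t) ^ N) - 2 * (\<nu>0 powr (- t) * power_trace \<sigma> (1 + t) ^ N) - real K * \<nu>0 / \<mu>0"
    proof
      assume "\<sigma> = ptrace_A dA dB \<rho>"
      then show ?thesis
        using distill_step[OF mono st[of N] pos(2,3,1,4) disjI1[OF refl]]
        unfolding power_trace_btensor_power[OF \<rho>] by simp
    next
      assume "\<sigma> = ptrace_B dA dB \<rho>"
      then show ?thesis
        using distill_step[OF mono st[of N] pos(2,3,1,4) disjI2[OF refl]]
        unfolding power_trace_btensor_power[OF \<rho>] by simp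
    qed
  qed
qed

section \<open>Pure product states and the i.i.d. average\<close>

lemma btensor_proj:
  assumes "u \<in> carrier_vec (dA1*dB1)" "v \<in> carrier_vec (dA2*dB2)"
  shows "btensor dA1 dB1 dA2 dB2 (proj u) (proj v)
    = proj (vec ((dA1*dA2)*(dB1*dB2)) (\<lambda>i. u $ bidx1 dB1 dA2 dB2 i * v $ bidx2 dB1 dA2 dB2 i))"
  (is "_ = proj ?w")
proof (rule eq_matI)
  fix i j assume "i < dim_row (proj ?w)" "j < dim_col (proj ?w)"
  then have ij: "i < (dA1*dA2)*(dB1*dB2)" "j < (dA1*dA2)*(dB1*dB2)" by (auto simp: proj_def)
  show "btensor dA1 dB1 dA2 dB2 (proj u) (proj v) $$ (i,j) = proj ?w $$ (i,j)"
    unfolding index_btensor[OF ij] using assms ij bidx_less[OF ij(1)] bidx_less[OF ij(2)]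
    by (simp add: proj_def)
qed (auto simp: proj_def)

lemma unit_vector_iff_trace: "unit_vector v \<longleftrightarrow> mtrace (proj v) = 1"
proof -
  have "mtrace (proj v) = of_real (\<Sum>i<dim_vec v. (cmod (v $ i))\<^sup>2)"
    by (simp add: mtrace_def proj_def complex_norm_square del: of_real_power)
  then show ?thesis unfolding unit_vector_def by (metis of_real_1 of_real_eq_iff)
qed

text \<open>Products of pure states are pure, which makes \<open>pure_normalized\<close> applicable
  to every term of the source. The unit norm of \<open>w\<close> is read off from the trace of the
  product state.\<close>

lemma btensor_list_pure:
  assumes "\<forall>v\<in>set vs. v \<in> carrier_vec (dA*dB) \<and> unit_vector v"
  shows "\<exists>w. w \<in> carrier_vec (dA ^ length vs * dB ^ length vs) \<and> unit_vector w \<and> btensor_list dA dB (map proj vs) = proj w"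
proof -
  have st: "bstate (dA ^ length vs) (dB ^ length vs) (btensor_list dA dB (map proj vs))"
    using bstate_btensor_list[of "map proj vs" dA dB] assms bstate_proj by fastforce
  have "\<exists>w. w \<in> carrier_vec (dA ^ length vs * dB ^ length vs) \<and> btensor_list dA dB (map proj vs) = proj w"
    using assms
  proof (induction vs)
    case Nil
    show ?case by (intro exI[of _ "vec 1 (\<lambda>_. 1)"]) (auto simp: proj_def intro!: eq_matI)
  next
    case (Cons v vs)
    then obtain w where w: "w \<in> carrier_vec (dA ^ length vs * dB ^ length vs)" "btensor_list dA dB (map proj vs) = proj w" by auto
    show ?case using btensor_proj[of v dA dB w "dA ^ length vs" "dB ^ length vs"] w Cons.prems
      by (intro exI[of _ "vec (dA * dA ^ length vs * (dB * dB ^ length vs)) (\<lambda>i. v $ bidx1 dB (dA ^ length vs) (dB ^ length vs) i * w $ bidx2 dB (dA ^ length vs) (dB ^ length vs) i)"]) simp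
  qed
  then obtain w where w: "w \<in> carrier_vec (dA ^ length vs * dB ^ length vs)" "btensor_list dA dB (map proj vs) = proj w" by blast
  moreover have "unit_vector w" using st w unfolding unit_vector_iff_trace by (simp add: bstate_def density_op_def)
  ultimately show ?thesis by blast
qed

lemma vN_entropy_btensor_list:
  assumes "\<forall>r\<in>set rs. bstate dA dB r"
  shows "vN_entropy (ptrace_B (dA ^ length rs) (dB ^ length rs) (btensor_list dA dB rs)) = (\<Sum>r\<leftarrow>rs. vN_entropy (ptrace_B dA dB r))"
  using assms
proof (induction rs)
  case Nil
  have "ptrace_B 1 1 (1\<^sub>m 1) = 1\<^sub>m 1 * real_diag 1 (\<lambda>_. 1) * adj (1\<^sub>m 1)"
    by (rule eq_matI) (auto simp: real_diag_def scalar_prod_def ptrace_B_def)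
  from vN_entropy_unitary_conj[OF unitary_mat_one this] show ?case by (simp add: xlogx_def)
next
  case (Cons r rs)
  then have "bstate (dA ^ length rs) (dB ^ length rs) (btensor_list dA dB rs)" using bstate_btensor_list by auto
  then show ?case
    using Cons vN_entropy_kron[OF density_ptrace(1) density_ptrace(1)] by (simp add: ptrace_btensor)
qed

text \<open>Linearity of expectation for \<open>N\<close> independent draws. The induction splits
  off the first letter and uses that the product weights of the remaining letters sum to 1.\<close>

lemma sum_lists_iid:
  fixes p s :: "nat \<Rightarrow> real"
  assumes p: "(\<Sum>i<n. p i) = 1"
  shows "(\<Sum>is\<in>{is. set is \<subseteq> {..<n} \<and> length is = N}. (\<Prod>j<N. p (is ! j)) * (\<Sum>i\<leftarrow>is. s i)) = N * (\<Sum>i<n. p i * s i)"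
proof -
  define L where "L N = {is. set is \<subseteq> {..<n} \<and> length is = N}" for N
  have L: "(\<Sum>is\<in>L (Suc N). g is) = (\<Sum>i<n. \<Sum>is\<in>L N. g (i # is))" for g :: "nat list \<Rightarrow> real" and N
  proof -
    have "L (Suc N) = (\<lambda>(i,is). i # is) ` ({..<n} \<times> L N)"
      by (auto simp: L_def length_Suc_conv image_iff)
    moreover have "inj_on (\<lambda>(i,is). i # is) ({..<n} \<times> L N)" by (auto simp: inj_on_def)
    ultimately show ?thesis by (simp add: sum.reindex sum_Times)
  qed
  have P: "(\<Prod>j<Suc N. p ((i # is) ! j)) = p i * (\<Prod>j<N. p (is ! j))" for i "is" N
    by (subst prod.lessThan_Suc_shift) simp
  have L0: "L 0 = {[]}" by (auto simp: L_def)
  have 1: "(\<Sum>is\<in>L N. \<Prod>j<N. p (is ! j)) = 1" for N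
  proof (induction N)
    case (Suc N)
    then show ?case using p unfolding L P by (simp flip: sum_distrib_left)
  qed (simp add: L0)
  have 2: "(\<Sum>is\<in>L N. (\<Prod>j<N. p (is ! j)) * (\<Sum>i\<leftarrow>is. s i)) = N * (\<Sum>i<n. p i * s i)" for N
  proof (induction N)
    case (Suc N)
    have "(\<Sum>is\<in>L (Suc N). (\<Prod>j<Suc N. p (is ! j)) * (\<Sum>i\<leftarrow>is. s i))
      = (\<Sum>i<n. \<Sum>is\<in>L N. p i * s i * (\<Prod>j<N. p (is ! j)) + p i * ((\<Prod>j<N. p (is ! j)) * (\<Sum>i\<leftarrow>is. s i)))"
      unfolding L P by (simp add: algebra_simps)
    also have "\<dots> = (\<Sum>i<n. p i * s i * (\<Sum>is\<in>L N. \<Prod>j<N. p (is ! j)) + p i * (\<Sum>is\<in>L N. (\<Prod>j<N. p (is ! j)) * (\<Sum>i\<leftarrow>is. s i)))"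
      by (simp only: sum.distrib sum_distrib_left)
    also have "\<dots> = (\<Sum>i<n. p i * s i) + (\<Sum>i<n. p i) * (N * (\<Sum>i<n. p i * s i))"
      unfolding 1 Suc by (simp add: sum.distrib sum_distrib_right)
    finally show ?case using p by (simp add: algebra_simps)
  qed (simp add: L0)
  show ?thesis using 2[of N] by (simp add: L_def)
qed

text \<open>By additivity of the entropy the sequence is constant from \<open>N = 1\<close> on, so
  its limit is the average over a single draw. At \<open>N = 0\<close> the definition divides by
  zero.\<close>

lemma source_E_pure:
  assumes E: "pure_normalized E" and p: "(\<Sum>i<n. p i) = 1"
    and \<psi>: "\<forall>i<n. \<psi> i \<in> carrier_vec (dA * dB) \<and> unit_vector (\<psi> i)" and N: "N > 0"
  shows "source_E_seq E dA dB n p (\<lambda>i. proj (\<psi> i)) N = (\<Sum>i<n. p i * vN_entropy (ptrace_B dA dB (proj (\<psi> i))))"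
proof -
  define s where "s i = vN_entropy (ptrace_B dA dB (proj (\<psi> i)))" for i
  have "E (dA ^ N) (dB ^ N) (btensor_list dA dB (map (\<lambda>i. proj (\<psi> i)) is)) = (\<Sum>i\<leftarrow>is. s i)"
    if "is": "set is \<subseteq> {..<n}" "length is = N" for "is"
  proof -
    have eq: "map (\<lambda>i. proj (\<psi> i)) is = map proj (map \<psi> is)" by simp
    have v: "\<forall>v\<in>set (map \<psi> is). v \<in> carrier_vec (dA*dB) \<and> unit_vector v" using \<psi> "is" by auto
    obtain w where w: "w \<in> carrier_vec (dA^N * dB^N)" "unit_vector w" "btensor_list dA dB (map proj (map \<psi> is)) = proj w"
      using btensor_list_pure[OF v] "is" by auto
    have "E (dA^N) (dB^N) (proj w) = vN_entropy (ptrace_B (dA^N) (dB^N) (proj w))"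
      using E w by (simp add: pure_normalized_def)
    also have "\<dots> = (\<Sum>i\<leftarrow>is. s i)"
      using vN_entropy_btensor_list[of "map proj (map \<psi> is)" dA dB] v bstate_proj "is" w(3) by (auto simp: o_def s_def)
    finally show ?thesis unfolding eq w(3) .
  qed
  then have "source_E_seq E dA dB n p (\<lambda>i. proj (\<psi> i)) N
      = (\<Sum>is\<in>{is. set is \<subseteq> {..<n} \<and> length is = N}. (\<Prod>j<N. p (is ! j)) * (\<Sum>i\<leftarrow>is. s i)) / N"
    unfolding source_E_seq_def by (intro arg_cong2[of _ _ _ _ "(/)"] sum.cong refl) auto
  then show ?thesis using N unfolding sum_lists_iid[OF p] by (simp add: s_def)
qed

lemma ens_state_gram:
  fixes n :: nat
  assumes p: "\<forall>i<n. p i > 0" "(\<Sum>i<n. p i) = 1"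
    and \<psi>: "\<forall>i<n. \<psi> i \<in> carrier_vec d \<and> unit_vector (\<psi> i)"
  defines "f \<equiv> \<lambda>i k. complex_of_real (sqrt (p i)) * \<psi> i $ k"
  shows "\<And>k l. k < d \<Longrightarrow> l < d \<Longrightarrow> ens_state d n p (\<lambda>i. proj (\<psi> i)) $$ (k,l) = (\<Sum>i<n. f i k * cnj (f i l))"
    and "(\<Sum>i<n. \<Sum>k<d. (cmod (f i k))\<^sup>2) = 1"
    and "density_op d (ens_state d n p (\<lambda>i. proj (\<psi> i)))"
proof -
  have sq: "complex_of_real (p i) = of_real (sqrt (p i)) * of_real (sqrt (p i))" if "i < n" for i
    using p(1) that by (simp add: less_imp_le flip: of_real_mult)
  have dv: "dim_vec (\<psi> i) = d" if "i < n" for i using \<psi> that by auto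
  show g: "ens_state d n p (\<lambda>i. proj (\<psi> i)) $$ (k,l) = (\<Sum>i<n. f i k * cnj (f i l))" if "k < d" "l < d" for k l
    unfolding ens_state_def using that by (auto simp: proj_def f_def dv sq intro!: sum.cong)
  have "(\<Sum>k<d. (cmod (f i k))\<^sup>2) = p i" if i: "i < n" for i
  proof -
    have "(\<Sum>k<d. (cmod (f i k))\<^sup>2) = (\<Sum>k<d. p i * (cmod (\<psi> i $ k))\<^sup>2)"
      using p(1) i by (intro sum.cong refl) (auto simp: f_def norm_mult power_mult_distrib less_imp_le)
    also have "\<dots> = p i * (\<Sum>k<d. (cmod (\<psi> i $ k))\<^sup>2)" by (simp add: sum_distrib_left)
    also have "(\<Sum>k<d. (cmod (\<psi> i $ k))\<^sup>2) = 1"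
      using \<psi>[rule_format, OF i] dv[OF i] by (simp add: unit_vector_def)
    finally show ?thesis by simp
  qed
  then show norm: "(\<Sum>i<n. \<Sum>k<d. (cmod (f i k))\<^sup>2) = 1" using p(2) by simp
  have c: "ens_state d n p (\<lambda>i. proj (\<psi> i)) \<in> carrier_mat d d" by (simp add: ens_state_def)
  have psd: "psd (ens_state d n p (\<lambda>i. proj (\<psi> i)))" by (rule psd_gram[OF c, where S = "{..<n}" and f = f]) (rule g)
  have "mtrace (ens_state d n p (\<lambda>i. proj (\<psi> i))) = (\<Sum>k<d. \<Sum>i<n. of_real ((cmod (f i k))\<^sup>2))"
    unfolding mtrace_def using c by (simp add: g complex_norm_square del: of_real_power)
  also have "\<dots> = of_real (\<Sum>i<n. \<Sum>k<d. (cmod (f i k))\<^sup>2)" by (subst sum.swap) simp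
  finally show "density_op d (ens_state d n p (\<lambda>i. proj (\<psi> i)))" using c psd norm by (simp add: density_op_def del: of_real_sum)
qed

text \<open>Concavity is applied on either side; the left-hand averages coincide because the two
  marginals of a pure state have the same entropy.\<close>

lemma ensemble_entropy_le:
  fixes n :: nat
  assumes p: "\<forall>i<n. p i > 0" "(\<Sum>i<n. p i) = 1"
    and \<psi>: "\<forall>i<n. \<psi> i \<in> carrier_vec (dA*dB) \<and> unit_vector (\<psi> i)"
  defines "\<rho> \<equiv> ens_state (dA*dB) n p (\<lambda>i. proj (\<psi> i))"
  shows "(\<Sum>i<n. p i * vN_entropy (ptrace_B dA dB (proj (\<psi> i)))) \<le> vN_entropy (ptrace_B dA dB \<rho>)"
    and "(\<Sum>i<n. p i * vN_entropy (ptrace_B dA dB (proj (\<psi> i)))) \<le> vN_entropy (ptrace_A dA dB \<rho>)"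
proof -
  have b: "bstate dA dB (proj (\<psi> i))" if "i < n" for i using bstate_proj \<psi> that by blast
  have "bstate dA dB \<rho>" unfolding bstate_def \<rho>_def by (rule ens_state_gram(3)[OF p \<psi>])
  note \<rho>d = density_ptrace[OF this]
  have \<rho>i: "\<rho> $$ (k,l) = (\<Sum>i<n. complex_of_real (p i) * proj (\<psi> i) $$ (k,l))" if "k < dA*dB" "l < dA*dB" for k l
    using that by (simp add: \<rho>_def ens_state_def)
  show "(\<Sum>i<n. p i * vN_entropy (ptrace_B dA dB (proj (\<psi> i)))) \<le> vN_entropy (ptrace_B dA dB \<rho>)"
  proof (rule vN_entropy_concave)
    show "ptrace_B dA dB \<rho> $$ (k,l) = (\<Sum>i<n. complex_of_real (p i) * ptrace_B dA dB (proj (\<psi> i)) $$ (k,l))"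
      if "k < dA" "l < dA" for k l
      using that by (simp add: index_ptrace_B \<rho>i prod_index_less sum_distrib_left) (rule sum.swap)
  qed (use p \<rho>d density_ptrace[OF b] in \<open>auto simp: density_op_def less_imp_le\<close>)
  have "(\<Sum>i<n. p i * vN_entropy (ptrace_B dA dB (proj (\<psi> i)))) = (\<Sum>i<n. p i * vN_entropy (ptrace_A dA dB (proj (\<psi> i))))"
    using \<psi> by (intro sum.cong refl) (simp add: ptrace_pure_entropy)
  also have "\<dots> \<le> vN_entropy (ptrace_A dA dB \<rho>)"
  proof (rule vN_entropy_concave)
    show "ptrace_A dA dB \<rho> $$ (k,l) = (\<Sum>i<n. complex_of_real (p i) * ptrace_A dA dB (proj (\<psi> i)) $$ (k,l))"
      if "k < dB" "l < dB" for k l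
      using that by (simp add: index_ptrace_A \<rho>i prod_index_less sum_distrib_left) (rule sum.swap)
  qed (use p \<rho>d density_ptrace[OF b] in \<open>auto simp: density_op_def less_imp_le\<close>)
  finally show "(\<Sum>i<n. p i * vN_entropy (ptrace_B dA dB (proj (\<psi> i)))) \<le> vN_entropy (ptrace_A dA dB \<rho>)" .
qed

theorem theorem1:
  fixes E :: "nat \<Rightarrow> nat \<Rightarrow> complex mat \<Rightarrow> real"
    and dA dB n :: nat
    and p :: "nat \<Rightarrow> real"
    and \<psi> :: "nat \<Rightarrow> complex vec"
    and ES Einf :: real
  assumes E_proper: "proper_measure E"
    and p_pos: "\<forall>i<n. p i > 0"
    and p_sum: "(\<Sum>i<n. p i) = 1"
    and psi: "\<forall>i<n. \<psi> i \<in> carrier_vec (dA * dB) \<and> unit_vector (\<psi> i)"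
    and S_pos: "vN_entropy (ens_state (dA * dB) n p (\<lambda>i. proj (\<psi> i))) > 0"
    and ES_lim: "source_E_seq E dA dB n p (\<lambda>i. proj (\<psi> i)) \<longlonglongrightarrow> ES"
    and Einf_lim: "reg_E_seq E dA dB (ens_state (dA * dB) n p (\<lambda>i. proj (\<psi> i))) \<longlonglongrightarrow> Einf"
  shows "(ES - Einf) / shannon n p
           \<le> 1 - \<bar>vN_entropy (ptrace_B dA dB (ens_state (dA * dB) n p (\<lambda>i. proj (\<psi> i))))
                  - vN_entropy (ptrace_A dA dB (ens_state (dA * dB) n p (\<lambda>i. proj (\<psi> i))))\<bar>
                 / vN_entropy (ens_state (dA * dB) n p (\<lambda>i. proj (\<psi> i)))"
proof -
  define \<rho> where "\<rho> = ens_state (dA * dB) n p (\<lambda>i. proj (\<psi> i))"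
  define SA SB S H where "SA = vN_entropy (ptrace_B dA dB \<rho>)" and "SB = vN_entropy (ptrace_A dA dB \<rho>)"
    and "S = vN_entropy \<rho>" and "H = shannon n p"
  note gram = ens_state_gram[OF p_pos p_sum psi, folded \<rho>_def]
  have b: "bstate dA dB \<rho>" using gram(3) by (simp add: bstate_def)
  have \<rho>c: "\<rho> \<in> carrier_mat (dA * dB) (dA * dB)" by (simp add: \<rho>_def ens_state_def)
  have S0: "S > 0" using S_pos by (simp add: S_def \<rho>_def)
  have SH: "S \<le> H"
    unfolding S_def H_def \<rho>_def using p_pos psi by (intro vN_entropy_ensemble_le_shannon) (auto simp: less_imp_le)
  have al: "\<bar>SA - SB\<bar> \<le> S"
    unfolding SA_def SB_def S_def by (rule araki_lieb[OF \<rho>c gram(1,2)])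
  have hash: "SA - S \<le> Einf" "SB - S \<le> Einf"
    unfolding SA_def SB_def S_def using hashing_inequality[OF E_proper b Einf_lim[folded \<rho>_def]] by blast+
  have "\<forall>\<^sub>F N in sequentially. source_E_seq E dA dB n p (\<lambda>i. proj (\<psi> i)) N
      = (\<Sum>i<n. p i * vN_entropy (ptrace_B dA dB (proj (\<psi> i))))"
    using E_proper
    by (intro eventually_mono[OF eventually_gt_at_top[of 0]] source_E_pure p_sum psi) (simp_all add: proper_measure_def)
  then have "ES = (\<Sum>i<n. p i * vN_entropy (ptrace_B dA dB (proj (\<psi> i))))"
    using ES_lim tendsto_eventually LIMSEQ_unique by blast
  then have "ES \<le> SA" "ES \<le> SB"
    using ensemble_entropy_le[OF p_pos p_sum psi] by (simp_all add: SA_def SB_def \<rho>_def)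
  \<comment> \<open>The smaller of \<open>SA\<close> and \<open>SB\<close> bounds \<open>ES\<close>
    from above, the larger one bounds \<open>Einf + S\<close> from below, and the gap between them
    is the absolute value.\<close>
  then have "ES - Einf \<le> S - \<bar>SA - SB\<bar>" using hash by linarith
  then have "(ES - Einf) / H \<le> (S - \<bar>SA - SB\<bar>) / H" using S0 SH by (intro divide_right_mono) auto
  \<comment> \<open>Passing from \<open>H\<close> to the smaller \<open>S\<close> raises the
    quotient because \<open>al\<close> makes the numerator nonnegative.\<close>
  also have "\<dots> \<le> (S - \<bar>SA - SB\<bar>) / S" using S0 SH al by (intro divide_left_mono) auto
  also have "\<dots> = 1 - \<bar>SA - SB\<bar> / S" using S0 by (simp add: diff_divide_distrib)
  finally show ?thesis by (simp add: SA_def SB_def S_def H_def \<rho>_def)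
qed

end
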